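(* For every integer $k\ge0$, $|L_{13}(k)|=T_{13}(k)+\mathcal E_{13}(k)$, where $$T_{13}(k)=\frac{117649}{82080}k^6+\frac{16807}{2280}k^5+\frac{156065}{10944}k^4+\frac{5831}{456}k^3+\frac{71981}{13680}k^2+\frac{959}{1140}k+\frac{27749}{196992}$$ and $$\mathcal E_{13}(k)=\frac{10368\,C_{13}(k)+d_{k\bmod6}}{196992},$$ with $(d_0,d_1,d_2,d_3,d_4,d_5)=(-17381,-18971,-22373,-24347,-22373,-18971)$, and where $C_{13}$ is the function, periodic modulo $114$, whose values $C_{13}(19u+r)$ for $0\le u\le5$ and $0\le r\le18$ are the entries (listed for $r=0,1,\dots,18$ from left to right) of the following rows: $u=0$: $18,\,0,\,60,\,30,\,0,\,-54,\,-54,\,-60,\,60,\,48,\,42,\,-6,\,18,\,-60,\,-12,\,0,\,0,\,-24,\,18$; $u=1$: $0,\,60,\,54,\,36,\,-60,\,-36,\,-72,\,0,\,54,\,54,\,-18,\,12,\,0,\,0,\,-18,\,6,\,-60,\,-6,\,0$; $u=2$: $60,\,54,\,60,\,-24,\,-42,\,-54,\,-12,\,-6,\,60,\,-6,\,0,\,-6,\,60,\,-6,\,-12,\,-54,\,-42,\,-24,\,60$; $u=3$: $54,\,60,\,0,\,-6,\,-60,\,6,\,-18,\,0,\,0,\,12,\,-18,\,54,\,54,\,0,\,-72,\,-36,\,-60,\,36,\,54$; $u=4$: $60,\,0,\,18,\,-24,\,0,\,0,\,-12,\,-60,\,18,\,-6,\,42,\,48,\,60,\,-60,\,-54,\,-54,\,0,\,30,\,60$;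 $u=5$: $0,\,18,\,0,\,36,\,-6,\,6,\,-72,\,-42,\,0,\,54,\,36,\,54,\,0,\,-42,\,-72,\,6,\,-6,\,36,\,0$.
   Context: Notation: $q=e^{2\pi i\tau}$, $\operatorname{Im}\tau>0$; $(x_1,\dots,x_s;q)_\infty=\prod_{i=1}^s\prod_{n\ge0}(1-x_iq^n)$. For $N\ge5$ put $m=\lfloor N/2\rfloor$. For an even integer $a_0\ge0$ and $\mathbf a=(a_1,\dots,a_m)\in\mathbb Z^m$, $$f^{(N)}_{\mathbf a}(\tau)=q^{\frac N{24}S_1-\frac1{2N}S_2}(q^N;q^N)_\infty^{a_0}\prod_{j=1}^m(q^j,q^{N-j};q^N)_\infty^{a_j},\quad S_1=a_0+2\sum_{j=1}^m a_j,\quad S_2=\sum_{j=1}^m j(N-j)a_j.$$ For an integer $k\ge0$, $L_N(k)$ is the set of all $\mathbf a\in\mathbb Z^m$ such that, with $a_0=2k$, $f^{(N)}_{\mathbf a}\in M_k(\Gamma_1(N))$, the space of holomorphic modular forms of weight $k$ on $\Gamma_1(N)=\{\begin{pmatrix}a&b\\c&d\end{pmatrix}\in\mathrm{SL}_2(\mathbb Z):a\equiv d\equiv1,\ c\equiv0\pmod N\}$. Here $N=13$, $m=6$; $k\bmod6\in\{0,\dots,5\}$ denotes the least nonnegative residue. *)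

theory Defs
  imports "HOL-Complex_Analysis.Complex_Analysis" "HOL-Number_Theory.Cong"
begin

section \<open>Modular forms\<close>

definition upper_half_plane :: "complex set" where
  "upper_half_plane = {\<tau>. Im \<tau> > 0}"

definition SL2Z :: "(int^2^2) set" where
  "SL2Z = {A. det A = 1}"

definition Gamma1 :: "nat \<Rightarrow> (int^2^2) set" where
  "Gamma1 N = {A \<in> SL2Z. [A$1$1 = 1] (mod int N) \<and> [A$2$2 = 1] (mod int N)
                         \<and> [A$2$1 = 0] (mod int N)}"

definition slash :: "nat \<Rightarrow> (complex \<Rightarrow> complex) \<Rightarrow> int^2^2 \<Rightarrow> complex \<Rightarrow> complex" where
  "slash k f A \<tau> =
     f ((of_int (A$1$1) * \<tau> + of_int (A$1$2)) / (of_int (A$2$1) * \<tau> + of_int (A$2$2)))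
     / (of_int (A$2$1) * \<tau> + of_int (A$2$2)) ^ k"

text \<open>Functions are total on the complex numbers, but only their restriction to the upper half
  plane is constrained. The last conjunct is holomorphy at all cusps: every translate of \<open>f\<close> under
  the full modular group stays bounded as the imaginary part tends to infinity.\<close>
definition modular_forms :: "nat \<Rightarrow> (int^2^2) set \<Rightarrow> (complex \<Rightarrow> complex) set" where
  "modular_forms k \<Gamma> = {f.
     f holomorphic_on upper_half_plane \<and>
     (\<forall>A\<in>\<Gamma>. \<forall>\<tau>\<in>upper_half_plane. slash k f A \<tau> = f \<tau>) \<and>
     (\<forall>A\<in>SL2Z. \<exists>B R. \<forall>\<tau>\<in>upper_half_plane. Im \<tau> > R \<longrightarrow> norm (slash k f A \<tau>) \<le> B)}"

section \<open>Theta products\<close>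

definition qpoch_inf :: "complex \<Rightarrow> complex \<Rightarrow> complex" where
  "qpoch_inf x q = (\<Prod>n. 1 - x * q ^ n)"

text \<open>\<open>q\<^sup>r\<close> for \<open>q = exp (2\<pi>i\<tau>)\<close> and real \<open>r\<close>, with the branch determined by \<open>\<tau>\<close>.\<close>
definition qpow :: "complex \<Rightarrow> real \<Rightarrow> complex" where
  "qpow \<tau> r = exp (2 * of_real pi * \<i> * \<tau> * of_real r)"

definition S1 :: "nat \<Rightarrow> nat \<Rightarrow> (nat \<Rightarrow> int) \<Rightarrow> int" where
  "S1 N a0 a = int a0 + 2 * (\<Sum>j=1..N div 2. a j)"

definition S2 :: "nat \<Rightarrow> (nat \<Rightarrow> int) \<Rightarrow> int" where
  "S2 N a = (\<Sum>j=1..N div 2. int (j * (N - j)) * a j)"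

definition theta_prod :: "nat \<Rightarrow> nat \<Rightarrow> (nat \<Rightarrow> int) \<Rightarrow> complex \<Rightarrow> complex" where
  "theta_prod N a0 a \<tau> = (let q = qpow \<tau> 1 in
     qpow \<tau> (real N / 24 * of_int (S1 N a0 a) - 1 / (2 * real N) * of_int (S2 N a))
     * qpoch_inf (q ^ N) (q ^ N) ^ a0
     * (\<Prod>j=1..N div 2. (qpoch_inf (q ^ j) (q ^ N) * qpoch_inf (q ^ (N - j)) (q ^ N)) powi (a j)))"

text \<open>A vector in \<open>\<int>\<^sup>m\<close>, where \<open>m = N div 2\<close>, is an extensional function on \<open>{1..m}\<close>, so that
  distinct elements of \<open>L N k\<close> are distinct vectors.\<close>
definition L :: "nat \<Rightarrow> nat \<Rightarrow> (nat \<Rightarrow> int) set" where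
  "L N k = {a \<in> {1..N div 2} \<rightarrow>\<^sub>E (UNIV :: int set).
              theta_prod N (2 * k) a \<in> modular_forms k (Gamma1 N)}"

section \<open>The counting function at level 13\<close>

definition T13 :: "nat \<Rightarrow> real" where
  "T13 k = 117649 / 82080 * real k ^ 6 + 16807 / 2280 * real k ^ 5 + 156065 / 10944 * real k ^ 4
     + 5831 / 456 * real k ^ 3 + 71981 / 13680 * real k ^ 2 + 959 / 1140 * real k + 27749 / 196992"

definition C13_rows :: "int list list" where
  "C13_rows =
    [[18, 0, 60, 30, 0, -54, -54, -60, 60, 48, 42, -6, 18, -60, -12, 0, 0, -24, 18],
     [0, 60, 54, 36, -60, -36, -72, 0, 54, 54, -18, 12, 0, 0, -18, 6, -60, -6, 0],
     [60, 54, 60, -24, -42, -54, -12, -6, 60, -6, 0, -6, 60, -6, -12, -54, -42, -24, 60],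
     [54, 60, 0, -6, -60, 6, -18, 0, 0, 12, -18, 54, 54, 0, -72, -36, -60, 36, 54],
     [60, 0, 18, -24, 0, 0, -12, -60, 18, -6, 42, 48, 60, -60, -54, -54, 0, 30, 60],
     [0, 18, 0, 36, -6, 6, -72, -42, 0, 54, 36, 54, 0, -42, -72, 6, -6, 36, 0]]"

text \<open>Row \<open>u\<close>, column \<open>r\<close> holds the value at \<open>19u + r\<close>; the period is \<open>114 = 6 \<cdot> 19\<close>.\<close>
definition C13 :: "nat \<Rightarrow> int" where
  "C13 k = C13_rows ! ((k mod 114) div 19) ! ((k mod 114) mod 19)"

definition d13 :: "int list" where
  "d13 = [-17381, -18971, -22373, -24347, -22373, -18971]"

definition E13 :: "nat \<Rightarrow> real" where
  "E13 k = of_int (10368 * C13 k + d13 ! (k mod 6)) / 196992"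

end

theory Submission
  imports Defs
begin

text \<open>The theta product is \<open>\<eta>(13\<tau>)\<^sup>2\<^sup>k\<close> times the product over \<open>j\<close> of the \<open>a\<^sub>j\<close>-th powers of the Siegel functions with
  characteristics \<open>(j/13, 0)\<close>, taken at \<open>13\<tau>\<close>. A matrix \<open>\<gamma>\<close> of \<open>SL\<^sub>2(\<int>)\<close> sends the Siegel function with
  characteristics \<open>r\<close> to the one with characteristics \<open>r\<gamma>\<close>, times a twelfth root of unity \<open>\<epsilon>(\<gamma>)\<close> that is also
  the multiplier of \<open>\<eta>\<^sup>2\<close> (\<open>siegel_eta2_modular\<close>). This rests on the inversion formula of the theta function
  (\<open>Theta_inversion\<close>), which is proved by showing that the quotient of its two sides is a pole-free elliptic
  function and by evaluating the resulting constant at the half periods and at \<open>\<tau> = \<i>\<close>.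

  Two things follow. The theta product is invariant under \<open>\<Gamma>\<^sub>1(13)\<close> exactly if \<open>12\<close> divides \<open>k + \<Sum>a\<^sub>j\<close> and \<open>13\<close> divides
  \<open>\<Sum>j\<^sup>2a\<^sub>j\<close>; and its order at every cusp is an explicit linear form in \<open>k\<close> and the exponents, the same number \<open>s\<close> at
  the six cusps over \<open>0\<close> and numbers \<open>v\<^sub>1, \<dots>, v\<^sub>6\<close> at the six cusps over infinity. So the theta product is a modular
  form of weight \<open>k\<close> exactly if both divisibilities hold and all orders are nonnegative
  (\<open>theta_prod_modular_form_iff\<close>).

  The exponents correspond bijectively to the orders, that is, to the solutions in natural numbers of
  \<open>v\<^sub>1 + \<dots> + v\<^sub>6 + 6s = 7k\<close> and \<open>12v\<^sub>1 + 11v\<^sub>2 + 8v\<^sub>3 + 18v\<^sub>4 + 7v\<^sub>5 + v\<^sub>6 \<equiv> 0 (mod 19)\<close>: the cusps over infinity generate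
  a cuspidal class group of order \<open>19\<close> (\<open>card_admissible\<close>). For fixed \<open>n = 7k - 6s\<close> the number of solutions is \<open>1/19\<close> of
  the binomial coefficient of \<open>n + 5\<close> over \<open>5\<close> plus a correction periodic modulo \<open>19\<close>
  (\<open>comp_count_cusp_weights\<close>). Summation over \<open>s\<close> gives a count whose increment from \<open>k\<close> to \<open>k + 6\<close> consists of
  seven such terms; the closed form has the same increments and the same first six values
  (\<open>divisor_count_closed_form\<close>).\<close>

section \<open>Infinite q-Pochhammer symbols\<close>

lemma qpoch_convergent:
  fixes x q :: complex
  assumes "norm q < 1"
  shows "convergent_prod (\<lambda>n. 1 - x * q ^ n)"
proof -
  have "summable (\<lambda>n. norm (- (x * q ^ n)))"
    using assms by (simp add: norm_mult norm_power summable_mult summable_geometric)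
  then have "abs_convergent_prod (\<lambda>n. 1 + - (x * q ^ n))"
    by (intro summable_imp_abs_convergent_prod) simp
  then show ?thesis
    using abs_convergent_prod_imp_convergent_prod by force
qed

lemma qpoch_inf_lim:
  assumes "norm q < 1"
  shows "(\<lambda>n. \<Prod>i<n. 1 - x * q ^ i) \<longlonglongrightarrow> qpoch_inf x q"
proof -
  have "(\<lambda>n. \<Prod>i\<le>n. 1 - x * q ^ i) \<longlonglongrightarrow> qpoch_inf x q"
    unfolding qpoch_inf_def by (rule convergent_prod_LIMSEQ[OF qpoch_convergent[OF assms]])
  then show ?thesis
    by (simp add: LIMSEQ_lessThan_iff_atMost)
qed

lemma qpoch_inf_Suc:
  assumes "norm q < 1"
  shows "qpoch_inf x q = (1 - x) * qpoch_inf (x * q) q"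
proof -
  have "(\<lambda>n. \<Prod>i<Suc n. 1 - x * q ^ i) \<longlonglongrightarrow> qpoch_inf x q"
    using qpoch_inf_lim[OF assms] by (rule LIMSEQ_Suc)
  moreover have "(\<lambda>n. (1 - x) * (\<Prod>i<n. 1 - x * q * q ^ i)) \<longlonglongrightarrow> (1 - x) * qpoch_inf (x * q) q"
    by (intro tendsto_intros qpoch_inf_lim assms)
  ultimately show ?thesis
    unfolding prod.lessThan_Suc_shift
    by (simp add: mult.assoc LIMSEQ_unique)
qed

lemma qpoch_inf_eq_0_iff:
  assumes "norm q < 1"
  shows "qpoch_inf x q = 0 \<longleftrightarrow> (\<exists>n. x * q ^ n = 1)"
proof -
  have "(\<lambda>n. 1 - x * q ^ n) has_prod qpoch_inf x q"
    unfolding qpoch_inf_def using qpoch_convergent[OF assms] by blast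
  then show ?thesis
    by (auto simp: has_prod_eq_0_iff)
qed

lemma qpoch_inf_mult_minus:
  assumes "norm q < 1"
  shows "qpoch_inf x q * qpoch_inf (- x) q = qpoch_inf (x\<^sup>2) (q\<^sup>2)"
proof -
  have q2: "norm (q\<^sup>2) < 1"
    using assms by (simp add: norm_power power_less_one_iff)
  have "(\<lambda>n. (\<Prod>i<n. 1 - x * q ^ i) * (\<Prod>i<n. 1 - (- x) * q ^ i))
          \<longlonglongrightarrow> qpoch_inf x q * qpoch_inf (- x) q"
    by (intro tendsto_intros qpoch_inf_lim assms)
  also have "(\<lambda>n. (\<Prod>i<n. 1 - x * q ^ i) * (\<Prod>i<n. 1 - (- x) * q ^ i))
      = (\<lambda>n. \<Prod>i<n. 1 - x\<^sup>2 * (q\<^sup>2) ^ i)"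
    unfolding prod.distrib[symmetric]
    by (intro ext prod.cong refl) (simp add: algebra_simps power2_eq_square power_mult_distrib)
  finally show ?thesis
    using qpoch_inf_lim[OF q2] LIMSEQ_unique by blast
qed

lemma qpoch_inf_split_parity:
  assumes "norm q < 1"
  shows "qpoch_inf x q = qpoch_inf x (q\<^sup>2) * qpoch_inf (x * q) (q\<^sup>2)"
proof -
  have q2: "norm (q\<^sup>2) < 1"
    using assms by (simp add: norm_power power_less_one_iff)
  have "(\<lambda>n. \<Prod>i<2 * n. 1 - x * q ^ i) \<longlonglongrightarrow> qpoch_inf x q"
    using LIMSEQ_subseq_LIMSEQ[OF qpoch_inf_lim[OF assms], of "\<lambda>n. 2 * n"]
    by (simp add: strict_mono_def o_def)
  also have "(\<lambda>n. \<Prod>i<2 * n. 1 - x * q ^ i)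
      = (\<lambda>n. (\<Prod>i<n. 1 - x * (q\<^sup>2) ^ i) * (\<Prod>i<n. 1 - x * q * (q\<^sup>2) ^ i))"
  proof
    fix n show "(\<Prod>i<2 * n. 1 - x * q ^ i)
        = (\<Prod>i<n. 1 - x * (q\<^sup>2) ^ i) * (\<Prod>i<n. 1 - x * q * (q\<^sup>2) ^ i)"
      by (induction n) (simp_all add: mult_ac power_mult[symmetric])
  qed
  finally have "(\<lambda>n. (\<Prod>i<n. 1 - x * (q\<^sup>2) ^ i) * (\<Prod>i<n. 1 - x * q * (q\<^sup>2) ^ i))
      \<longlonglongrightarrow> qpoch_inf x q" .
  moreover have "(\<lambda>n. (\<Prod>i<n. 1 - x * (q\<^sup>2) ^ i) * (\<Prod>i<n. 1 - x * q * (q\<^sup>2) ^ i))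
      \<longlonglongrightarrow> qpoch_inf x (q\<^sup>2) * qpoch_inf (x * q) (q\<^sup>2)"
    by (intro tendsto_intros qpoch_inf_lim q2)
  ultimately show ?thesis by (rule LIMSEQ_unique)
qed

lemma holomorphic_on_qpoch_inf [holomorphic_intros]:
  assumes X: "X holomorphic_on A" and Q: "Q holomorphic_on A" and "open A"
    and Q1: "\<And>z. z \<in> A \<Longrightarrow> norm (Q z) < 1"
  shows "(\<lambda>z. qpoch_inf (X z) (Q z)) holomorphic_on A"
proof (rule holomorphic_uniform_sequence[OF \<open>open A\<close>])
  show "(\<lambda>z. \<Prod>i<n. 1 - X z * Q z ^ i) holomorphic_on A" for n
    by (intro holomorphic_intros X Q)
next
  fix x assume "x \<in> A"
  then obtain d where d: "d > 0" "cball x d \<subseteq> A"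
    using \<open>open A\<close> open_contains_cball by blast
  let ?K = "cball x d"
  have cX: "continuous_on ?K X" and cQ: "continuous_on ?K Q"
    using X Q d holomorphic_on_imp_continuous_on continuous_on_subset by blast+
  obtain B where "\<forall>y\<in>X ` ?K. norm y \<le> B"
    using compact_imp_bounded[OF compact_continuous_image[OF cX compact_cball]]
    unfolding bounded_iff by blast
  then have B: "\<And>z. z \<in> ?K \<Longrightarrow> norm (X z) \<le> B" by blast
  have "\<exists>z0\<in>?K. \<forall>z\<in>?K. norm (Q z) \<le> norm (Q z0)"
    using d by (intro continuous_attains_sup continuous_intros cQ) auto
  then obtain z0 where z0: "z0 \<in> ?K" "\<And>z. z \<in> ?K \<Longrightarrow> norm (Q z) \<le> norm (Q z0)" by blast
  define r where "r = norm (Q z0)"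
  have r: "0 \<le> r" "r < 1" "\<And>z. z \<in> ?K \<Longrightarrow> norm (Q z) \<le> r"
    using z0 Q1 d unfolding r_def by auto
  have "uniformly_convergent_on ?K (\<lambda>N z. \<Sum>n<N. norm (1 - X z * Q z ^ n - 1))"
  proof (rule Weierstrass_m_test')
    show "summable (\<lambda>n. B * r ^ n)"
      using r by (intro summable_mult summable_geometric) auto
    show "norm (norm (1 - X z * Q z ^ n - 1)) \<le> B * r ^ n" if "z \<in> ?K" for n z
      using B[OF that] r(3)[OF that] r(1)
      by (auto simp: norm_mult norm_power intro!: mult_mono power_mono order_trans[OF norm_ge_zero B[OF that]])
  qed
  then have "uniformly_convergent_on ?K (\<lambda>N z. \<Prod>n<N. 1 - X z * Q z ^ n)"
    by (intro uniformly_convergent_on_prod' continuous_intros cX cQ compact_cball)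
  then obtain l where l: "uniform_limit ?K (\<lambda>N z. \<Prod>n<N. 1 - X z * Q z ^ n) l sequentially"
    by (auto simp: uniformly_convergent_on_def)
  have "l z = qpoch_inf (X z) (Q z)" if "z \<in> ?K" for z
    using tendsto_uniform_limitI[OF l that] qpoch_inf_lim[OF Q1, of z] d that
    by (meson LIMSEQ_unique subsetD)
  then have "uniform_limit ?K (\<lambda>N z. \<Prod>n<N. 1 - X z * Q z ^ n) (\<lambda>z. qpoch_inf (X z) (Q z)) sequentially"
    using l by (metis (mono_tags, lifting) uniform_limit_cong')
  then show "\<exists>d>0. cball x d \<subseteq> A \<and>
      uniform_limit (cball x d) (\<lambda>n z. \<Prod>i<n. 1 - X z * Q z ^ i) (\<lambda>z. qpoch_inf (X z) (Q z)) sequentially"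
    using d by blast
qed

lemma qpoch_inf_near_1:
  assumes "norm q \<le> 1 / 2" "norm x \<le> 1 / 8"
  shows "norm (qpoch_inf x q - 1) \<le> 1 / 2"
proof -
  have q1: "norm q < 1" using assms by simp
  have "norm ((\<Prod>i<n. 1 - x * q ^ i) - 1) \<le> 1 / 2" for n
  proof -
    have "norm ((\<Prod>i<n. 1 + - (x * q ^ i)) - 1) \<le> (\<Prod>i<n. 1 + norm (- (x * q ^ i))) - 1"
      by (rule norm_prod_minus1_le_prod_minus1)
    also have "(\<Prod>i<n. 1 + norm (- (x * q ^ i))) \<le> exp (\<Sum>i<n. norm (- (x * q ^ i)))"
      by (intro prod_le_exp_sum) auto
    also have "(\<Sum>i<n. norm (- (x * q ^ i))) \<le> (\<Sum>i<n. 1 / 8 * (1 / 2) ^ i)"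
      unfolding norm_minus_cancel norm_mult norm_power
      using assms by (intro sum_mono mult_mono power_mono) auto
    also have "\<dots> = 1 / 8 * (2 - 2 * (1 / 2) ^ n)"
      by (induction n) (simp_all add: algebra_simps)
    also have "\<dots> \<le> 1 / 4" by simp
    also have "exp (1 / 4) \<le> (3 / 2 :: real)"
      using exp_bound[of "1/4"] by (simp add: power2_eq_square)
    finally show ?thesis by simp
  qed
  moreover have "(\<lambda>n. norm ((\<Prod>i<n. 1 - x * q ^ i) - 1)) \<longlonglongrightarrow> norm (qpoch_inf x q - 1)"
    by (intro tendsto_intros qpoch_inf_lim q1)
  ultimately show ?thesis
    using Lim_bounded by blast
qed

section \<open>The theta function\<close>

text \<open>The function \<open>x \<mapsto> exp (2 \<pi> i x)\<close>. Writing fractional powers of \<open>q\<close> as \<open>ee (r * \<tau>)\<close> fixes the branch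
  and turns every identity between them into a linear identity of exponents.\<close>
definition ee :: "complex \<Rightarrow> complex" where
  "ee x = exp (2 * of_real pi * \<i> * x)"

lemma ee_add: "ee (x + y) = ee x * ee y"
  and ee_0 [simp]: "ee 0 = 1"
  and ee_minus: "ee (- x) = inverse (ee x)"
  and ee_diff: "ee (x - y) = ee x / ee y"
  and ee_nz [simp]: "ee x \<noteq> 0"
  by (simp_all add: ee_def ring_distribs exp_add exp_minus exp_diff)

lemma ee_power: "ee x ^ n = ee (of_nat n * x)"
  by (simp add: ee_def exp_of_nat_mult[symmetric] mult_ac)

lemma norm_ee: "norm (ee x) = exp (- (2 * pi * Im x))"
  by (simp add: ee_def)

lemma norm_ee_less_1 [simp]: "Im \<tau> > 0 \<Longrightarrow> norm (ee \<tau>) < 1"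
  by (simp add: norm_ee)

lemma ee_eq_1_iff: "ee x = 1 \<longleftrightarrow> x \<in> \<int>"
proof -
  have "ee x = 1 \<longleftrightarrow> (\<exists>n::int. Im x = 0 \<and> Re x = of_int n)"
    unfolding ee_def exp_eq_1 by auto
  also have "\<dots> \<longleftrightarrow> x \<in> \<int>"
    by (auto simp: complex_eq_iff elim!: Ints_cases)
       (metis Ints_of_int complex_eq_iff complex.sel of_int_code complex_of_real_def of_real_of_int_eq)
  finally show ?thesis .
qed

lemma ee_of_int [simp]: "ee (of_int n) = 1" and ee_1 [simp]: "ee 1 = 1"
  by (simp_all add: ee_eq_1_iff)

lemma ee_half [simp]: "ee (1 / 2) = -1" "ee (- (1 / 2)) = -1"
  using exp_pi_i by (simp_all add: ee_def exp_minus)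

lemma ee_quarter: "ee (1 / 4) = \<i>"
proof -
  have "ee (1 / 4) = exp (\<i> * of_real (pi / 2))" by (simp add: ee_def mult_ac)
  also have "\<dots> = \<i>" by (simp only: cis_conv_exp[symmetric] cis_pi_half)
  finally show ?thesis .
qed

lemma holomorphic_on_ee [holomorphic_intros]:
  "f holomorphic_on A \<Longrightarrow> (\<lambda>z. ee (f z)) holomorphic_on A"
  unfolding ee_def by (intro holomorphic_intros)

text \<open>With \<open>\<zeta> = ee z\<close> this is \<open>q^(1/12) \<zeta>^(-1/2) (\<zeta>; q) (q/\<zeta>; q)\<close>: up to a constant factor, the quotient of the
  Jacobi theta function \<open>\<theta>\<^sub>1(z, \<tau>)\<close> by \<open>\<eta>(\<tau>)\<close>. It has weight \<open>0\<close> under modular substitutions.\<close>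
definition Theta :: "complex \<Rightarrow> complex \<Rightarrow> complex" where
  "Theta z \<tau> = ee (\<tau> / 12 - z / 2) * qpoch_inf (ee z) (ee \<tau>) * qpoch_inf (ee (\<tau> - z)) (ee \<tau>)"

text \<open>The square \<open>\<eta>(\<tau>)\<^sup>2\<close> of the Dedekind eta function. Only even powers of \<open>\<eta>\<close> occur, so the square
  root is never needed; up to a constant, \<open>\<eta>\<^sup>2\<close> is the derivative of \<^term>\<open>Theta\<close> at \<open>z = 0\<close>.\<close>
definition eta2 :: "complex \<Rightarrow> complex" where
  "eta2 \<tau> = ee (\<tau> / 12) * qpoch_inf (ee \<tau>) (ee \<tau>) ^ 2"

lemma Theta_symmetric_form:
  assumes "Im \<tau> > 0"
  shows "Theta z \<tau> = ee (\<tau> / 12) * (ee (- z / 2) - ee (z / 2))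
           * (qpoch_inf (ee (\<tau> + z)) (ee \<tau>) * qpoch_inf (ee (\<tau> - z)) (ee \<tau>))"
proof -
  have "qpoch_inf (ee z) (ee \<tau>) = (1 - ee z) * qpoch_inf (ee (\<tau> + z)) (ee \<tau>)"
    using qpoch_inf_Suc[of "ee \<tau>" "ee z"] assms by (simp add: ee_add mult_ac)
  moreover have "ee (- z / 2) * (1 - ee z) = ee (- z / 2) - ee (z / 2)"
    by (simp add: ring_distribs flip: ee_add)
  moreover have "ee (\<tau> / 12 - z / 2) = ee (\<tau> / 12) * ee (- z / 2)"
    by (simp flip: ee_add)
  ultimately show ?thesis
    unfolding Theta_def by (metis (no_types, lifting) mult.assoc)
qed

lemma Theta_minus: "Im \<tau> > 0 \<Longrightarrow> Theta (- z) \<tau> = - Theta z \<tau>"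
  by (simp add: Theta_symmetric_form algebra_simps)

lemma Theta_plus_1: "Theta (z + 1) \<tau> = - Theta z \<tau>"
proof -
  have "\<tau> / 12 - (z + 1) / 2 = (\<tau> / 12 - z / 2) + (- 1 / 2)"
    by (simp add: add_divide_distrib)
  then have "ee (\<tau> / 12 - (z + 1) / 2) = ee (\<tau> / 12 - z / 2) * ee (- 1 / 2)"
    by (simp only: ee_add)
  moreover have "ee (z + 1) = ee z" by (simp add: ee_add)
  moreover have "ee (\<tau> - (z + 1)) = ee (\<tau> - z)" by (simp add: ee_diff ee_add)
  ultimately show ?thesis by (simp add: Theta_def)
qed

lemma Theta_eq_0_iff:
  assumes "Im \<tau> > 0"
  shows "Theta z \<tau> = 0 \<longleftrightarrow> (\<exists>m n :: int. z = of_int m + of_int n * \<tau>)"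
proof
  assume "Theta z \<tau> = 0"
  then obtain k where "ee z * ee \<tau> ^ k = 1 \<or> ee (\<tau> - z) * ee \<tau> ^ k = 1"
    using assms by (auto simp: Theta_def qpoch_inf_eq_0_iff)
  then have "z + of_nat k * \<tau> \<in> \<int> \<or> \<tau> - z + of_nat k * \<tau> \<in> \<int>"
    by (simp add: ee_power flip: ee_add ee_eq_1_iff)
  then consider m where "z + of_nat k * \<tau> = of_int m" | m where "\<tau> - z + of_nat k * \<tau> = of_int m"
    by (auto elim!: Ints_cases)
  then show "\<exists>m n :: int. z = of_int m + of_int n * \<tau>"
  proof cases
    case 1
    then have "z = of_int m + of_int (- int k) * \<tau>" by (simp add: algebra_simps)
    then show ?thesis by blast
  next
    case 2
    then have "z = of_int (- m) + of_int (int k + 1) * \<tau>" by (simp add: algebra_simps)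
    then show ?thesis by blast
  qed
next
  assume "\<exists>m n :: int. z = of_int m + of_int n * \<tau>"
  then obtain m n :: int where z: "z = of_int m + of_int n * \<tau>" by blast
  have "\<exists>k. ee z * ee \<tau> ^ k = 1 \<or> ee (\<tau> - z) * ee \<tau> ^ k = 1"
  proof (cases "n \<le> 0")
    case True
    then have "z + of_nat (nat (- n)) * \<tau> = of_int m" by (simp add: z)
    then have "ee z * ee \<tau> ^ nat (- n) = 1" by (simp add: ee_power flip: ee_add)
    then show ?thesis by blast
  next
    case False
    then have "\<tau> - z + of_nat (nat (n - 1)) * \<tau> = of_int (- m)" by (simp add: z algebra_simps)
    then have "ee (\<tau> - z) * ee \<tau> ^ nat (n - 1) = 1" by (simp add: ee_power del: of_int_minus flip: ee_add)
    then show ?thesis by blast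
  qed
  then show "Theta z \<tau> = 0"
    using assms by (auto simp: Theta_def qpoch_inf_eq_0_iff)
qed

lemma Theta_plus_tau:
  assumes "Im \<tau> > 0"
  shows "Theta (z + \<tau>) \<tau> = - ee (- z - \<tau> / 2) * Theta z \<tau>"
proof (cases "ee z = 1")
  case True
  then obtain m where m: "z = of_int m" by (auto simp: ee_eq_1_iff elim: Ints_cases)
  then have "z = of_int m + of_int 0 * \<tau>" "z + \<tau> = of_int m + of_int 1 * \<tau>" by simp_all
  then have "Theta z \<tau> = 0" "Theta (z + \<tau>) \<tau> = 0"
    using assms Theta_eq_0_iff by blast+
  then show ?thesis by simp
next
  case False
  have 1: "qpoch_inf (ee z) (ee \<tau>) = (1 - ee z) * qpoch_inf (ee (z + \<tau>)) (ee \<tau>)"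
    using qpoch_inf_Suc[of "ee \<tau>" "ee z"] assms by (simp add: ee_add mult_ac)
  have 2: "qpoch_inf (ee (\<tau> - (z + \<tau>))) (ee \<tau>) = (1 - ee (- z)) * qpoch_inf (ee (\<tau> - z)) (ee \<tau>)"
    using qpoch_inf_Suc[of "ee \<tau>" "ee (- z)"] assms by (simp add: ee_diff ee_minus field_simps)
  have 3: "ee (\<tau> / 12 - (z + \<tau>) / 2) = ee (\<tau> / 12 - z / 2) * ee (- \<tau> / 2)"
    by (simp add: add_divide_distrib flip: ee_add)
  have 4: "ee (- z - \<tau> / 2) = ee (- z) * ee (- \<tau> / 2)"
    by (simp flip: ee_add)
  have 5: "(1 - ee (- z)) = - ee (- z) * (1 - ee z)"
    by (simp add: ee_minus field_simps)
  show ?thesis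
    unfolding Theta_def 1 2 3 4 5 by (simp add: algebra_simps)
qed

lemma Theta_minus_tau:
  assumes "Im \<tau> > 0"
  shows "Theta (z - \<tau>) \<tau> = - ee (z - \<tau> / 2) * Theta z \<tau>"
proof -
  have "- z + \<tau> = - (z - \<tau>)" by simp
  then show ?thesis
    using Theta_plus_tau[OF assms, of "- z"] Theta_minus[OF assms, of "z - \<tau>"] Theta_minus[OF assms, of z]
    by (metis add.inverse_inverse minus_equation_iff mult_minus_right)
qed

lemma Theta_holomorphic [holomorphic_intros]:
  assumes "open A" "f holomorphic_on A" "g holomorphic_on A" "\<And>z. z \<in> A \<Longrightarrow> Im (g z) > 0"
  shows "(\<lambda>z. Theta (f z) (g z)) holomorphic_on A"
  unfolding Theta_def by (intro holomorphic_intros assms) (use assms in auto)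

lemma eta2_holomorphic [holomorphic_intros]:
  assumes "open A" "g holomorphic_on A" "\<And>z. z \<in> A \<Longrightarrow> Im (g z) > 0"
  shows "(\<lambda>z. eta2 (g z)) holomorphic_on A"
  unfolding eta2_def by (intro holomorphic_intros assms) (use assms in auto)

lemma eta2_nonzero:
  assumes "Im \<tau> > 0"
  shows "eta2 \<tau> \<noteq> 0"
proof -
  have "ee \<tau> * ee \<tau> ^ n \<noteq> 1" for n
  proof
    assume "ee \<tau> * ee \<tau> ^ n = 1"
    then have "norm (ee \<tau>) ^ Suc n = 1" by (metis norm_one norm_power power_Suc)
    then show False
      using norm_ee_less_1[OF assms] power_less_one_iff[of "norm (ee \<tau>)" "Suc n"] by auto
  qed
  then show ?thesis
    using assms by (simp add: eta2_def qpoch_inf_eq_0_iff)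
qed

lemma Theta_over_z_tendsto:
  assumes "Im \<tau> > 0"
  shows "(\<lambda>z. Theta z \<tau> / z) \<midarrow>0\<rightarrow> - 2 * of_real pi * \<i> * eta2 \<tau>"
proof -
  let ?P = "\<lambda>z. qpoch_inf (ee (\<tau> + z)) (ee \<tau>) * qpoch_inf (ee (\<tau> - z)) (ee \<tau>)"
  have "?P holomorphic_on UNIV"
    by (intro holomorphic_intros) (use assms in auto)
  then have "isCont ?P 0"
    using holomorphic_on_imp_continuous_on continuous_on_eq_continuous_at by blast
  then have P: "?P \<midarrow>0\<rightarrow> qpoch_inf (ee \<tau>) (ee \<tau>) ^ 2"
    by (simp add: isCont_def power2_eq_square)
  have "((\<lambda>z. ee (- z / 2) - ee (z / 2)) has_field_derivative - 2 * of_real pi * \<i>) (at 0)"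
    unfolding ee_def by (auto intro!: derivative_eq_intros)
  then have D: "(\<lambda>z. (ee (- z / 2) - ee (z / 2)) / z) \<midarrow>0\<rightarrow> - 2 * of_real pi * \<i>"
    by (simp add: DERIV_def)
  have "(\<lambda>z. ee (\<tau> / 12) * ((ee (- z / 2) - ee (z / 2)) / z) * ?P z) \<midarrow>0\<rightarrow>
     ee (\<tau> / 12) * (- 2 * of_real pi * \<i>) * qpoch_inf (ee \<tau>) (ee \<tau>) ^ 2"
    by (intro tendsto_intros D P)
  then show ?thesis
    by (simp add: Theta_symmetric_form[OF assms] eta2_def mult_ac)
qed

section \<open>Inversion of the theta function\<close>

text \<open>An entire function with the quasi-periods of \<^term>\<open>Theta\<close> that vanishes at \<open>0\<close> is a multiple of it: all zeros
  of \<^term>\<open>Theta\<close> are translates of the simple zero at \<open>0\<close>, so the quotient extends to an elliptic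
  function without poles, which is constant by Liouville's theorem. The limit hypothesis identifies
  the constant.\<close>
lemma entire_eq_Theta:
  assumes \<tau>: "Im \<tau> > 0" and F: "F holomorphic_on UNIV"
    and F1: "\<And>z. F (z + 1) = - F z"
    and F\<tau>: "\<And>z. F (z + \<tau>) = - ee (- z - \<tau> / 2) * F z"
    and F0: "(\<lambda>z. F z / z) \<midarrow>0\<rightarrow> c * (- 2 * of_real pi * \<i> * eta2 \<tau>)"
  shows "F z = c * Theta z \<tau>"
proof -
  define G where "G = (\<lambda>z. Theta z \<tau>)"
  define R where "R = (\<lambda>z. if G z = 0 then c else F z / G z)"
  have G_hol: "G holomorphic_on A" if "open A" for A
    unfolding G_def by (intro holomorphic_intros that) (use \<tau> in auto)
  have G0: "G z = 0 \<longleftrightarrow> (\<exists>m n :: int. z = of_int m + of_int n * \<tau>)" for z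
    unfolding G_def using Theta_eq_0_iff[OF \<tau>] .
  have "G 0 = 0" unfolding G0 by (intro exI[of _ 0]) simp
  have R1: "R (z + 1) = R z" for z
    by (simp add: R_def F1 G_def Theta_plus_1)
  have R\<tau>: "R (z + \<tau>) = R z" for z
    by (simp add: R_def F\<tau> G_def Theta_plus_tau[OF \<tau>])
  have Rm: "R (z + of_int m) = R z" for z and m :: int
  proof (induction m rule: int_induct[of _ 0])
    case (step1 i)
    then show ?case using R1[of "z + of_int i"] by (simp add: add.assoc)
  next
    case (step2 i)
    then show ?case using R1[of "z + of_int i - 1"] by (simp add: algebra_simps)
  qed simp
  have Rn: "R (z + of_int m * \<tau>) = R z" for z and m :: int
  proof (induction m rule: int_induct[of _ 0])
    case (step1 i)
    then show ?case using R\<tau>[of "z + of_int i * \<tau>"] by (simp add: algebra_simps)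
  next
    case (step2 i)
    then show ?case using R\<tau>[of "z + of_int i * \<tau> - \<tau>"] by (simp add: algebra_simps)
  qed simp
  have Rmn: "R (z + (of_int m + of_int n * \<tau>)) = R z" for z and m n :: int
    using Rn[of "z + of_int m" n] Rm[of z m] by (simp add: add.assoc)
  have e: "eta2 \<tau> \<noteq> 0" using eta2_nonzero[OF \<tau>] .
  have Glim: "(\<lambda>z. G z / z) \<midarrow>0\<rightarrow> - 2 * of_real pi * \<i> * eta2 \<tau>"
    unfolding G_def by (rule Theta_over_z_tendsto[OF \<tau>])
  have "eventually (\<lambda>z. G z / z \<noteq> 0) (at 0)"
    using e by (intro tendsto_imp_eventually_ne[OF Glim]) simp
  then obtain r where r: "r > 0" "\<And>z. z \<noteq> 0 \<Longrightarrow> norm z < r \<Longrightarrow> G z \<noteq> 0"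
    by (auto simp: eventually_at)
  have "(\<lambda>z. (F z / z) / (G z / z)) \<midarrow>0\<rightarrow>
      c * (- 2 * of_real pi * \<i> * eta2 \<tau>) / (- 2 * of_real pi * \<i> * eta2 \<tau>)"
    using e by (intro tendsto_divide F0 Glim) simp
  then have "(\<lambda>z. (F z / z) / (G z / z)) \<midarrow>0\<rightarrow> c"
    using e by simp
  moreover have "eventually (\<lambda>z. (F z / z) / (G z / z) = F z / G z) (at 0)"
    by (simp add: eventually_at_filter)
  ultimately have lim: "(\<lambda>z. F z / G z) \<midarrow>0\<rightarrow> c"
    by (rule Lim_transform_eventually)
  have "(\<lambda>z. if z = 0 then c else F z / G z) holomorphic_on ball 0 r"
    using r by (intro removable_singularity holomorphic_on_divide lim G_hol
        holomorphic_on_subset[OF F]) auto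
  moreover have "(if z = 0 then c else F z / G z) = R z" if "z \<in> ball 0 r" for z
    using that r(2)[of z] \<open>G 0 = 0\<close> by (cases "z = 0") (simp_all add: R_def)
  ultimately have "R holomorphic_on ball 0 r"
    by (rule holomorphic_transform)
  then have R_diff_0: "R field_differentiable at 0"
    using r(1) by (simp add: holomorphic_on_imp_differentiable_at)
  have R_hol: "R holomorphic_on UNIV"
    unfolding holomorphic_on_def
  proof
    fix z
    have "R field_differentiable at z"
    proof (cases "G z = 0")
      case False
      have op: "open {z. G z \<noteq> 0}"
      proof -
        have "continuous_on UNIV G" using G_hol holomorphic_on_imp_continuous_on by blast
        then show ?thesis by (intro open_Collect_neq continuous_intros) auto
      qed
      have "(\<lambda>z. F z / G z) holomorphic_on {z. G z \<noteq> 0}"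
        by (intro holomorphic_on_divide G_hol op holomorphic_on_subset[OF F]) auto
      moreover have "F z / G z = R z" if "z \<in> {z. G z \<noteq> 0}" for z
        using that by (simp add: R_def)
      ultimately have "R holomorphic_on {z. G z \<noteq> 0}"
        by (rule holomorphic_transform)
      then show ?thesis
        using False op by (simp add: holomorphic_on_imp_differentiable_at)
    next
      case True
      then obtain m n where z: "z = of_int m + of_int n * \<tau>" using G0 by blast
      have "R w = R (w - z)" for w
        using Rmn[of "w - z" m n] z by simp
      then have eq: "R = R \<circ> (\<lambda>w. w - z)" by auto
      show ?thesis
        by (subst eq, intro field_differentiable_compose)
           (use R_diff_0 in \<open>auto intro!: derivative_intros\<close>)
    qed
    then show "R field_differentiable at z within UNIV" by simp
  qed
  \<comment> \<open>periodicity reduces the range to the image of a compact period parallelogram\<close>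
  have "range R \<subseteq> R ` ((\<lambda>p. of_real (fst p) + of_real (snd p) * \<tau>) ` ({0..1} \<times> {0..1}))"
  proof
    fix w assume "w \<in> range R"
    then obtain z where w: "w = R z" by blast
    define y where "y = Im z / Im \<tau>"
    define x where "x = Re z - y * Re \<tau>"
    have z: "z = of_real x + of_real y * \<tau>"
      using \<tau> by (simp add: complex_eq_iff x_def y_def)
    have "z = (of_real (frac x) + of_real (frac y) * \<tau>) + (of_int \<lfloor>x\<rfloor> + of_int \<lfloor>y\<rfloor> * \<tau>)"
      by (simp add: z frac_def algebra_simps)
    then have "w = R (of_real (frac x) + of_real (frac y) * \<tau>)"
      using Rmn w by metis
    moreover have "(frac x, frac y) \<in> {0..1} \<times> {0..1}"
      by (simp add: frac_ge_0 less_imp_le[OF frac_lt_1])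
    ultimately show "w \<in> R ` ((\<lambda>p. of_real (fst p) + of_real (snd p) * \<tau>) ` ({0..1} \<times> {0..1}))"
      by (metis (mono_tags, lifting) fst_conv imageI snd_conv)
  qed
  moreover have "compact (R ` ((\<lambda>p. of_real (fst p) + of_real (snd p) * \<tau>) ` ({0..1} \<times> {0..1})))"
    by (intro compact_continuous_image compact_Times compact_Icc continuous_intros
        continuous_on_subset[OF holomorphic_on_imp_continuous_on[OF R_hol]]) auto
  ultimately have "bounded (range R)"
    using compact_imp_bounded bounded_subset by blast
  then have "R constant_on UNIV"
    using Liouville_theorem[OF R_hol] by blast
  then have Rc: "R z = R 0"
    unfolding constant_on_def by auto
  have "R z = c" using Rc \<open>G 0 = 0\<close> by (simp add: R_def)
  show ?thesis
  proof (cases "G z = 0")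
    case False
    then show ?thesis using \<open>R z = c\<close> by (simp add: R_def G_def field_simps)
  next
    case True
    \<comment> \<open>at a zero of the denominator the identity follows by continuity from nearby points\<close>
    have "F z = 0"
    proof -
      have c: "isCont F z" "isCont (\<lambda>z. c * G z) z"
        using F G_hol[of UNIV] by (auto simp: holomorphic_on_imp_continuous_on
            intro!: continuous_intros continuous_on_interior[of UNIV])
      have "eventually (\<lambda>w. G w \<noteq> 0) (at z)"
      proof -
        obtain m n where z: "z = of_int m + of_int n * \<tau>" using True G0 by blast
        have "G w \<noteq> 0" if "w \<noteq> z" "dist w z < r" for w
        proof
          assume "G w = 0"
          then obtain m' n' where w: "w = of_int m' + of_int n' * \<tau>" using G0 by blast
          have "w - z = of_int (m' - m) + of_int (n' - n) * \<tau>" by (simp add: w z algebra_simps)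
          then have "G (w - z) = 0" using G0 by blast
          then show False using r(2)[of "w - z"] that by (simp add: dist_norm)
        qed
        then show ?thesis using r(1) by (auto simp: eventually_at)
      qed
      then have "eventually (\<lambda>w. F w = c * G w) (at z)"
      proof eventually_elim
        case (elim w)
        have "R w = R 0" using \<open>R constant_on UNIV\<close> unfolding constant_on_def by auto
        then have "R w = c" using \<open>G 0 = 0\<close> by (simp add: R_def)
        then show ?case using elim by (simp add: R_def field_simps)
      qed
      then have "((\<lambda>w. F w) \<longlongrightarrow> c * G z) (at z)"
        using c(2) unfolding isCont_def by (simp add: tendsto_cong)
      then have "F z = c * G z"
        using c(1) unfolding isCont_def by (rule LIM_unique[rotated])
      then show ?thesis using True by simp
    qed
    then show ?thesis using True by (simp add: G_def)
  qed
qed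

lemma Theta_inversion_up_to_factor:
  assumes \<tau>: "Im \<tau> > 0"
  shows "Theta (z / \<tau>) (- 1 / \<tau>) =
     eta2 (- 1 / \<tau>) / (\<tau> * eta2 \<tau>) * ee (z\<^sup>2 / (2 * \<tau>)) * Theta z \<tau>"
proof -
  define \<tau>' where "\<tau>' = - 1 / \<tau>"
  have [simp]: "\<tau> \<noteq> 0" using \<tau> by auto
  have \<tau>': "Im \<tau>' > 0" using \<tau> unfolding \<tau>'_def Im_divide by (auto intro!: divide_pos_pos add_nonneg_pos)
  define F where "F = (\<lambda>z. Theta (z / \<tau>) \<tau>' * ee (- z\<^sup>2 / (2 * \<tau>)))"
  have "F z = eta2 \<tau>' / (\<tau> * eta2 \<tau>) * Theta z \<tau>"
  proof (rule entire_eq_Theta[OF \<tau>])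
    show "F holomorphic_on UNIV"
      unfolding F_def by (intro holomorphic_intros) (use \<tau>' in auto)
    show "F (z + 1) = - F z" for z
    proof -
      have "(z + 1) / \<tau> = z / \<tau> - \<tau>'" by (simp add: \<tau>'_def field_simps)
      then have "Theta ((z + 1) / \<tau>) \<tau>' = - ee (z / \<tau> - \<tau>' / 2) * Theta (z / \<tau>) \<tau>'"
        using Theta_minus_tau[OF \<tau>'] by simp
      moreover have "ee (z / \<tau> - \<tau>' / 2) * ee (- (z + 1)\<^sup>2 / (2 * \<tau>)) = ee (- z\<^sup>2 / (2 * \<tau>))"
        unfolding ee_add[symmetric]
        by (rule arg_cong[of _ _ ee]) (simp add: \<tau>'_def field_simps power2_eq_square)
      ultimately show ?thesis by (simp add: F_def mult_ac)
    qed
    show "F (z + \<tau>) = - ee (- z - \<tau> / 2) * F z" for z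
    proof -
      have "(z + \<tau>) / \<tau> = z / \<tau> + 1" by (simp add: field_simps)
      then have "Theta ((z + \<tau>) / \<tau>) \<tau>' = - Theta (z / \<tau>) \<tau>'"
        using Theta_plus_1 by simp
      moreover have "ee (- (z + \<tau>)\<^sup>2 / (2 * \<tau>)) = ee (- z - \<tau> / 2) * ee (- z\<^sup>2 / (2 * \<tau>))"
        unfolding ee_add[symmetric]
        by (rule arg_cong[of _ _ ee]) (simp add: field_simps power2_eq_square)
      ultimately show ?thesis by (simp add: F_def mult_ac)
    qed
    have "filterlim (\<lambda>z. z / \<tau>) (at 0) (at 0)"
      by (rule filterlim_atI) (auto intro!: tendsto_eq_intros simp: eventually_at_filter)
    from filterlim_compose[OF Theta_over_z_tendsto[OF \<tau>'] this]
    have "(\<lambda>z. Theta (z / \<tau>) \<tau>' / (z / \<tau>)) \<midarrow>0\<rightarrow> - 2 * of_real pi * \<i> * eta2 \<tau>'" .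
    moreover have "(\<lambda>z. ee (- z\<^sup>2 / (2 * \<tau>)) / \<tau>) \<midarrow>0\<rightarrow> 1 / \<tau>"
      unfolding ee_def by (auto intro!: tendsto_eq_intros)
    ultimately have "(\<lambda>z. Theta (z / \<tau>) \<tau>' / (z / \<tau>) * (ee (- z\<^sup>2 / (2 * \<tau>)) / \<tau>))
        \<midarrow>0\<rightarrow> - 2 * of_real pi * \<i> * eta2 \<tau>' * (1 / \<tau>)"
      by (rule tendsto_mult)
    then show "(\<lambda>z. F z / z) \<midarrow>0\<rightarrow> eta2 \<tau>' / (\<tau> * eta2 \<tau>) * (- 2 * of_real pi * \<i> * eta2 \<tau>)"
      using eta2_nonzero[OF \<tau>] by (simp add: F_def field_simps)
  qed
  then have "Theta (z / \<tau>) \<tau>' = eta2 \<tau>' / (\<tau> * eta2 \<tau>) * Theta z \<tau> / ee (- z\<^sup>2 / (2 * \<tau>))"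
    unfolding F_def nonzero_eq_divide_eq[OF ee_nz] .
  moreover have "ee (- z\<^sup>2 / (2 * \<tau>)) = inverse (ee (z\<^sup>2 / (2 * \<tau>)))"
    by (simp only: minus_divide_left[symmetric] ee_minus)
  ultimately show ?thesis
    unfolding \<tau>'_def[symmetric] by (simp only: divide_inverse inverse_inverse_eq mult_ac)
qed

text \<open>Because of the product identity \<open>(-q; q) (p; q) (-p; q) = 1\<close> with \<open>p\<^sup>2 = q\<close>, the product of the three values at the
  half periods is explicit. The inversion permutes these values up to explicit factors, which determines its factor up to
  a cube root of unity.\<close>
lemma Theta_half_periods:
  assumes \<tau>: "Im \<tau> > 0"
  shows "Theta (1 / 2) \<tau> * Theta (\<tau> / 2) \<tau> * Theta ((1 + \<tau>) / 2) \<tau> = - 2 * ee (- \<tau> / 4)"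
proof -
  define p where "p = ee (\<tau> / 2)"
  define q where "q = ee \<tau>"
  have q: "q = p\<^sup>2" by (simp add: p_def q_def ee_power)
  have p0 [simp]: "p \<noteq> 0" by (simp add: p_def)
  have nq: "norm q < 1" using \<tau> by (simp add: q_def)
  have np: "norm p < 1" using \<tau> by (simp add: p_def)
  have nq2: "norm (q\<^sup>2) < 1" using nq by (simp add: norm_power power_less_one_iff)
  have T1: "Theta (1 / 2) \<tau> = ee (\<tau> / 12 - 1 / 4) * (2 * qpoch_inf (- q) q * qpoch_inf (- q) q)"
    using qpoch_inf_Suc[OF nq, of "-1"] by (simp add: Theta_def ee_diff q_def)
  have T2: "Theta (\<tau> / 2) \<tau> = ee (\<tau> / 12 - \<tau> / 4) * (qpoch_inf p q * qpoch_inf p q)"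
    by (simp add: Theta_def p_def q_def mult.assoc)
  have T3: "Theta ((1 + \<tau>) / 2) \<tau>
      = ee (\<tau> / 12 - (1 + \<tau>) / 4) * (qpoch_inf (- p) q * qpoch_inf (- p) q)"
  proof -
    have "ee ((1 + \<tau>) / 2) = - p"
      by (simp add: add_divide_distrib ee_add p_def)
    moreover have "ee (\<tau> - (1 + \<tau>) / 2) = - p"
    proof -
      have "\<tau> - (1 + \<tau>) / 2 = - (1 / 2) + \<tau> / 2" by (simp add: field_simps)
      then show ?thesis by (simp only: ee_add p_def) simp
    qed
    ultimately show ?thesis by (simp add: Theta_def q_def mult.assoc)
  qed
  have Y: "qpoch_inf (- q) q * (qpoch_inf p q * qpoch_inf (- p) q) = 1"
  proof -
    have 1: "qpoch_inf p q * qpoch_inf (- p) q = qpoch_inf q (q\<^sup>2)"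
      using qpoch_inf_mult_minus[OF nq, of p] q by simp
    have 2: "qpoch_inf q q * qpoch_inf (- q) q = qpoch_inf (q\<^sup>2) (q\<^sup>2)"
      by (rule qpoch_inf_mult_minus[OF nq])
    have 3: "qpoch_inf q q = qpoch_inf q (q\<^sup>2) * qpoch_inf (q\<^sup>2) (q\<^sup>2)"
      using qpoch_inf_split_parity[OF nq, of q] by (simp add: power2_eq_square)
    have "qpoch_inf (q\<^sup>2) (q\<^sup>2) \<noteq> 0"
    proof
      assume "qpoch_inf (q\<^sup>2) (q\<^sup>2) = 0"
      then obtain n where "q\<^sup>2 * (q\<^sup>2) ^ n = 1" using nq2 by (auto simp: qpoch_inf_eq_0_iff)
      then have "norm (q\<^sup>2) ^ Suc n = 1" by (metis norm_one norm_power power_Suc)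
      then show False using nq2 power_less_one_iff[of "norm (q\<^sup>2)" "Suc n"] by auto
    qed
    moreover have "qpoch_inf (q\<^sup>2) (q\<^sup>2) * (qpoch_inf (- q) q * qpoch_inf q (q\<^sup>2)) = qpoch_inf (q\<^sup>2) (q\<^sup>2)"
      using 2 unfolding 3 by (simp only: mult_ac)
    ultimately show ?thesis unfolding 1 by simp
  qed
  have X: "ee (\<tau> / 12 - 1 / 4) * ee (\<tau> / 12 - \<tau> / 4) * ee (\<tau> / 12 - (1 + \<tau>) / 4) = - ee (- \<tau> / 4)"
  proof -
    have "\<tau> / 12 - 1 / 4 + (\<tau> / 12 - \<tau> / 4) + (\<tau> / 12 - (1 + \<tau>) / 4) = - (1 / 2) + - \<tau> / 4"
      by (simp add: field_simps)
    then show ?thesis by (metis ee_add ee_half(2) mult_minus1)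
  qed
  have "Theta (1 / 2) \<tau> * Theta (\<tau> / 2) \<tau> * Theta ((1 + \<tau>) / 2) \<tau>
      = 2 * (ee (\<tau> / 12 - 1 / 4) * ee (\<tau> / 12 - \<tau> / 4) * ee (\<tau> / 12 - (1 + \<tau>) / 4))
        * (qpoch_inf (- q) q * (qpoch_inf p q * qpoch_inf (- p) q))\<^sup>2"
    unfolding T1 T2 T3 power2_eq_square by (simp only: mult_ac)
  also have "\<dots> = - 2 * ee (- \<tau> / 4)" unfolding X Y by simp
  finally show ?thesis .
qed

lemma inversion_factor_cubed:
  assumes \<tau>: "Im \<tau> > 0"
  shows "(eta2 (- 1 / \<tau>) / (\<tau> * eta2 \<tau>)) ^ 3 = \<i>"
proof -
  define \<tau>' where "\<tau>' = - 1 / \<tau>"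
  define c where "c = eta2 \<tau>' / (\<tau> * eta2 \<tau>)"
  have [simp]: "\<tau> \<noteq> 0" using \<tau> by auto
  have \<tau>': "Im \<tau>' > 0"
    using \<tau> unfolding \<tau>'_def Im_divide by (auto intro!: divide_pos_pos add_nonneg_pos)
  have inv: "Theta (z / \<tau>) \<tau>' = c * ee (z\<^sup>2 / (2 * \<tau>)) * Theta z \<tau>" for z
    using Theta_inversion_up_to_factor[OF \<tau>, of z] by (simp add: c_def \<tau>'_def)
  have 1: "Theta (\<tau>' / 2) \<tau>' = - (c * ee (1 / (8 * \<tau>)) * Theta (1 / 2) \<tau>)"
  proof -
    have "1 / 2 / \<tau> = - (\<tau>' / 2)" "(1 / 2)\<^sup>2 / (2 * \<tau>) = 1 / (8 * \<tau>)"
      by (simp_all add: \<tau>'_def power2_eq_square field_simps)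
    then show ?thesis
      using inv[of "1 / 2"] Theta_minus[OF \<tau>', of "\<tau>' / 2"] by (metis minus_equation_iff)
  qed
  have 2: "Theta (1 / 2) \<tau>' = c * ee (\<tau> / 8) * Theta (\<tau> / 2) \<tau>"
    using inv[of "\<tau> / 2"] by (simp add: power2_eq_square)
  have 3: "Theta ((1 + \<tau>') / 2) \<tau>' = c * ee ((1 + \<tau>)\<^sup>2 / (8 * \<tau>)) * Theta ((1 + \<tau>) / 2) \<tau>"
  proof -
    have "(1 + \<tau>) / 2 / \<tau> = - ((\<tau>' - 1) / 2)" by (simp add: \<tau>'_def field_simps)
    then have "Theta ((1 + \<tau>) / 2 / \<tau>) \<tau>' = - Theta ((\<tau>' - 1) / 2) \<tau>'"
      using Theta_minus[OF \<tau>'] by simp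
    also have "\<dots> = Theta ((\<tau>' - 1) / 2 + 1) \<tau>'" by (simp only: Theta_plus_1)
    also have "(\<tau>' - 1) / 2 + 1 = (1 + \<tau>') / 2" by (simp add: field_simps)
    finally show ?thesis
      using inv[of "(1 + \<tau>) / 2"] by (simp add: power_divide)
  qed
  have "- 2 * ee (- \<tau>' / 4) = Theta (1 / 2) \<tau>' * Theta (\<tau>' / 2) \<tau>' * Theta ((1 + \<tau>') / 2) \<tau>'"
    by (rule Theta_half_periods[OF \<tau>', symmetric])
  also have "\<dots> = - (c ^ 3 * (ee (1 / (8 * \<tau>)) * ee (\<tau> / 8) * ee ((1 + \<tau>)\<^sup>2 / (8 * \<tau>)))
      * (Theta (1 / 2) \<tau> * Theta (\<tau> / 2) \<tau> * Theta ((1 + \<tau>) / 2) \<tau>))"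
    unfolding 1 2 3 by (simp add: power3_eq_cube mult_ac)
  also have "\<dots> = 2 * (c ^ 3 * (ee (1 / (8 * \<tau>)) * ee (\<tau> / 8) * ee ((1 + \<tau>)\<^sup>2 / (8 * \<tau>)) * ee (- \<tau> / 4)))"
    unfolding Theta_half_periods[OF \<tau>] by simp
  also have "ee (1 / (8 * \<tau>)) * ee (\<tau> / 8) * ee ((1 + \<tau>)\<^sup>2 / (8 * \<tau>)) * ee (- \<tau> / 4)
      = ee (1 / 4 + - \<tau>' / 4)"
  proof -
    have "(1 + \<tau>)\<^sup>2 / (8 * \<tau>) = 1 / (8 * \<tau>) + 1 / 4 + \<tau> / 8"
      by (simp add: field_simps power2_eq_square)
    moreover have "- \<tau>' / 4 = 1 / (8 * \<tau>) + 1 / (8 * \<tau>)"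
      by (simp add: \<tau>'_def)
    ultimately show ?thesis
      unfolding ee_add[symmetric] by (intro arg_cong[of _ _ ee]) simp
  qed
  also have "\<dots> = \<i> * ee (- \<tau>' / 4)"
    by (simp only: ee_add ee_quarter)
  finally have "- 2 * ee (- \<tau>' / 4) = 2 * (c ^ 3 * (\<i> * ee (- \<tau>' / 4)))" .
  moreover have "x * y = - 1" if "- 2 * e = 2 * (x * (y * e))" "e \<noteq> 0" for x y e :: complex
  proof -
    have "2 * e * (x * y + 1) = 2 * (x * (y * e)) - (- 2 * e)" by (simp add: algebra_simps)
    also have "\<dots> = 0" unfolding that(1) by simp
    finally have "2 * e * (x * y + 1) = 0" .
    then show ?thesis using that(2) by (simp add: eq_neg_iff_add_eq_0)
  qed
  ultimately have "c ^ 3 * \<i> = - 1" using ee_nz by blast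
  then have "c ^ 3 * \<i> * \<i> = - \<i>" by simp
  then have "c ^ 3 = \<i>" by (simp add: mult.assoc)
  then show ?thesis by (simp add: c_def \<tau>'_def)
qed

text \<open>The factor depends continuously on \<open>\<tau>\<close> and takes finitely many values, so it is constant; its value
  is read off at the fixed point \<open>\<i>\<close> of the inversion.\<close>
lemma inversion_factor:
  assumes \<tau>: "Im \<tau> > 0"
  shows "eta2 (- 1 / \<tau>) / (\<tau> * eta2 \<tau>) = - \<i>"
proof -
  define H where "H = {\<tau>. Im \<tau> > 0}"
  define c where "c = (\<lambda>\<tau>. eta2 (- 1 / \<tau>) / (\<tau> * eta2 \<tau>))"
  have inH: "Im (- 1 / \<tau>) > 0" if "Im \<tau> > 0" for \<tau>
    using that unfolding Im_divide by (auto intro!: divide_pos_pos add_nonneg_pos)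
  have "open H" by (simp add: H_def open_halfspace_Im_gt)
  have "c holomorphic_on H"
    unfolding c_def using eta2_nonzero inH
    by (intro holomorphic_intros \<open>open H\<close>) (auto simp: H_def)
  then have "continuous_on H c" by (rule holomorphic_on_imp_continuous_on)
  moreover have "connected H" by (auto simp: H_def)
  moreover have "finite (c ` H)"
  proof (rule finite_subset)
    have "c \<tau> ^ 12 = 1" if "\<tau> \<in> H" for \<tau>
    proof -
      have "c \<tau> ^ 12 = (c \<tau> ^ 3) ^ 4" by (simp flip: power_mult)
      also have "c \<tau> ^ 3 = \<i>" using inversion_factor_cubed that by (simp add: c_def H_def)
      finally show ?thesis by simp
    qed
    then show "c ` H \<subseteq> {z. z ^ 12 = 1}" by auto
    show "finite {z::complex. z ^ 12 = 1}" by (rule finite_roots_unity) simp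
  qed
  ultimately have "c constant_on H" using continuous_finite_range_constant by blast
  moreover have "\<tau> \<in> H" "\<i> \<in> H" using \<tau> by (auto simp: H_def)
  ultimately have "c \<tau> = c \<i>" unfolding constant_on_def by metis
  also have "c \<i> = - \<i>"
    using eta2_nonzero[of \<i>] by (simp add: c_def field_simps)
  finally show ?thesis by (simp add: c_def)
qed

lemma eta2_inversion: "Im \<tau> > 0 \<Longrightarrow> eta2 (- 1 / \<tau>) = - \<i> * \<tau> * eta2 \<tau>"
  using inversion_factor[of \<tau>] eta2_nonzero[of \<tau>]
  by (cases "\<tau> = 0") (simp_all add: divide_eq_eq mult_ac)

lemma Theta_inversion:
  "Im \<tau> > 0 \<Longrightarrow> Theta (z / \<tau>) (- 1 / \<tau>) = - \<i> * ee (z\<^sup>2 / (2 * \<tau>)) * Theta z \<tau>"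
  unfolding Theta_inversion_up_to_factor[of \<tau> z] inversion_factor ..

section \<open>The action of the modular group\<close>

lemma eta2_translation: "eta2 (\<tau> + of_int n) = ee (of_int n / 12) * eta2 \<tau>"
  by (simp add: eta2_def add_divide_distrib ee_add)

lemma Theta_translation: "Theta z (\<tau> + of_int n) = ee (of_int n / 12) * Theta z \<tau>"
proof -
  have "ee ((\<tau> + of_int n) / 12 - z / 2) = ee (of_int n / 12) * ee (\<tau> / 12 - z / 2)"
    unfolding ee_add[symmetric] by (rule arg_cong[of _ _ ee]) (simp add: field_simps)
  moreover have "ee (\<tau> + of_int n - z) = ee (\<tau> - z)"
    by (simp add: ee_add ee_diff)
  ultimately show ?thesis by (simp add: Theta_def ee_add)
qed

lemma automorphy_factor_nonzero:
  assumes "Im \<tau> > 0" "(a::int) * d - b * c = 1"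
  shows "of_int c * \<tau> + of_int d \<noteq> 0"
proof
  assume "of_int c * \<tau> + of_int d = 0"
  then have "Im (of_int c * \<tau> + of_int d) = 0" "Re (of_int c * \<tau> + of_int d) = 0" by simp_all
  then have "c = 0" "d = 0" using assms(1) by simp_all
  then show False using assms(2) by simp
qed

lemma Im_moebius_pos:
  assumes "Im \<tau> > 0" "(a::int) * d - b * c = 1"
  shows "Im ((of_int a * \<tau> + of_int b) / (of_int c * \<tau> + of_int d)) > 0"
proof -
  let ?j = "of_int c * \<tau> + of_int d"
  have j: "?j \<noteq> 0" by (rule automorphy_factor_nonzero[OF assms])
  have "real_of_int a * d - b * c = 1" using assms(2) by (metis of_int_1 of_int_diff of_int_mult)
  moreover have "Im (of_int a * \<tau> + of_int b) * Re ?j - Re (of_int a * \<tau> + of_int b) * Im ?j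
      = (real_of_int a * d - b * c) * Im \<tau>"
    by (simp add: algebra_simps)
  ultimately have "Im ((of_int a * \<tau> + of_int b) / ?j) = Im \<tau> / ((Re ?j)\<^sup>2 + (Im ?j)\<^sup>2)"
    unfolding Im_divide by simp
  also have "\<dots> > 0"
    using assms(1) j by (intro divide_pos_pos) (simp_all add: complex_neq_0 del: plus_complex.sel)
  finally show ?thesis .
qed

text \<open>The group \<open>SL\<^sub>2(\<int>)\<close> is generated by translation and inversion; the induction is the Euclidean algorithm
  on the first column of the matrix. What matters is that the same twelfth root of unity \<open>\<epsilon>\<close> occurs for
  \<^term>\<open>eta2\<close> and for \<^term>\<open>Theta\<close>.\<close>
lemma Theta_eta2_modular:
  fixes a b c d :: int
  assumes "a * d - b * c = 1"
  shows "\<exists>\<epsilon>. \<epsilon> ^ 12 = 1 \<and> (\<forall>\<tau>. Im \<tau> > 0 \<longrightarrow>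
     eta2 ((of_int a * \<tau> + of_int b) / (of_int c * \<tau> + of_int d))
       = \<epsilon> * (of_int c * \<tau> + of_int d) * eta2 \<tau> \<and>
     (\<forall>z. Theta (z / (of_int c * \<tau> + of_int d)) ((of_int a * \<tau> + of_int b) / (of_int c * \<tau> + of_int d))
       = \<epsilon> * ee (of_int c * z\<^sup>2 / (2 * (of_int c * \<tau> + of_int d))) * Theta z \<tau>))"
  using assms
proof (induction "nat \<bar>c\<bar>" arbitrary: a b c d rule: less_induct)
  case less
  have ee12: "ee (of_int n / 12) ^ 12 = 1" for n
    by (simp add: ee_power)
  show ?case
  proof (cases "c = 0")
    case True
    then have "a * d = 1" using less.prems by simp
    then consider "a = 1" "d = 1" | "a = - 1" "d = - 1"
      using zmult_eq_1_iff by blast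
    then show ?thesis
    proof cases
      case 1
      then show ?thesis using True
        by (intro exI[of _ "ee (of_int b / 12)"])
           (simp add: ee12 eta2_translation Theta_translation)
    next
      case 2
      have "eta2 (\<tau> - of_int b) = ee (of_int (- b) / 12) * eta2 \<tau>"
        "Theta z (\<tau> - of_int b) = ee (of_int (- b) / 12) * Theta z \<tau>" for \<tau> z
        using eta2_translation[of \<tau> "- b"] Theta_translation[of z \<tau> "- b"] by simp_all
      then show ?thesis using True 2 ee12[of "- b"]
        by (intro exI[of _ "- ee (of_int (- b) / 12)"])
           (simp add: Theta_minus)
    qed
  next
    case False
    \<comment> \<open>the matrix is a translation by \<open>n\<close>, times the inversion, times a matrix with lower left entry \<open>-r\<close>\<close>
    define n r b' where "n = a div c" and "r = a mod c" and "b' = b - n * d"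
    have a: "a = n * c + r" by (simp add: n_def r_def)
    have b: "b = n * d + b'" by (simp add: b'_def)
    have det: "r * d - b' * c = 1" using less.prems by (simp add: a b algebra_simps)
    have det2: "c * (- b') - d * (- r) = 1" using det by (simp add: algebra_simps)
    have "\<bar>r\<bar> < \<bar>c\<bar>" using False by (simp add: r_def abs_mod_less)
    then have "nat \<bar>- r\<bar> < nat \<bar>c\<bar>" by simp
    from less.hyps[OF this det2] obtain \<epsilon> where \<epsilon>: "\<epsilon> ^ 12 = 1"
      and IH: "\<And>\<tau>. Im \<tau> > 0 \<Longrightarrow>
        eta2 ((of_int c * \<tau> + of_int d) / (of_int (- r) * \<tau> + of_int (- b')))
          = \<epsilon> * (of_int (- r) * \<tau> + of_int (- b')) * eta2 \<tau>"
      "\<And>\<tau> z. Im \<tau> > 0 \<Longrightarrow>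
        Theta (z / (of_int (- r) * \<tau> + of_int (- b'))) ((of_int c * \<tau> + of_int d) / (of_int (- r) * \<tau> + of_int (- b')))
          = \<epsilon> * ee (of_int (- r) * z\<^sup>2 / (2 * (of_int (- r) * \<tau> + of_int (- b')))) * Theta z \<tau>"
      by blast
    have "(- \<i> * ee (of_int n / 12) * \<epsilon>) ^ 12 = 1"
      by (simp add: power_mult_distrib ee12 \<epsilon>)
    moreover have
      "eta2 ((of_int a * \<tau> + of_int b) / (of_int c * \<tau> + of_int d))
         = (- \<i> * ee (of_int n / 12) * \<epsilon>) * (of_int c * \<tau> + of_int d) * eta2 \<tau> \<and>
       (\<forall>z. Theta (z / (of_int c * \<tau> + of_int d)) ((of_int a * \<tau> + of_int b) / (of_int c * \<tau> + of_int d))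
         = (- \<i> * ee (of_int n / 12) * \<epsilon>) * ee (of_int c * z\<^sup>2 / (2 * (of_int c * \<tau> + of_int d))) * Theta z \<tau>)"
      if \<tau>: "Im \<tau> > 0" for \<tau>
    proof -
      define j where "j = of_int c * \<tau> + of_int d"
      define j' where "j' = of_int (- r) * \<tau> + of_int (- b')"
      define w where "w = j / j'"
      have j: "j \<noteq> 0" unfolding j_def by (rule automorphy_factor_nonzero[OF \<tau> less.prems])
      have j': "j' \<noteq> 0" unfolding j'_def by (rule automorphy_factor_nonzero[OF \<tau> det2])
      have w: "Im w > 0" unfolding w_def j_def j'_def by (rule Im_moebius_pos[OF \<tau> det2])
      have jw: "j = w * j'" and w0: "w \<noteq> 0" using j j' by (auto simp: w_def)
      have "of_int a * \<tau> + of_int b = of_int n * j - j'"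
        by (simp add: a b j_def j'_def algebra_simps)
      then have g: "(of_int a * \<tau> + of_int b) / j = - 1 / w + of_int n"
        using j j' by (simp add: w_def field_simps)
      have "eta2 ((of_int a * \<tau> + of_int b) / j) = ee (of_int n / 12) * (- \<i> * w * (\<epsilon> * j' * eta2 \<tau>))"
        unfolding g eta2_translation eta2_inversion[OF w]
        using IH(1)[OF \<tau>] by (simp only: w_def j_def j'_def)
      then have e: "eta2 ((of_int a * \<tau> + of_int b) / j) = (- \<i> * ee (of_int n / 12) * \<epsilon>) * j * eta2 \<tau>"
        unfolding jw by (simp only: mult_ac)
      have th: "Theta (z / j) ((of_int a * \<tau> + of_int b) / j)
         = (- \<i> * ee (of_int n / 12) * \<epsilon>) * ee (of_int c * z\<^sup>2 / (2 * j)) * Theta z \<tau>" for z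
      proof -
        have zj: "z / j = (z / j') / w" using j j' by (simp add: w_def)
        have "Theta (z / j') w = \<epsilon> * ee (of_int (- r) * z\<^sup>2 / (2 * j')) * Theta z \<tau>"
          using IH(2)[OF \<tau>] by (simp only: w_def j_def j'_def)
        then have "Theta (z / j) ((of_int a * \<tau> + of_int b) / j)
          = (- \<i> * ee (of_int n / 12) * \<epsilon>) * (ee ((z / j')\<^sup>2 / (2 * w)) * ee (of_int (- r) * z\<^sup>2 / (2 * j'))) * Theta z \<tau>"
          unfolding g Theta_translation zj Theta_inversion[OF w] by (simp only: mult_ac)
        moreover have "(z / j')\<^sup>2 / (2 * w) + of_int (- r) * z\<^sup>2 / (2 * j') = of_int c * z\<^sup>2 / (2 * j)"
        proof -
          have "complex_of_int r * of_int d - of_int b' * of_int c = 1"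
            using det by (metis of_int_1 of_int_diff of_int_mult)
          then have "1 - of_int r * j = of_int c * j'"
            by (simp add: j_def j'_def algebra_simps)
          then have "1 = of_int c * j' + of_int r * j" by (simp add: algebra_simps)
          then have "z\<^sup>2 = (of_int c * j' + of_int r * j) * z\<^sup>2" by simp
          moreover have "(z / j')\<^sup>2 / (2 * w) = z\<^sup>2 / (2 * j * j')"
            using j' by (simp add: w_def power2_eq_square field_simps)
          ultimately have "(z / j')\<^sup>2 / (2 * w) = (of_int c * j' + of_int r * j) * z\<^sup>2 / (2 * j * j')"
            by metis
          also have "\<dots> = of_int c * z\<^sup>2 / (2 * j) - of_int (- r) * z\<^sup>2 / (2 * j')"
            using j j' by (simp add: field_simps)
          finally show ?thesis by simp
        qed
        ultimately show ?thesis by (simp only: ee_add[symmetric])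
      qed
      show ?thesis using e th unfolding j_def by blast
    qed
    ultimately show ?thesis by blast
  qed
qed

section \<open>Siegel functions and orders at infinity\<close>

text \<open>The Siegel function with real characteristics \<open>(r1, r2)\<close>, up to a constant. The exponential factor absorbs the
  theta multiplier, so that modular substitutions merely act on the row vector \<open>(r1, r2)\<close>.\<close>
definition siegel :: "real \<Rightarrow> real \<Rightarrow> complex \<Rightarrow> complex" where
  "siegel r1 r2 \<tau> =
     (let z = of_real r1 * \<tau> + of_real r2 in ee (of_real r1 * z / 2) * Theta z \<tau>)"

lemma siegel_eta2_modular:
  fixes a b c d :: int
  assumes det: "a * d - b * c = 1"
  shows "\<exists>\<epsilon>. \<epsilon> ^ 12 = 1 \<and> (\<forall>\<tau>. Im \<tau> > 0 \<longrightarrow>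
     eta2 ((of_int a * \<tau> + of_int b) / (of_int c * \<tau> + of_int d))
       = \<epsilon> * (of_int c * \<tau> + of_int d) * eta2 \<tau> \<and>
     (\<forall>r1 r2. siegel r1 r2 ((of_int a * \<tau> + of_int b) / (of_int c * \<tau> + of_int d))
       = \<epsilon> * siegel (r1 * of_int a + r2 * of_int c) (r1 * of_int b + r2 * of_int d) \<tau>))"
proof -
  obtain \<epsilon> where \<epsilon>: "\<epsilon> ^ 12 = 1"
    and e: "\<And>\<tau>. Im \<tau> > 0 \<Longrightarrow> eta2 ((of_int a * \<tau> + of_int b) / (of_int c * \<tau> + of_int d))
       = \<epsilon> * (of_int c * \<tau> + of_int d) * eta2 \<tau>"
    and th: "\<And>\<tau> z. Im \<tau> > 0 \<Longrightarrow>
      Theta (z / (of_int c * \<tau> + of_int d)) ((of_int a * \<tau> + of_int b) / (of_int c * \<tau> + of_int d))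
       = \<epsilon> * ee (of_int c * z\<^sup>2 / (2 * (of_int c * \<tau> + of_int d))) * Theta z \<tau>"
    using Theta_eta2_modular[OF det] by blast
  have "siegel r1 r2 ((of_int a * \<tau> + of_int b) / (of_int c * \<tau> + of_int d))
       = \<epsilon> * siegel (r1 * of_int a + r2 * of_int c) (r1 * of_int b + r2 * of_int d) \<tau>"
    if \<tau>: "Im \<tau> > 0" for \<tau> r1 r2
  proof -
    define j where "j = of_int c * \<tau> + of_int d"
    define s1 s2 where "s1 = r1 * of_int a + r2 * of_int c" and "s2 = r1 * of_int b + r2 * of_int d"
    define z where "z = of_real s1 * \<tau> + of_real s2"
    have j: "j \<noteq> 0" unfolding j_def by (rule automorphy_factor_nonzero[OF \<tau> det])
    have zj: "of_real r1 * ((of_int a * \<tau> + of_int b) / j) + of_real r2 = z / j"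
      using j by (simp add: j_def z_def s1_def s2_def field_simps)
    have "of_int c * s2 + r1 = of_int d * s1"
    proof -
      have "real_of_int a * d - b * c = 1" using det by (metis of_int_1 of_int_diff of_int_mult)
      then have "r1 = r1 * (real_of_int a * d - b * c)" by simp
      then show ?thesis by (simp add: s1_def s2_def algebra_simps)
    qed
    then have "of_real (of_int c * s2 + r1) = (of_real (of_int d * s1) :: complex)" by (rule arg_cong)
    then have r1: "of_real r1 + of_int c * z = of_real s1 * j"
      by (simp add: z_def j_def algebra_simps)
    have "of_real r1 * (z / j) / 2 + of_int c * z\<^sup>2 / (2 * j) = of_real s1 * z / 2"
    proof -
      have "of_real r1 * (z / j) / 2 + of_int c * z\<^sup>2 / (2 * j)
          = (of_real r1 + of_int c * z) * (z / (2 * j))"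
        using j by (simp add: field_simps power2_eq_square)
      also have "\<dots> = of_real s1 * z / 2"
        unfolding r1 using j by simp
      finally show ?thesis .
    qed
    then have "ee (of_real r1 * (z / j) / 2) * ee (of_int c * z\<^sup>2 / (2 * j)) = ee (of_real s1 * z / 2)"
      by (simp only: ee_add[symmetric])
    moreover have "siegel r1 r2 ((of_int a * \<tau> + of_int b) / j)
        = \<epsilon> * (ee (of_real r1 * (z / j) / 2) * ee (of_int c * z\<^sup>2 / (2 * j))) * Theta z \<tau>"
      unfolding siegel_def zj Let_def using th[OF \<tau>, of z] by (simp add: j_def)
    ultimately show ?thesis
      unfolding siegel_def Let_def j_def[symmetric] s1_def[symmetric] s2_def[symmetric] z_def[symmetric]
      by simp
  qed
  then show ?thesis using \<epsilon> e by blast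
qed

lemma siegel_shift_2: "siegel r1 (r2 + of_int n) \<tau> = ee (of_int n * (1 + of_real r1) / 2) * siegel r1 r2 \<tau>"
proof (induction n rule: int_induct[of _ 0])
  have step: "siegel r1 (r2 + 1) \<tau> = ee ((1 + of_real r1) / 2) * siegel r1 r2 \<tau>" for r2
  proof -
    define z where "z = of_real r1 * \<tau> + of_real r2"
    have "siegel r1 (r2 + 1) \<tau> = ee (of_real r1 * (z + 1) / 2) * Theta (z + 1) \<tau>"
      unfolding siegel_def Let_def z_def by (simp only: of_real_add of_real_1 add.assoc)
    also have "\<dots> = - ee (of_real r1 * (z + 1) / 2) * Theta z \<tau>"
      unfolding Theta_plus_1 by simp
    also have "- ee (of_real r1 * (z + 1) / 2) = ee (1 / 2 + of_real r1 * (z + 1) / 2)"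
      by (simp only: ee_add ee_half) simp
    also have "1 / 2 + of_real r1 * (z + 1) / 2 = (1 + of_real r1) / 2 + of_real r1 * z / 2"
      by (simp add: field_simps)
    finally show ?thesis unfolding siegel_def Let_def z_def[symmetric] by (simp only: ee_add mult.assoc)
  qed
  {
    case base
    show ?case by simp
  next
    case (step1 i)
    have "siegel r1 (r2 + of_int (i + 1)) \<tau> = ee ((1 + of_real r1) / 2) * (ee (of_int i * (1 + of_real r1) / 2) * siegel r1 r2 \<tau>)"
      using step[of "r2 + of_int i"] step1 by (simp add: add.assoc)
    also have "\<dots> = ee ((1 + of_real r1) / 2 + of_int i * (1 + of_real r1) / 2) * siegel r1 r2 \<tau>"
      by (simp only: ee_add mult.assoc)
    also have "(1 + complex_of_real r1) / 2 + of_int i * (1 + of_real r1) / 2 = of_int (i + 1) * (1 + of_real r1) / 2"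
      by (simp add: field_simps)
    finally show ?case .
  next
    case (step2 i)
    have "siegel r1 (r2 + of_int i) \<tau> = ee ((1 + of_real r1) / 2) * siegel r1 (r2 + of_int (i - 1)) \<tau>"
      using step[of "r2 + of_int (i - 1)"] by (simp add: algebra_simps)
    then have "siegel r1 (r2 + of_int (i - 1)) \<tau> = ee (- ((1 + of_real r1) / 2)) * siegel r1 (r2 + of_int i) \<tau>"
      by (simp add: ee_minus)
    also have "\<dots> = ee (- ((1 + of_real r1) / 2) + of_int i * (1 + of_real r1) / 2) * siegel r1 r2 \<tau>"
      unfolding step2 by (simp only: ee_add mult.assoc)
    also have "- ((1 + complex_of_real r1) / 2) + of_int i * (1 + of_real r1) / 2 = of_int (i - 1) * (1 + of_real r1) / 2"
      by (simp add: field_simps)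
    finally show ?case .
  }
qed

lemma siegel_shift_1:
  assumes \<tau>: "Im \<tau> > 0"
  shows "siegel (r1 + of_int n) r2 \<tau> = ee (of_int n * (1 - of_real r2) / 2) * siegel r1 r2 \<tau>"
proof (induction n rule: int_induct[of _ 0])
  have step: "siegel (r1 + 1) r2 \<tau> = ee ((1 - of_real r2) / 2) * siegel r1 r2 \<tau>" for r1
  proof -
    define z where "z = of_real r1 * \<tau> + of_real r2"
    have "of_real (r1 + 1) * \<tau> + of_real r2 = z + \<tau>" by (simp add: z_def algebra_simps)
    then have "siegel (r1 + 1) r2 \<tau> = ee ((of_real r1 + 1) * (z + \<tau>) / 2) * Theta (z + \<tau>) \<tau>"
      unfolding siegel_def Let_def by simp
    also have "\<dots> = ee (1 / 2) * ee ((of_real r1 + 1) * (z + \<tau>) / 2) * ee (- z - \<tau> / 2) * Theta z \<tau>"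
      unfolding Theta_plus_tau[OF \<tau>] by simp
    also have "\<dots> = ee (1 / 2 + (of_real r1 + 1) * (z + \<tau>) / 2 + (- z - \<tau> / 2)) * Theta z \<tau>"
      by (simp only: ee_add)
    also have "1 / 2 + (of_real r1 + 1) * (z + \<tau>) / 2 + (- z - \<tau> / 2)
        = (1 - of_real r2) / 2 + of_real r1 * z / 2"
      by (simp add: z_def field_simps)
    finally show ?thesis unfolding siegel_def Let_def z_def[symmetric] by (simp only: ee_add mult.assoc)
  qed
  {
    case base
    show ?case by simp
  next
    case (step1 i)
    have "siegel (r1 + of_int (i + 1)) r2 \<tau> = ee ((1 - of_real r2) / 2) * (ee (of_int i * (1 - of_real r2) / 2) * siegel r1 r2 \<tau>)"
      using step[of "r1 + of_int i"] step1 by (simp add: add.assoc)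
    also have "\<dots> = ee ((1 - of_real r2) / 2 + of_int i * (1 - of_real r2) / 2) * siegel r1 r2 \<tau>"
      by (simp only: ee_add mult.assoc)
    also have "(1 - complex_of_real r2) / 2 + of_int i * (1 - of_real r2) / 2 = of_int (i + 1) * (1 - of_real r2) / 2"
      by (simp add: field_simps)
    finally show ?case .
  next
    case (step2 i)
    have "siegel (r1 + of_int i) r2 \<tau> = ee ((1 - of_real r2) / 2) * siegel (r1 + of_int (i - 1)) r2 \<tau>"
      using step[of "r1 + of_int (i - 1)"] by (simp add: algebra_simps)
    then have "siegel (r1 + of_int (i - 1)) r2 \<tau> = ee (- ((1 - of_real r2) / 2)) * siegel (r1 + of_int i) r2 \<tau>"
      by (simp add: ee_minus)
    also have "\<dots> = ee (- ((1 - of_real r2) / 2) + of_int i * (1 - of_real r2) / 2) * siegel r1 r2 \<tau>"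
      unfolding step2 by (simp only: ee_add mult.assoc)
    also have "- ((1 - complex_of_real r2) / 2) + of_int i * (1 - of_real r2) / 2 = of_int (i - 1) * (1 - of_real r2) / 2"
      by (simp add: field_simps)
    finally show ?case .
  }
qed

lemma siegel_nonzero:
  assumes \<tau>: "Im \<tau> > 0" and r: "r1 \<notin> \<int> \<or> r2 \<notin> \<int>"
  shows "siegel r1 r2 \<tau> \<noteq> 0"
proof
  assume "siegel r1 r2 \<tau> = 0"
  then have "Theta (of_real r1 * \<tau> + of_real r2) \<tau> = 0"
    by (simp add: siegel_def Let_def)
  then obtain m n :: int where *: "of_real r1 * \<tau> + of_real r2 = of_int m + of_int n * \<tau>"
    using Theta_eq_0_iff[OF \<tau>] by blast
  from arg_cong[OF *, of Im] have "r1 = of_int n" using \<tau> by simp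
  moreover from this arg_cong[OF *, of Re] have "r2 = of_int m" by simp
  ultimately show False using r by simp
qed

lemma siegel_holomorphic [holomorphic_intros]:
  assumes "open A" "g holomorphic_on A" "\<And>z. z \<in> A \<Longrightarrow> Im (g z) > 0"
  shows "(\<lambda>z. siegel r1 r2 (g z)) holomorphic_on A"
  unfolding siegel_def Let_def by (intro holomorphic_intros assms) (use assms in auto)

text \<open>\<open>F\<close> is bounded above and below by constant multiples of \<open>\<bar>q\<bar>\<^sup>v\<close> as \<open>Im \<tau>\<close> tends to infinity. Two-sided bounds
  are stable under products and negative powers, and they decide boundedness by the sign of \<open>v\<close>.\<close>
definition order_at_infinity :: "(complex \<Rightarrow> complex) \<Rightarrow> real \<Rightarrow> bool" where
  "order_at_infinity F v \<longleftrightarrow> (\<exists>C D R. 0 < C \<and> 0 < D \<and>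
     (\<forall>\<tau>. Im \<tau> > R \<longrightarrow> C * exp (- (2 * pi * v * Im \<tau>)) \<le> norm (F \<tau>) \<and>
                       norm (F \<tau>) \<le> D * exp (- (2 * pi * v * Im \<tau>))))"

lemma order_at_infinityI:
  assumes "0 < C" "0 < D"
    "\<And>\<tau>. Im \<tau> > R \<Longrightarrow> C * exp (- (2 * pi * v * Im \<tau>)) \<le> norm (F \<tau>)"
    "\<And>\<tau>. Im \<tau> > R \<Longrightarrow> norm (F \<tau>) \<le> D * exp (- (2 * pi * v * Im \<tau>))"
  shows "order_at_infinity F v"
  unfolding order_at_infinity_def using assms by blast

lemma order_at_infinity_cong:
  assumes "order_at_infinity F v" "\<And>\<tau>. Im \<tau> > 0 \<Longrightarrow> F \<tau> = G \<tau>"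
  shows "order_at_infinity G v"
proof -
  obtain C D R where CD: "0 < C" "0 < D" "\<And>\<tau>. Im \<tau> > R \<Longrightarrow>
     C * exp (- (2 * pi * v * Im \<tau>)) \<le> norm (F \<tau>) \<and> norm (F \<tau>) \<le> D * exp (- (2 * pi * v * Im \<tau>))"
    using assms(1) unfolding order_at_infinity_def by blast
  show ?thesis
  proof (rule order_at_infinityI[of C D "max R 0"])
    fix \<tau> assume "Im \<tau> > max R 0"
    then show "C * exp (- (2 * pi * v * Im \<tau>)) \<le> norm (G \<tau>)"
      "norm (G \<tau>) \<le> D * exp (- (2 * pi * v * Im \<tau>))"
      using CD(3)[of \<tau>] assms(2)[of \<tau>] by simp_all
  qed (use CD in auto)
qed

lemma order_at_infinity_const: "c \<noteq> 0 \<Longrightarrow> order_at_infinity (\<lambda>\<tau>. c) 0"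
  by (rule order_at_infinityI[of "norm c" "norm c"]) auto

lemma order_at_infinity_mult:
  assumes "order_at_infinity F v" "order_at_infinity G w"
  shows "order_at_infinity (\<lambda>\<tau>. F \<tau> * G \<tau>) (v + w)"
proof -
  obtain C D R where 1: "0 < C" "0 < D" "\<And>\<tau>. Im \<tau> > R \<Longrightarrow>
     C * exp (- (2 * pi * v * Im \<tau>)) \<le> norm (F \<tau>) \<and> norm (F \<tau>) \<le> D * exp (- (2 * pi * v * Im \<tau>))"
    using assms(1) unfolding order_at_infinity_def by blast
  obtain C' D' R' where 2: "0 < C'" "0 < D'" "\<And>\<tau>. Im \<tau> > R' \<Longrightarrow>
     C' * exp (- (2 * pi * w * Im \<tau>)) \<le> norm (G \<tau>) \<and> norm (G \<tau>) \<le> D' * exp (- (2 * pi * w * Im \<tau>))"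
    using assms(2) unfolding order_at_infinity_def by blast
  have e: "x * y * exp (- (2 * pi * (v + w) * t))
      = (x * exp (- (2 * pi * v * t))) * (y * exp (- (2 * pi * w * t)))" for x y t
    by (simp add: exp_add[symmetric] algebra_simps)
  show ?thesis
  proof (rule order_at_infinityI[of "C * C'" "D * D'" "max R R'"])
    fix \<tau> assume "Im \<tau> > max R R'"
    then have b: "C * exp (- (2 * pi * v * Im \<tau>)) \<le> norm (F \<tau>)" "norm (F \<tau>) \<le> D * exp (- (2 * pi * v * Im \<tau>))"
      "C' * exp (- (2 * pi * w * Im \<tau>)) \<le> norm (G \<tau>)" "norm (G \<tau>) \<le> D' * exp (- (2 * pi * w * Im \<tau>))"
      using 1(3) 2(3) by auto
    show "C * C' * exp (- (2 * pi * (v + w) * Im \<tau>)) \<le> norm (F \<tau> * G \<tau>)"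
      unfolding e norm_mult using b 1(1) 2(1) by (intro mult_mono) auto
    show "norm (F \<tau> * G \<tau>) \<le> D * D' * exp (- (2 * pi * (v + w) * Im \<tau>))"
      unfolding e norm_mult using b 1(2) 2(2) by (intro mult_mono) auto
  qed (use 1 2 in auto)
qed

lemma order_at_infinity_inverse:
  assumes "order_at_infinity F v"
  shows "order_at_infinity (\<lambda>\<tau>. inverse (F \<tau>)) (- v)"
proof -
  obtain C D R where 1: "0 < C" "0 < D" "\<And>\<tau>. Im \<tau> > R \<Longrightarrow>
     C * exp (- (2 * pi * v * Im \<tau>)) \<le> norm (F \<tau>) \<and> norm (F \<tau>) \<le> D * exp (- (2 * pi * v * Im \<tau>))"
    using assms(1) unfolding order_at_infinity_def by blast
  have e: "inverse x * exp (- (2 * pi * - v * t)) = inverse (x * exp (- (2 * pi * v * t)))" for x t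
    by (simp add: exp_minus)
  show ?thesis
  proof (rule order_at_infinityI[of "inverse D" "inverse C" R])
    fix \<tau> assume "Im \<tau> > R"
    then have b: "C * exp (- (2 * pi * v * Im \<tau>)) \<le> norm (F \<tau>)" "norm (F \<tau>) \<le> D * exp (- (2 * pi * v * Im \<tau>))"
      using 1(3) by auto
    have pos: "0 < C * exp (- (2 * pi * v * Im \<tau>))" using 1(1) by simp
    show "inverse D * exp (- (2 * pi * - v * Im \<tau>)) \<le> norm (inverse (F \<tau>))"
      unfolding e norm_inverse using b(2) less_le_trans[OF pos b(1)] by (rule le_imp_inverse_le)
    show "norm (inverse (F \<tau>)) \<le> inverse C * exp (- (2 * pi * - v * Im \<tau>))"
      unfolding e norm_inverse using b(1) pos by (rule le_imp_inverse_le)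
  qed (use 1 in auto)
qed

lemma order_at_infinity_power:
  "order_at_infinity F v \<Longrightarrow> order_at_infinity (\<lambda>\<tau>. F \<tau> ^ n) (of_nat n * v)"
proof (induction n)
  case 0
  then show ?case using order_at_infinity_const[of 1] by simp
next
  case (Suc n)
  then show ?case using order_at_infinity_mult[of F v "\<lambda>\<tau>. F \<tau> ^ n" "of_nat n * v"]
    by (simp add: algebra_simps)
qed

lemma order_at_infinity_powi:
  assumes "order_at_infinity F v"
  shows "order_at_infinity (\<lambda>\<tau>. F \<tau> powi n) (of_int n * v)"
proof (cases "n \<ge> 0")
  case True
  then show ?thesis using order_at_infinity_power[OF assms, of "nat n"] by (simp add: power_int_def)
next
  case False
  then show ?thesis
    using order_at_infinity_power[OF order_at_infinity_inverse[OF assms], of "nat (- n)"]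
    by (simp add: power_int_def)
qed

lemma order_at_infinity_prod:
  assumes "\<And>i. i \<in> I \<Longrightarrow> order_at_infinity (F i) (v i)"
  shows "order_at_infinity (\<lambda>\<tau>. \<Prod>i\<in>I. F i \<tau>) (\<Sum>i\<in>I. v i)"
  using assms
proof (induction I rule: infinite_finite_induct)
  case (insert i I)
  then show ?case using order_at_infinity_mult by simp
qed (use order_at_infinity_const[of 1] in simp_all)

lemma order_at_infinity_compose:
  assumes "order_at_infinity F v" "s > 0"
  shows "order_at_infinity (\<lambda>\<tau>. F (of_real s * \<tau> + of_real t)) (s * v)"
proof -
  obtain C D R where 1: "0 < C" "0 < D" "\<And>\<tau>. Im \<tau> > R \<Longrightarrow>
     C * exp (- (2 * pi * v * Im \<tau>)) \<le> norm (F \<tau>) \<and> norm (F \<tau>) \<le> D * exp (- (2 * pi * v * Im \<tau>))"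
    using assms(1) unfolding order_at_infinity_def by blast
  have e: "Im (of_real s * \<tau> + of_real t) = s * Im \<tau>" for \<tau> by simp
  show ?thesis
  proof (rule order_at_infinityI[of C D "R / s"])
    fix \<tau> assume "Im \<tau> > R / s"
    then have "Im (of_real s * \<tau> + of_real t) > R"
      using assms(2) by (simp add: divide_less_eq mult.commute)
    from 1(3)[OF this]
    show "C * exp (- (2 * pi * (s * v) * Im \<tau>)) \<le> norm (F (of_real s * \<tau> + of_real t))"
      "norm (F (of_real s * \<tau> + of_real t)) \<le> D * exp (- (2 * pi * (s * v) * Im \<tau>))"
      unfolding e by (simp_all add: mult_ac)
  qed (use 1 in auto)
qed

text \<open>The growth condition of \<^term>\<open>modular_forms\<close> at a single cusp.\<close>
definition bounded_at_infinity :: "(complex \<Rightarrow> complex) \<Rightarrow> bool" where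
  "bounded_at_infinity F \<longleftrightarrow> (\<exists>B R. \<forall>\<tau>. Im \<tau> > 0 \<longrightarrow> Im \<tau> > R \<longrightarrow> norm (F \<tau>) \<le> B)"

lemma bounded_at_infinity_iff_order_nonneg:
  assumes "order_at_infinity F v"
  shows "bounded_at_infinity F \<longleftrightarrow> v \<ge> 0"
proof -
  obtain C D R where 1: "0 < C" "0 < D" "\<And>\<tau>. Im \<tau> > R \<Longrightarrow>
     C * exp (- (2 * pi * v * Im \<tau>)) \<le> norm (F \<tau>) \<and> norm (F \<tau>) \<le> D * exp (- (2 * pi * v * Im \<tau>))"
    using assms(1) unfolding order_at_infinity_def by blast
  show ?thesis
    unfolding bounded_at_infinity_def
  proof
    assume v: "v \<ge> 0"
    have "norm (F \<tau>) \<le> D" if "Im \<tau> > 0" "Im \<tau> > R" for \<tau>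
    proof -
      have "exp (- (2 * pi * v * Im \<tau>)) \<le> 1" using v that by simp
      then show ?thesis
        using 1(2) 1(3)[OF that(2)] mult_left_le[of "exp (- (2 * pi * v * Im \<tau>))" D] by linarith
    qed
    then show "\<exists>B R. \<forall>\<tau>. Im \<tau> > 0 \<longrightarrow> Im \<tau> > R \<longrightarrow> norm (F \<tau>) \<le> B" by blast
  next
    assume "\<exists>B R. \<forall>\<tau>. Im \<tau> > 0 \<longrightarrow> Im \<tau> > R \<longrightarrow> norm (F \<tau>) \<le> B"
    then obtain B R' where B: "\<And>\<tau>. Im \<tau> > 0 \<Longrightarrow> Im \<tau> > R' \<Longrightarrow> norm (F \<tau>) \<le> B" by blast
    show "v \<ge> 0"
    proof (rule ccontr)
      assume "\<not> v \<ge> 0"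
      then have v: "v < 0" by simp
      define y where "y = max 0 (max R (max R' (B / C / (2 * pi * (- v))))) + 1"
      have y: "y > 0" "y > R" "y > R'" "y > B / C / (2 * pi * (- v))"
        unfolding y_def by linarith+
      have "B / C < 2 * pi * (- v) * y"
    proof -
        have P: "0 < 2 * pi * (- v)" using v by (simp add: mult_pos_neg)
        show ?thesis using y(4) unfolding pos_divide_less_eq[OF P] by (simp only: mult.commute)
      qed
      also have "\<dots> \<le> exp (2 * pi * (- v) * y)"
        using exp_ge_add_one_self[of "2 * pi * (- v) * y"] by linarith
      finally have "B < C * exp (- (2 * pi * v * y))"
        using 1(1) by (simp add: pos_divide_less_eq mult.commute)
      also have "\<dots> \<le> norm (F (Complex 0 y))" using 1(3)[of "Complex 0 y"] y by simp
      also have "\<dots> \<le> B" using B[of "Complex 0 y"] y by simp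
      finally show False by simp
    qed
  qed
qed

lemma order_at_infinity_ee: "order_at_infinity (\<lambda>\<tau>. ee (of_real s * \<tau> + of_real t)) s"
  by (rule order_at_infinityI[of 1 1]) (auto simp: norm_ee mult.assoc)

lemma order_at_infinity_near_1:
  assumes "\<And>\<tau>. Im \<tau> > R \<Longrightarrow> norm (F \<tau> - 1) \<le> 1 / 2"
  shows "order_at_infinity F 0"
proof (rule order_at_infinityI[of "1/2" "3/2" R])
  fix \<tau> assume "Im \<tau> > R"
  then have "norm (F \<tau> - 1) \<le> 1 / 2" by (rule assms)
  then show "1 / 2 * exp (- (2 * pi * 0 * Im \<tau>)) \<le> norm (F \<tau>)"
    "norm (F \<tau>) \<le> 3 / 2 * exp (- (2 * pi * 0 * Im \<tau>))"
    using norm_triangle_ineq2[of "F \<tau>" 1] norm_triangle_ineq2[of 1 "F \<tau>"]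
    by (simp_all add: norm_minus_commute)
qed auto

lemma order_at_infinity_qpoch:
  assumes "s > 0"
  shows "order_at_infinity (\<lambda>\<tau>. qpoch_inf (ee (of_real s * \<tau> + of_real t)) (ee \<tau>)) 0"
proof (rule order_at_infinity_near_1[of "max 7 (7 / s)"])
  have small: "exp (- (2 * pi * x)) \<le> 1 / 8" if "x \<ge> 7" for x
  proof -
    have "2 * pi * x \<ge> 1 * 7" using that pi_gt3 by (intro mult_mono) auto
    then have "exp (2 * pi * x) \<ge> 8" using exp_ge_add_one_self[of "2 * pi * x"] by linarith
    then show ?thesis by (simp add: exp_minus field_simps)
  qed
  fix \<tau> assume \<tau>: "Im \<tau> > max 7 (7 / s)"
  have "s * Im \<tau> \<ge> 7" using \<tau> assms by (simp add: divide_less_eq mult.commute)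
  then have "norm (ee (of_real s * \<tau> + of_real t)) \<le> 1 / 8"
    unfolding norm_ee using small by simp
  moreover have "norm (ee \<tau>) \<le> 1 / 2"
    unfolding norm_ee using small[of "Im \<tau>"] \<tau> by simp
  ultimately show "norm (qpoch_inf (ee (of_real s * \<tau> + of_real t)) (ee \<tau>) - 1) \<le> 1 / 2"
    by (intro qpoch_inf_near_1)
qed

lemma order_at_infinity_eta2: "order_at_infinity eta2 (1 / 12)"
proof -
  have "order_at_infinity (\<lambda>\<tau>. ee (of_real (1 / 12) * \<tau> + of_real 0)
      * qpoch_inf (ee (of_real 1 * \<tau> + of_real 0)) (ee \<tau>) ^ 2) (1 / 12 + of_nat 2 * 0)"
    by (intro order_at_infinity_mult order_at_infinity_power order_at_infinity_ee order_at_infinity_qpoch) simp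
  then show ?thesis by (simp add: eta2_def[abs_def])
qed

text \<open>The order is half the second Bernoulli polynomial at the fractional part of \<open>r1\<close>. The excluded case
  of integral \<open>(r1, r2)\<close> is that of the zero function.\<close>
lemma order_at_infinity_siegel:
  assumes r: "r1 \<notin> \<int> \<or> r2 \<notin> \<int>"
  shows "order_at_infinity (siegel r1 r2) (1 / 12 - frac r1 * (1 - frac r1) / 2)"
proof -
  define \<rho> where "\<rho> = frac r1"
  have \<rho>: "0 \<le> \<rho>" "\<rho> < 1" by (auto simp: \<rho>_def frac_ge_0 frac_lt_1)
  have one: "order_at_infinity (\<lambda>\<tau>. 1 - ee (of_real \<rho> * \<tau> + of_real r2)) 0"
  proof (cases "\<rho> = 0")
    case True
    then have "r1 \<in> \<int>" by (simp add: \<rho>_def frac_eq_0_iff)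
    then have "r2 \<notin> \<int>" using r by simp
    then have "ee (of_real r2) \<noteq> 1" by (simp add: ee_eq_1_iff)
    then show ?thesis using True order_at_infinity_const[of "1 - ee (of_real r2)"] by simp
  next
    case False
    show ?thesis
    proof (rule order_at_infinity_near_1[of "1 / \<rho>"])
      fix \<tau> assume "Im \<tau> > 1 / \<rho>"
      then have "\<rho> * Im \<tau> \<ge> 1" using \<rho> False by (simp add: divide_less_eq mult.commute)
      then have "2 * pi * (\<rho> * Im \<tau>) \<ge> 1 * 1" using pi_gt3 by (intro mult_mono) auto
      then have "exp (2 * pi * (\<rho> * Im \<tau>)) \<ge> 2"
        using exp_ge_add_one_self[of "2 * pi * (\<rho> * Im \<tau>)"] by linarith
      then show "norm (1 - ee (of_real \<rho> * \<tau> + of_real r2) - 1) \<le> 1 / 2"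
        by (simp add: norm_ee exp_minus field_simps)
    qed
  qed
  define s where "s = \<rho>\<^sup>2 / 2 + 1 / 12 - \<rho> / 2"
  have "order_at_infinity (\<lambda>\<tau>. ee (of_real s * \<tau> + of_real (\<rho> * r2 / 2 - r2 / 2))
      * (1 - ee (of_real \<rho> * \<tau> + of_real r2))
      * qpoch_inf (ee (of_real (1 + \<rho>) * \<tau> + of_real r2)) (ee \<tau>)
      * qpoch_inf (ee (of_real (1 - \<rho>) * \<tau> + of_real (- r2))) (ee \<tau>)) (s + 0 + 0 + 0)"
    using \<rho> by (intro order_at_infinity_mult order_at_infinity_ee order_at_infinity_qpoch one) auto
  then have "order_at_infinity (siegel \<rho> r2) (s + 0 + 0 + 0)"
  proof (rule order_at_infinity_cong)
    fix \<tau> :: complex assume \<tau>: "Im \<tau> > 0"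
    define z where "z = of_real \<rho> * \<tau> + of_real r2"
    have "qpoch_inf (ee z) (ee \<tau>) = (1 - ee z) * qpoch_inf (ee (z + \<tau>)) (ee \<tau>)"
      using qpoch_inf_Suc[of "ee \<tau>" "ee z"] \<tau> by (simp add: ee_add)
    moreover have "of_real s * \<tau> + of_real (\<rho> * r2 / 2 - r2 / 2) = of_real \<rho> * z / 2 + (\<tau> / 12 - z / 2)"
      by (simp add: z_def s_def field_simps power2_eq_square)
    then have "ee (of_real s * \<tau> + of_real (\<rho> * r2 / 2 - r2 / 2)) = ee (of_real \<rho> * z / 2) * ee (\<tau> / 12 - z / 2)"
      by (simp only: ee_add)
    moreover have "of_real (1 + \<rho>) * \<tau> + of_real r2 = z + \<tau>"
      "of_real (1 - \<rho>) * \<tau> + of_real (- r2) = \<tau> - z"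
      by (simp_all add: z_def algebra_simps)
    ultimately show "ee (of_real s * \<tau> + of_real (\<rho> * r2 / 2 - r2 / 2))
      * (1 - ee (of_real \<rho> * \<tau> + of_real r2))
      * qpoch_inf (ee (of_real (1 + \<rho>) * \<tau> + of_real r2)) (ee \<tau>)
      * qpoch_inf (ee (of_real (1 - \<rho>) * \<tau> + of_real (- r2))) (ee \<tau>) = siegel \<rho> r2 \<tau>"
      unfolding siegel_def Let_def z_def[symmetric] Theta_def by (simp only: mult.assoc)
  qed
  then have *: "order_at_infinity (siegel \<rho> r2) s" by simp
  have "order_at_infinity (\<lambda>\<tau>. ee (of_int \<lfloor>r1\<rfloor> * (1 - of_real r2) / 2) * siegel \<rho> r2 \<tau>) (0 + s)"
    by (intro order_at_infinity_mult order_at_infinity_const * ee_nz)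
  then have "order_at_infinity (siegel r1 r2) (0 + s)"
  proof (rule order_at_infinity_cong)
    fix \<tau> :: complex assume \<tau>: "Im \<tau> > 0"
    have "r1 = \<rho> + of_int \<lfloor>r1\<rfloor>" by (simp add: \<rho>_def frac_def)
    then show "ee (of_int \<lfloor>r1\<rfloor> * (1 - of_real r2) / 2) * siegel \<rho> r2 \<tau> = siegel r1 r2 \<tau>"
      using siegel_shift_1[OF \<tau>, of \<rho> "\<lfloor>r1\<rfloor>" r2] by simp
  qed
  moreover have "0 + s = 1 / 12 - frac r1 * (1 - frac r1) / 2"
    by (simp add: s_def \<rho>_def field_simps power2_eq_square)
  ultimately show ?thesis by simp
qed

section \<open>Translates of theta products at level 13\<close>

lemma ee_powi: "ee x powi n = ee (of_int n * x)"
proof (cases "n \<ge> 0")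
  case True
  then show ?thesis by (simp add: power_int_def ee_power)
next
  case False
  then have "ee x powi n = inverse (ee (of_nat (nat (- n)) * x))"
    by (simp add: power_int_def ee_power power_inverse)
  also have "\<dots> = ee (- (of_nat (nat (- n)) * x))" by (simp only: ee_minus)
  also have "- (of_nat (nat (- n)) * x) = of_int n * x" using False by simp
  finally show ?thesis .
qed

lemma ee_sum: "ee (\<Sum>i\<in>I. f i) = (\<Prod>i\<in>I. ee (f i))"
  by (induction I rule: infinite_finite_induct) (simp_all add: ee_add)

lemma power_int_sum: "x \<noteq> 0 \<Longrightarrow> (\<Prod>i\<in>I. x powi f i) = x powi (\<Sum>i\<in>I. f i)" for x :: complex
  by (induction I rule: infinite_finite_induct) (simp_all add: power_int_add)

lemma prod_powi_mult:
  "(\<Prod>i\<in>I. (f i * g i) powi a i) = (\<Prod>i\<in>I. f i powi a i) * (\<Prod>i\<in>I. g i powi a i :: complex)"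
  by (simp add: power_int_mult_distrib prod.distrib)

lemma sum_1_to_6: "(\<Sum>j=1..6. f j) = f 1 + f 2 + f 3 + f 4 + f 5 + f (6::nat)"
  by (simp add: numeral_eq_Suc add.assoc)

text \<open>The function \<open>\<eta>^(2k) \<Prod>\<^sub>j siegel (u j) (v j) ^ (a j)\<close> with arbitrary characteristics; all translates of the
  theta product under the modular group have this shape, up to a constant and an affine change of variable.\<close>
definition siegel_prod :: "nat \<Rightarrow> (nat \<Rightarrow> int) \<Rightarrow> (nat \<Rightarrow> real) \<Rightarrow> (nat \<Rightarrow> real) \<Rightarrow> complex \<Rightarrow> complex" where
  "siegel_prod k a u v \<tau> = eta2 \<tau> ^ k * (\<Prod>j=1..6. siegel (u j) (v j) \<tau> powi a j)"

lemma siegel_prod_holomorphic: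
  assumes "open A" "g holomorphic_on A" "\<And>z. z \<in> A \<Longrightarrow> Im (g z) > 0"
    and "\<And>j. j \<in> {1..6} \<Longrightarrow> u j \<notin> \<int> \<or> v j \<notin> \<int>"
  shows "(\<lambda>z. siegel_prod k a u v (g z)) holomorphic_on A"
  unfolding siegel_prod_def
  by (intro holomorphic_intros assms holomorphic_on_prod holomorphic_on_power_int disjI2 ballI)
     (use assms siegel_nonzero in auto)

lemma siegel_prod_nonzero:
  assumes "Im \<tau> > 0" and "\<And>j. j \<in> {1..6} \<Longrightarrow> u j \<notin> \<int> \<or> v j \<notin> \<int>"
  shows "siegel_prod k a u v \<tau> \<noteq> 0"
  using assms eta2_nonzero siegel_nonzero by (simp add: siegel_prod_def)

lemma order_at_infinity_siegel_prod:
  assumes "\<And>j. j \<in> {1..6} \<Longrightarrow> u j \<notin> \<int> \<or> v j \<notin> \<int>"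
  shows "order_at_infinity (siegel_prod k a u v)
    (of_nat k * (1 / 12) + (\<Sum>j=1..6. of_int (a j) * (1 / 12 - frac (u j) * (1 - frac (u j)) / 2)))"
  unfolding siegel_prod_def[abs_def]
  by (intro order_at_infinity_mult order_at_infinity_power order_at_infinity_prod
      order_at_infinity_powi order_at_infinity_eta2 order_at_infinity_siegel assms)

lemma siegel_prod_modular:
  fixes \<alpha> \<beta> \<gamma> \<delta> :: int
  assumes det: "\<alpha> * \<delta> - \<beta> * \<gamma> = 1"
  shows "\<exists>\<epsilon>. \<epsilon> ^ 12 = 1 \<and> (\<forall>\<tau>. Im \<tau> > 0 \<longrightarrow>
     eta2 ((of_int \<alpha> * \<tau> + of_int \<beta>) / (of_int \<gamma> * \<tau> + of_int \<delta>))
        = \<epsilon> * (of_int \<gamma> * \<tau> + of_int \<delta>) * eta2 \<tau> \<and>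
     (\<forall>u v. siegel_prod k a u v ((of_int \<alpha> * \<tau> + of_int \<beta>) / (of_int \<gamma> * \<tau> + of_int \<delta>))
       = \<epsilon> powi (int k + (\<Sum>j=1..6. a j)) * (of_int \<gamma> * \<tau> + of_int \<delta>) ^ k *
         siegel_prod k a (\<lambda>j. u j * of_int \<alpha> + v j * of_int \<gamma>) (\<lambda>j. u j * of_int \<beta> + v j * of_int \<delta>) \<tau>))"
proof -
  obtain \<epsilon> where \<epsilon>: "\<epsilon> ^ 12 = 1"
    and e: "\<And>\<tau>. Im \<tau> > 0 \<Longrightarrow> eta2 ((of_int \<alpha> * \<tau> + of_int \<beta>) / (of_int \<gamma> * \<tau> + of_int \<delta>))
       = \<epsilon> * (of_int \<gamma> * \<tau> + of_int \<delta>) * eta2 \<tau>"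
    and s: "\<And>\<tau> r1 r2. Im \<tau> > 0 \<Longrightarrow>
      siegel r1 r2 ((of_int \<alpha> * \<tau> + of_int \<beta>) / (of_int \<gamma> * \<tau> + of_int \<delta>))
       = \<epsilon> * siegel (r1 * of_int \<alpha> + r2 * of_int \<gamma>) (r1 * of_int \<beta> + r2 * of_int \<delta>) \<tau>"
    using siegel_eta2_modular[OF det] by blast
  have \<epsilon>0: "\<epsilon> \<noteq> 0" using \<epsilon> by auto
  have "siegel_prod k a u v ((of_int \<alpha> * \<tau> + of_int \<beta>) / (of_int \<gamma> * \<tau> + of_int \<delta>))
       = \<epsilon> powi (int k + (\<Sum>j=1..6. a j)) * (of_int \<gamma> * \<tau> + of_int \<delta>) ^ k *
         siegel_prod k a (\<lambda>j. u j * of_int \<alpha> + v j * of_int \<gamma>) (\<lambda>j. u j * of_int \<beta> + v j * of_int \<delta>) \<tau>"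
    if \<tau>: "Im \<tau> > 0" for \<tau> u v
    unfolding siegel_prod_def e[OF \<tau>] s[OF \<tau>] prod_powi_mult power_int_sum[OF \<epsilon>0]
    using \<epsilon>0 by (simp add: power_mult_distrib power_int_add)
  then show ?thesis using \<epsilon> e by blast
qed

lemma theta_prod_eq_siegel_prod:
  "theta_prod 13 (2 * k) a \<tau> = siegel_prod k a (\<lambda>j. of_nat j / 13) (\<lambda>j. 0) (13 * \<tau>)"
proof -
  define P where "P = (\<lambda>j. qpoch_inf (ee (of_nat j * \<tau>)) (ee (13 * \<tau>)) * qpoch_inf (ee (13 * \<tau> - of_nat j * \<tau>)) (ee (13 * \<tau>)))"
  define e where "e = (\<lambda>j. of_nat j * of_nat j * \<tau> / 26 + 13 * \<tau> / 12 - of_nat j * \<tau> / 2)"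
  have s: "siegel (of_nat j / 13) 0 (13 * \<tau>) = ee (e j) * P j" for j
  proof -
    have "of_nat j * of_nat j * \<tau> / 26 + (13 * \<tau> / 12 - of_nat j * \<tau> / 2) = e j"
      by (simp add: e_def)
    then have "ee (of_nat j * of_nat j * \<tau> / 26) * ee (13 * \<tau> / 12 - of_nat j * \<tau> / 2) = ee (e j)"
      by (simp only: ee_add[symmetric])
    then show ?thesis
      by (simp add: siegel_def Theta_def P_def Let_def mult.assoc[symmetric])
  qed
  have "siegel_prod k a (\<lambda>j. of_nat j / 13) (\<lambda>j. 0) (13 * \<tau>)
     = ee (of_nat k * (13 * \<tau> / 12)) * qpoch_inf (ee (13 * \<tau>)) (ee (13 * \<tau>)) ^ (2 * k)
       * (ee (\<Sum>j=1..6. of_int (a j) * e j) * (\<Prod>j=1..6. P j powi a j))"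
    unfolding siegel_prod_def s prod_powi_mult ee_sum ee_powi eta2_def power_mult_distrib ee_power power_mult[symmetric]
    by simp
  also have "\<dots> = ee (of_nat k * (13 * \<tau> / 12) + (\<Sum>j=1..6. of_int (a j) * e j))
      * qpoch_inf (ee (13 * \<tau>)) (ee (13 * \<tau>)) ^ (2 * k) * (\<Prod>j=1..6. P j powi a j)"
    by (simp add: ee_add)
  also have "of_nat k * (13 * \<tau> / 12) + (\<Sum>j=1..6. of_int (a j) * e j)
      = \<tau> * of_real (real 13 / 24 * of_int (S1 13 (2 * k) a) - 1 / (2 * real 13) * of_int (S2 13 a))"
  proof -
    have 6: "(13 div 2 :: nat) = 6" by simp
    show ?thesis unfolding S1_def S2_def 6 sum_1_to_6 e_def by (simp add: field_simps)
  qed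
  also have "(\<Prod>j=1..6. P j powi a j) = (\<Prod>j=1..13 div 2. (qpoch_inf (qpow \<tau> 1 ^ j) (qpow \<tau> 1 ^ 13)
      * qpoch_inf (qpow \<tau> 1 ^ (13 - j)) (qpow \<tau> 1 ^ 13)) powi a j)"
  proof (rule prod.cong)
    fix j assume j: "j \<in> {1..13 div 2 :: nat}"
    then have "(of_nat (13 - j) :: complex) = 13 - of_nat j" by (simp add: of_nat_diff)
    then have "ee (13 * \<tau> - of_nat j * \<tau>) = qpow \<tau> 1 ^ (13 - j)"
      by (simp add: qpow_def ee_power left_diff_distrib flip: ee_def)
    moreover have "ee (of_nat j * \<tau>) = qpow \<tau> 1 ^ j" "ee (13 * \<tau>) = qpow \<tau> 1 ^ 13"
      by (simp_all add: qpow_def ee_power flip: ee_def)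
    ultimately show "P j powi a j = (qpoch_inf (qpow \<tau> 1 ^ j) (qpow \<tau> 1 ^ 13)
      * qpoch_inf (qpow \<tau> 1 ^ (13 - j)) (qpow \<tau> 1 ^ 13)) powi a j"
      by (simp add: P_def)
  qed simp
  also have "ee (13 * \<tau>) = qpow \<tau> 1 ^ 13"
    by (simp add: qpow_def ee_power flip: ee_def)
  also have "ee (\<tau> * of_real (real 13 / 24 * of_int (S1 13 (2 * k) a) - 1 / (2 * real 13) * of_int (S2 13 a)))
     = qpow \<tau> (real 13 / 24 * of_int (S1 13 (2 * k) a) - 1 / (2 * real 13) * of_int (S2 13 a))"
    unfolding qpow_def ee_def by (simp only: mult.assoc)
  finally show ?thesis
    unfolding theta_prod_def Let_def by simp
qed

lemma of_nat_div_13_notin_Ints: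
  assumes "j \<in> {1..6::nat}" "\<not> 13 dvd (n::int)"
  shows "real j * of_int n / 13 \<notin> \<int>"
proof
  assume "real j * of_int n / 13 \<in> \<int>"
  then obtain m where "real j * of_int n / 13 = of_int m" by (auto elim: Ints_cases)
  then have "of_int (int j * n) = (of_int (13 * m) :: real)" by simp
  then have "int j * n = 13 * m" by (simp only: of_int_eq_iff)
  then have "13 dvd int j * n" by simp
  moreover have "prime (13::int)" by simp
  ultimately have "13 dvd int j" using assms(2) prime_dvd_mult_iff by blast
  then show False using assms(1) by (auto simp: zdvd_not_zless dest!: zdvd_imp_le)
qed

text \<open>If \<open>13\<close> divides the lower left entry of \<open>A\<close>, then \<open>diag(13, 1) A\<close> equals an element of \<open>SL\<^sub>2(\<int>)\<close> times
  \<open>diag(13, 1)\<close>; these are the cusps over infinity.\<close>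
lemma theta_prod_slash_infinity:
  fixes \<alpha> \<beta> \<gamma> \<delta> :: int
  assumes det: "\<alpha> * \<delta> - \<beta> * (13 * \<gamma>) = 1"
  shows "\<exists>\<epsilon>. \<epsilon> ^ 12 = 1 \<and> (\<forall>\<tau>. Im \<tau> > 0 \<longrightarrow>
     eta2 ((of_int \<alpha> * (13 * \<tau>) + of_int (13 * \<beta>)) / (of_int \<gamma> * (13 * \<tau>) + of_int \<delta>))
        = \<epsilon> * (of_int \<gamma> * (13 * \<tau>) + of_int \<delta>) * eta2 (13 * \<tau>) \<and>
     theta_prod 13 (2 * k) a ((of_int \<alpha> * \<tau> + of_int \<beta>) / (of_int (13 * \<gamma>) * \<tau> + of_int \<delta>))
       / (of_int (13 * \<gamma>) * \<tau> + of_int \<delta>) ^ k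
     = \<epsilon> powi (int k + (\<Sum>j=1..6. a j)) *
         siegel_prod k a (\<lambda>j. of_nat j * of_int \<alpha> / 13) (\<lambda>j. of_int (int j * \<beta>)) (13 * \<tau>))"
proof -
  have det': "\<alpha> * \<delta> - (13 * \<beta>) * \<gamma> = 1" using det by (simp add: algebra_simps)
  obtain \<epsilon> where \<epsilon>: "\<epsilon> ^ 12 = 1" and M: "\<And>\<tau>. Im \<tau> > 0 \<Longrightarrow>
     eta2 ((of_int \<alpha> * \<tau> + of_int (13 * \<beta>)) / (of_int \<gamma> * \<tau> + of_int \<delta>))
        = \<epsilon> * (of_int \<gamma> * \<tau> + of_int \<delta>) * eta2 \<tau>"
     "\<And>\<tau> u v. Im \<tau> > 0 \<Longrightarrow> siegel_prod k a u v ((of_int \<alpha> * \<tau> + of_int (13 * \<beta>)) / (of_int \<gamma> * \<tau> + of_int \<delta>))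
       = \<epsilon> powi (int k + (\<Sum>j=1..6. a j)) * (of_int \<gamma> * \<tau> + of_int \<delta>) ^ k *
         siegel_prod k a (\<lambda>j. u j * of_int \<alpha> + v j * of_int \<gamma>) (\<lambda>j. u j * of_int (13 * \<beta>) + v j * of_int \<delta>) \<tau>"
    using siegel_prod_modular[OF det', of k a] by blast
  have "theta_prod 13 (2 * k) a ((of_int \<alpha> * \<tau> + of_int \<beta>) / (of_int (13 * \<gamma>) * \<tau> + of_int \<delta>))
       / (of_int (13 * \<gamma>) * \<tau> + of_int \<delta>) ^ k
     = \<epsilon> powi (int k + (\<Sum>j=1..6. a j)) *
         siegel_prod k a (\<lambda>j. of_nat j * of_int \<alpha> / 13) (\<lambda>j. of_int (int j * \<beta>)) (13 * \<tau>)"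
    if \<tau>: "Im \<tau> > 0" for \<tau>
  proof -
    define J where "J = of_int (13 * \<gamma>) * \<tau> + of_int \<delta>"
    have J: "J \<noteq> 0" unfolding J_def by (rule automorphy_factor_nonzero[OF \<tau> det])
    have J': "of_int \<gamma> * (13 * \<tau>) + of_int \<delta> = J" by (simp add: J_def)
    have g: "13 * ((of_int \<alpha> * \<tau> + of_int \<beta>) / J)
        = (of_int \<alpha> * (13 * \<tau>) + of_int (13 * \<beta>)) / J"
      by (simp add: algebra_simps add_divide_distrib)
    have "Im (13 * \<tau>) > 0" using \<tau> by simp
    from M(2)[OF this, of "\<lambda>j. of_nat j / 13" "\<lambda>j. 0"]
    have "siegel_prod k a (\<lambda>j. of_nat j / 13) (\<lambda>j. 0) (13 * ((of_int \<alpha> * \<tau> + of_int \<beta>) / J))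
      = \<epsilon> powi (int k + (\<Sum>j=1..6. a j)) * J ^ k *
         siegel_prod k a (\<lambda>j. of_nat j * of_int \<alpha> / 13) (\<lambda>j. of_int (int j * \<beta>)) (13 * \<tau>)"
      unfolding g J' by simp
    then show ?thesis
      unfolding theta_prod_eq_siegel_prod J_def[symmetric] using J by simp
  qed
  moreover have "Im (13 * \<tau>) > 0" if "Im \<tau> > 0" for \<tau> using that by simp
  ultimately show ?thesis using \<epsilon> M(1) by blast
qed

text \<open>If \<open>13\<close> does not divide the lower left entry of \<open>A\<close>, then \<open>diag(13, 1) A\<close> equals an element of
  \<open>SL\<^sub>2(\<int>)\<close> times an upper triangular matrix with diagonal \<open>(1, 13)\<close>; these are the cusps over \<open>0\<close>, where the
  first characteristics become integral.\<close>
lemma theta_prod_slash_zero: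
  fixes \<alpha> \<beta> \<gamma> \<delta> :: int
  assumes det: "\<alpha> * \<delta> - \<beta> * \<gamma> = 1" and \<gamma>: "\<not> 13 dvd \<gamma>"
  shows "\<exists>\<epsilon> \<beta>' x. \<epsilon> \<noteq> 0 \<and> \<not> 13 dvd (\<beta>' :: int) \<and> (\<forall>\<tau>. Im \<tau> > 0 \<longrightarrow>
     theta_prod 13 (2 * k) a ((of_int \<alpha> * \<tau> + of_int \<beta>) / (of_int \<gamma> * \<tau> + of_int \<delta>))
       / (of_int \<gamma> * \<tau> + of_int \<delta>) ^ k
     = \<epsilon> * siegel_prod k a (\<lambda>j. of_int (int j * \<alpha>)) (\<lambda>j. of_nat j * of_int \<beta>' / 13)
         (of_real (1 / 13) * \<tau> + of_real x))"
proof -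
  have "prime (13::int)" by simp
  then have "coprime \<gamma> 13"
    using \<gamma> prime_imp_coprime coprime_commute by blast
  then obtain y where "[\<gamma> * y = 1] (mod 13)" using cong_solve_coprime_int by blast
  then have "[\<gamma> * (y * \<delta>) = \<delta>] (mod 13)"
    by (metis cong_scalar_right mult.assoc mult_1)
  then have "13 dvd \<delta> - \<gamma> * (y * \<delta>)" by (simp add: cong_iff_dvd_diff dvd_diff_commute)
  then obtain \<delta>' where \<delta>': "\<delta> - \<gamma> * (y * \<delta>) = 13 * \<delta>'" by blast
  \<comment> \<open>translation by \<open>x\<close>, a solution of \<open>\<gamma> x \<equiv> \<delta>\<close> modulo \<open>13\<close>, makes the lower right entry divisible by \<open>13\<close>\<close>
  define x where "x = y * \<delta>"
  define \<beta>' where "\<beta>' = \<beta> - \<alpha> * x"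
  have d: "\<delta> = 13 * \<delta>' + \<gamma> * x" using \<delta>' by (simp add: x_def)
  have b: "\<beta> = \<beta>' + \<alpha> * x" by (simp add: \<beta>'_def)
  have det': "(13 * \<alpha>) * \<delta>' - \<beta>' * \<gamma> = 1" using det by (simp add: d b algebra_simps)
  have nd: "\<not> 13 dvd \<beta>'"
  proof
    assume "13 dvd \<beta>'"
    then have "13 dvd (13 * \<alpha>) * \<delta>' - \<beta>' * \<gamma>" by (intro dvd_diff dvd_mult2) auto
    then show False unfolding det' by simp
  qed
  obtain \<epsilon> where \<epsilon>: "\<epsilon> ^ 12 = 1" and M: 
     "\<And>\<tau> u v. Im \<tau> > 0 \<Longrightarrow> siegel_prod k a u v ((of_int (13 * \<alpha>) * \<tau> + of_int \<beta>') / (of_int \<gamma> * \<tau> + of_int \<delta>'))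
       = \<epsilon> powi (int k + (\<Sum>j=1..6. a j)) * (of_int \<gamma> * \<tau> + of_int \<delta>') ^ k *
         siegel_prod k a (\<lambda>j. u j * of_int (13 * \<alpha>) + v j * of_int \<gamma>) (\<lambda>j. u j * of_int \<beta>' + v j * of_int \<delta>') \<tau>"
    using siegel_prod_modular[OF det', of k a] by blast
  have "\<epsilon> \<noteq> 0" using \<epsilon> by auto
  moreover have "theta_prod 13 (2 * k) a ((of_int \<alpha> * \<tau> + of_int \<beta>) / (of_int \<gamma> * \<tau> + of_int \<delta>))
       / (of_int \<gamma> * \<tau> + of_int \<delta>) ^ k
     = (\<epsilon> powi (int k + (\<Sum>j=1..6. a j)) / 13 ^ k) *
         siegel_prod k a (\<lambda>j. of_int (int j * \<alpha>)) (\<lambda>j. of_nat j * of_int \<beta>' / 13)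
          (of_real (1 / 13) * \<tau> + of_real (of_int x / 13))"
    if \<tau>: "Im \<tau> > 0" for \<tau>
  proof -
    define J where "J = of_int \<gamma> * \<tau> + of_int \<delta>"
    define w where "w = of_real (1 / 13) * \<tau> + of_real (of_int x / 13)"
    have w: "Im w > 0" using \<tau> by (simp add: w_def)
    have J: "J \<noteq> 0" unfolding J_def by (rule automorphy_factor_nonzero[OF \<tau> det])
    have J': "of_int \<gamma> * w + of_int \<delta>' = J / 13"
      by (simp add: J_def w_def d field_simps)
    have g: "13 * ((of_int \<alpha> * \<tau> + of_int \<beta>) / J)
        = (of_int (13 * \<alpha>) * w + of_int \<beta>') / (J / 13)"
    proof -
      have "of_int (13 * \<alpha>) * w + of_int \<beta>' = of_int \<alpha> * \<tau> + of_int \<beta>"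
        by (simp add: w_def b algebra_simps)
      then show ?thesis by simp
    qed
    from M[OF w, of "\<lambda>j. of_nat j / 13" "\<lambda>j. 0"]
    have "siegel_prod k a (\<lambda>j. of_nat j / 13) (\<lambda>j. 0) (13 * ((of_int \<alpha> * \<tau> + of_int \<beta>) / J))
      = \<epsilon> powi (int k + (\<Sum>j=1..6. a j)) * (J / 13) ^ k *
         siegel_prod k a (\<lambda>j. of_int (int j * \<alpha>)) (\<lambda>j. of_nat j * of_int \<beta>' / 13) w"
      unfolding g J' by simp
    then show ?thesis
      unfolding theta_prod_eq_siegel_prod J_def[symmetric] w_def[symmetric] using J
      by (simp add: power_divide)
  qed
  ultimately show ?thesis using nd
    by (intro exI[of _ "\<epsilon> powi (int k + (\<Sum>j=1..6. a j)) / 13 ^ k"] exI[of _ \<beta>'] exI[of _ "of_int x / 13"]) auto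
qed

text \<open>The part of the order at the cusp over infinity with index \<open>i\<close> that depends on that cusp: the order is
  \<open>(169 (k + \<Sum>a\<^sub>j) - 6 residue_form i a) / 156\<close>.\<close>
definition residue_form :: "int \<Rightarrow> (nat \<Rightarrow> int) \<Rightarrow> int" where
  "residue_form i a = (\<Sum>j=1..6. (int j * i mod 13) * (13 - int j * i mod 13) * a j)"

lemma frac_of_int_div_13: "frac (of_int n / 13 :: real) = of_int (n mod 13) / 13"
proof -
  have "n = 13 * (n div 13) + n mod 13" by simp
  then have "of_int n = (13 * of_int (n div 13) + of_int (n mod 13) :: real)"
    by (metis of_int_add of_int_mult of_int_numeral)
  then have "of_int n / 13 - of_int (n mod 13) / 13 = (of_int (n div 13) :: real)" by (simp add: field_simps)
  then have "of_int n / 13 - of_int (n mod 13) / 13 \<in> (\<int> :: real set)" by (metis Ints_of_int)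
  moreover have "0 \<le> n mod 13" "n mod 13 < 13" by simp_all
  then have "0 \<le> (of_int (n mod 13) / 13 :: real)" "(of_int (n mod 13) / 13 :: real) < 1"
    by (auto simp: divide_less_eq)
  ultimately show ?thesis unfolding frac_unique_iff by blast
qed

lemma order_at_infinity_cusp_infinity:
  assumes "\<not> 13 dvd \<alpha>"
  shows "order_at_infinity (\<lambda>\<tau>. siegel_prod k a (\<lambda>j. of_nat j * of_int \<alpha> / 13) v (13 * \<tau>))
           (of_int (169 * (int k + (\<Sum>j=1..6. a j)) - 6 * residue_form \<alpha> a) / 156)"
proof -
  let ?u = "\<lambda>j. of_nat j * of_int \<alpha> / (13 :: real)"
  have "?u j \<notin> \<int> \<or> v j \<notin> \<int>" if "j \<in> {1..6}" for j
    using of_nat_div_13_notin_Ints[OF that assms] by simp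
  note o = order_at_infinity_siegel_prod[where u = ?u and v = v and k = k and a = a, OF this]
  from order_at_infinity_compose[OF o, of 13 0]
  have o': "order_at_infinity (\<lambda>\<tau>. siegel_prod k a ?u v (13 * \<tau>))
     (13 * (of_nat k * (1 / 12) + (\<Sum>j=1..6. of_int (a j) * (1 / 12 - frac (?u j) * (1 - frac (?u j)) / 2))))"
    by simp
  have f: "frac (?u j) = of_int (int j * \<alpha> mod 13) / 13" for j
    using frac_of_int_div_13[of "int j * \<alpha>"] by simp
  have "13 * (of_nat k * (1 / 12) + (\<Sum>j=1..6. of_int (a j) * (1 / 12 - of_int (int j * \<alpha> mod 13) / 13 * (1 - of_int (int j * \<alpha> mod 13) / 13) / 2)))
     = (of_int (169 * (int k + (\<Sum>j=1..6. a j)) - 6 * residue_form \<alpha> a) / 156 :: real)"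
  proof -
    have "of_int x * (1 / 12 - of_int r / 13 * (1 - of_int r / 13) / 2)
        = (of_int (169 * x - 6 * (r * (13 - r) * x)) / 2028 :: real)" for r x
      by (simp add: field_simps)
    then have "(\<Sum>j=1..6. of_int (a j) * (1 / 12 - of_int (int j * \<alpha> mod 13) / 13 * (1 - of_int (int j * \<alpha> mod 13) / 13) / 2))
      = (\<Sum>j=1..6. of_int (169 * a j - 6 * ((int j * \<alpha> mod 13) * (13 - int j * \<alpha> mod 13) * a j)) / (2028 :: real))"
      by (intro sum.cong refl)
    also have "\<dots> = of_int (169 * (\<Sum>j=1..6. a j) - 6 * residue_form \<alpha> a) / 2028"
      unfolding residue_form_def sum_divide_distrib[symmetric] of_int_sum[symmetric]
      by (simp only: sum_subtractf sum_distrib_left)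
    finally have *: "(\<Sum>j=1..6. of_int (a j) * (1 / 12 - of_int (int j * \<alpha> mod 13) / 13 * (1 - of_int (int j * \<alpha> mod 13) / 13) / 2))
      = (of_int (169 * (\<Sum>j=1..6. a j) - 6 * residue_form \<alpha> a) / 2028 :: real)" .
    show ?thesis unfolding * by (simp add: field_simps)
  qed
  then show ?thesis using o' unfolding f by (simp only:)
qed

lemma order_at_infinity_cusp_zero:
  assumes "\<not> 13 dvd \<beta>'"
  shows "order_at_infinity (\<lambda>\<tau>. siegel_prod k a (\<lambda>j. of_int (int j * \<alpha>)) (\<lambda>j. of_nat j * of_int \<beta>' / 13)
          (of_real (1 / 13) * \<tau> + of_real x)) (of_int (int k + (\<Sum>j=1..6. a j)) / 156)"
proof -
  let ?u = "\<lambda>j. of_int (int j * \<alpha>) :: real" and ?v = "\<lambda>j. of_nat j * of_int \<beta>' / (13 :: real)"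
  have "?u j \<notin> \<int> \<or> ?v j \<notin> \<int>" if "j \<in> {1..6}" for j
    using of_nat_div_13_notin_Ints[OF that assms] by simp
  note o = order_at_infinity_siegel_prod[where u = ?u and v = ?v and k = k and a = a, OF this]
  from order_at_infinity_compose[OF o, of "1 / 13" x]
  have *: "order_at_infinity (\<lambda>\<tau>. siegel_prod k a ?u ?v (of_real (1 / 13) * \<tau> + of_real x))
     (1 / 13 * (of_nat k * (1 / 12) + (\<Sum>j=1..6. of_int (a j) * (1 / 12 - frac (?u j) * (1 - frac (?u j)) / 2))))"
    by simp
  have f0: "frac (?u j) = 0" for j by (simp only: frac_of_int)
  have "(\<Sum>j=1..6. of_int (a j) * (1 / 12 - frac (?u j) * (1 - frac (?u j)) / 2)) = of_int (\<Sum>j=1..6. a j) / 12"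
    unfolding f0 by (simp add: sum_divide_distrib)
  moreover have "1 / 13 * (of_nat k * (1 / 12) + of_int (\<Sum>j=1..6. a j) / 12)
      = (of_int (int k + (\<Sum>j=1..6. a j)) / 156 :: real)" by (simp add: field_simps)
  ultimately show ?thesis using * by (simp only:)
qed

section \<open>The arithmetic criterion for modularity\<close>

lemma qpow_eq_ee: "qpow \<tau> r = ee (\<tau> * of_real r)"
  by (simp add: qpow_def ee_def mult.assoc)

lemma theta_prod_translation:
  "theta_prod N a0 a (\<tau> + 1)
     = ee (of_real (real N / 24 * of_int (S1 N a0 a) - 1 / (2 * real N) * of_int (S2 N a))) * theta_prod N a0 a \<tau>"
proof -
  have q: "qpow (\<tau> + 1) 1 = qpow \<tau> 1" by (simp add: qpow_eq_ee ee_add)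
  have "qpow (\<tau> + 1) r = ee (of_real r) * qpow \<tau> r" for r
    by (simp add: qpow_eq_ee ring_distribs ee_add)
  then show ?thesis unfolding theta_prod_def q Let_def by (simp only: mult.assoc)
qed

lemma theta_prod_13_nonzero: "Im \<tau> > 0 \<Longrightarrow> theta_prod 13 (2 * k) a \<tau> \<noteq> 0"
  unfolding theta_prod_eq_siegel_prod
  using of_nat_div_13_notin_Ints[of _ 1] by (intro siegel_prod_nonzero) auto

text \<open>Only the class of \<open>\<alpha>\<close> modulo \<open>13\<close> up to sign matters: there are six cusps over infinity.\<close>
lemma residue_form_eq_1_to_6:
  assumes "\<not> 13 dvd \<alpha>"
  obtains i where "i \<in> {1..6}" "residue_form \<alpha> a = residue_form i a"
proof -
  define r where "r = \<alpha> mod 13"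
  have r: "r \<noteq> 0" "0 \<le> r" "r < 13" using assms by (auto simp: r_def dvd_eq_mod_eq_0)
  have red: "residue_form \<alpha> a = residue_form r a"
    unfolding residue_form_def r_def by (intro sum.cong refl) (simp add: mod_mult_right_eq)
  show ?thesis
  proof (cases "r \<le> 6")
    case True
    then show ?thesis using r red that[of r] by simp
  next
    case False
    have "residue_form r a = residue_form (13 - r) a"
      unfolding residue_form_def
    proof (intro sum.cong refl)
      fix j :: nat
      have "int j * (13 - r) mod 13 = (- (int j * r)) mod 13"
        by (metis (no_types, opaque_lifting) diff_0 mod_diff_left_eq mod_mult_self2_is_0 right_diff_distrib')
      then show "(int j * r mod 13) * (13 - int j * r mod 13) * a j
          = (int j * (13 - r) mod 13) * (13 - int j * (13 - r) mod 13) * a j"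
        by (simp add: zmod_zminus1_eq_if)
    qed
    then show ?thesis using r red False that[of "13 - r"] by simp
  qed
qed

lemma SL2Z_iff: "A \<in> SL2Z \<longleftrightarrow> A$1$1 * A$2$2 - A$1$2 * A$2$1 = 1"
  by (simp add: SL2Z_def det_2)

text \<open>The \<open>2 \<times> 2\<close> matrix with the given entries, row by row.\<close>
definition mat2 :: "int \<Rightarrow> int \<Rightarrow> int \<Rightarrow> int \<Rightarrow> int^2^2" where
  "mat2 \<alpha> \<beta> \<gamma> \<delta> = vector [vector [\<alpha>, \<beta>], vector [\<gamma>, \<delta>]]"

lemma mat2_nth [simp]: "mat2 \<alpha> \<beta> \<gamma> \<delta> $ 1 $ 1 = \<alpha>" "mat2 \<alpha> \<beta> \<gamma> \<delta> $ 1 $ 2 = \<beta>"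
  "mat2 \<alpha> \<beta> \<gamma> \<delta> $ 2 $ 1 = \<gamma>" "mat2 \<alpha> \<beta> \<gamma> \<delta> $ 2 $ 2 = \<delta>"
  by (simp_all add: mat2_def vector_2)

lemma theta_prod_bounded_infinity_iff:
  fixes A :: "int^2^2"
  assumes A: "A \<in> SL2Z" and d: "13 dvd A$2$1"
  shows "bounded_at_infinity (slash k (theta_prod 13 (2 * k) a) A) \<longleftrightarrow>
     6 * residue_form (A$1$1) a \<le> 169 * (int k + (\<Sum>j=1..6. a j))"
proof -
  obtain \<gamma> where \<gamma>: "A$2$1 = 13 * \<gamma>" using d by blast
  have det: "A$1$1 * A$2$2 - A$1$2 * (13 * \<gamma>) = 1" using A by (simp add: SL2Z_iff \<gamma>)
  have nd: "\<not> 13 dvd A$1$1"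
  proof
    assume "13 dvd A$1$1"
    then have "13 dvd A$1$1 * A$2$2 - A$1$2 * (13 * \<gamma>)" by (intro dvd_diff dvd_mult2 dvd_mult) auto
    then show False unfolding det by simp
  qed
  obtain \<epsilon> where \<epsilon>: "\<epsilon> ^ 12 = 1" and s: "\<And>\<tau>. Im \<tau> > 0 \<Longrightarrow> slash k (theta_prod 13 (2 * k) a) A \<tau>
     = \<epsilon> powi (int k + (\<Sum>j=1..6. a j)) *
         siegel_prod k a (\<lambda>j. of_nat j * of_int (A$1$1) / 13) (\<lambda>j. of_int (int j * (A$1$2))) (13 * \<tau>)"
    using theta_prod_slash_infinity[OF det, of k a] unfolding slash_def \<gamma> by blast
  have "\<epsilon> powi (int k + (\<Sum>j=1..6. a j)) \<noteq> 0" using \<epsilon> by auto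
  from order_at_infinity_mult[OF order_at_infinity_const[OF this]
      order_at_infinity_cusp_infinity[OF nd, where v = "\<lambda>j. of_int (int j * A$1$2)"]]
  have "order_at_infinity (slash k (theta_prod 13 (2 * k) a) A)
      (0 + of_int (169 * (int k + (\<Sum>j=1..6. a j)) - 6 * residue_form (A$1$1) a) / 156)"
    by (rule order_at_infinity_cong) (use s in simp)
  from bounded_at_infinity_iff_order_nonneg[OF this]
  have "bounded_at_infinity (slash k (theta_prod 13 (2 * k) a) A) \<longleftrightarrow>
     (0::real) \<le> 0 + of_int (169 * (int k + (\<Sum>j=1..6. a j)) - 6 * residue_form (A$1$1) a) / 156"
    .
  also have "\<dots> \<longleftrightarrow> 0 \<le> 169 * (int k + (\<Sum>j=1..6. a j)) - 6 * residue_form (A$1$1) a"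
    by (simp only: add_0_left zero_le_divide_iff of_int_0_le_iff) simp
  finally show ?thesis by simp
qed

lemma theta_prod_bounded_zero_iff:
  fixes A :: "int^2^2"
  assumes A: "A \<in> SL2Z" and d: "\<not> 13 dvd A$2$1"
  shows "bounded_at_infinity (slash k (theta_prod 13 (2 * k) a) A) \<longleftrightarrow>
     0 \<le> int k + (\<Sum>j=1..6. a j)"
proof -
  have det: "A$1$1 * A$2$2 - A$1$2 * A$2$1 = 1" using A by (simp add: SL2Z_iff)
  obtain \<epsilon> \<beta>' x where \<epsilon>: "\<epsilon> \<noteq> 0" and nd: "\<not> 13 dvd (\<beta>' :: int)"
   and s: "\<And>\<tau>. Im \<tau> > 0 \<Longrightarrow> slash k (theta_prod 13 (2 * k) a) A \<tau>
     = \<epsilon> * siegel_prod k a (\<lambda>j. of_int (int j * A$1$1)) (\<lambda>j. of_nat j * of_int \<beta>' / 13)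
         (of_real (1 / 13) * \<tau> + of_real x)"
    using theta_prod_slash_zero[OF det d, of k a] unfolding slash_def by blast
  from order_at_infinity_mult[OF order_at_infinity_const[OF \<epsilon>]
      order_at_infinity_cusp_zero[OF nd, where \<alpha> = "A$1$1" and x = x]]
  have "order_at_infinity (slash k (theta_prod 13 (2 * k) a) A)
      (0 + of_int (int k + (\<Sum>j=1..6. a j)) / 156)"
    by (rule order_at_infinity_cong) (use s in simp)
  from bounded_at_infinity_iff_order_nonneg[OF this]
  have "bounded_at_infinity (slash k (theta_prod 13 (2 * k) a) A) \<longleftrightarrow>
     (0::real) \<le> 0 + of_int (int k + (\<Sum>j=1..6. a j)) / 156"
    .
  also have "\<dots> \<longleftrightarrow> 0 \<le> int k + (\<Sum>j=1..6. a j)"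
    by (simp only: add_0_left zero_le_divide_iff of_int_0_le_iff) simp
  finally show ?thesis .
qed

lemma theta_prod_cusps_iff:
  "(\<forall>A\<in>SL2Z. bounded_at_infinity (slash k (theta_prod 13 (2 * k) a) A)) \<longleftrightarrow>
     0 \<le> int k + (\<Sum>j=1..6. a j) \<and>
     (\<forall>i\<in>{1..6}. 6 * residue_form i a \<le> 169 * (int k + (\<Sum>j=1..6. a j)))"
proof (intro iffI conjI ballI)
  assume *: "\<forall>A\<in>SL2Z. bounded_at_infinity (slash k (theta_prod 13 (2 * k) a) A)"
  have "mat2 0 (-1) 1 0 \<in> SL2Z" by (simp add: SL2Z_iff)
  then show "0 \<le> int k + (\<Sum>j=1..6. a j)"
    using * theta_prod_bounded_zero_iff[of "mat2 0 (-1) 1 0" k a] by simp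
  fix i :: int assume "i \<in> {1..6}"
  then have "\<not> 13 dvd i" by (auto dest!: zdvd_imp_le)
  moreover have "prime (13::int)" by simp
  ultimately have "coprime i 13" using prime_imp_coprime coprime_commute by blast
  then obtain \<delta> where "[i * \<delta> = 1] (mod 13)" using cong_solve_coprime_int by blast
  then obtain \<beta> where "i * \<delta> - 1 = 13 * \<beta>" by (auto simp: cong_iff_dvd_diff)
  then have "mat2 i \<beta> 13 \<delta> \<in> SL2Z" by (simp add: SL2Z_iff)
  then show "6 * residue_form i a \<le> 169 * (int k + (\<Sum>j=1..6. a j))"
    using * theta_prod_bounded_infinity_iff[of "mat2 i \<beta> 13 \<delta>" k a] by simp
next
  fix A :: "int^2^2" assume A: "A \<in> SL2Z"
  assume *: "0 \<le> int k + (\<Sum>j=1..6. a j) \<and>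
     (\<forall>i\<in>{1..6}. 6 * residue_form i a \<le> 169 * (int k + (\<Sum>j=1..6. a j)))"
  show "bounded_at_infinity (slash k (theta_prod 13 (2 * k) a) A)"
  proof (cases "13 dvd A$2$1")
    case False
    then show ?thesis using theta_prod_bounded_zero_iff[OF A] * by simp
  next
    case True
    have "\<not> 13 dvd A$1$1"
    proof
      assume "13 dvd A$1$1"
      then have "13 dvd A$1$1 * A$2$2 - A$1$2 * A$2$1"
        using True by (intro dvd_diff dvd_mult2 dvd_mult) auto
      then show False using A by (simp add: SL2Z_iff)
    qed
    then obtain i where "i \<in> {1..6}" "residue_form (A$1$1) a = residue_form i a"
      by (rule residue_form_eq_1_to_6)
    then show ?thesis using theta_prod_bounded_infinity_iff[OF A True] * by simp
  qed
qed

text \<open>Both conditions are used: the first kills the multiplier \<open>\<epsilon>\<close>, the second the constants that arise when the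
  characteristics \<open>(j\<alpha>/13, j\<beta>)\<close> are shifted back to \<open>(j/13, 0)\<close>. Here \<open>\<alpha> = 1 + 13m\<close> and \<open>\<beta>\<close> form the first row of the
  matrix. The product of the constants is \<open>-1\<close> raised to a multiple of \<open>m (1 + \<beta>)\<close>, which is even by the
  determinant condition.\<close>
lemma theta_prod_invariant:
  assumes K: "12 dvd int k + (\<Sum>j=1..6. a j)" and S: "13 dvd (\<Sum>j=1..6. int j ^ 2 * a j)"
    and A: "A \<in> Gamma1 13" and \<tau>: "Im \<tau> > 0"
  shows "slash k (theta_prod 13 (2 * k) a) A \<tau> = theta_prod 13 (2 * k) a \<tau>"
proof -
  define \<beta> \<delta> where "\<beta> = A$1$2" and "\<delta> = A$2$2"
  have "[A$2$1 = 0] (mod 13)" "[A$1$1 = 1] (mod 13)" "A \<in> SL2Z" using A by (auto simp: Gamma1_def)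
  then have "13 dvd A$2$1" "13 dvd A$1$1 - 1" by (simp_all add: cong_iff_dvd_diff)
  then obtain \<gamma> m where \<gamma>: "A$2$1 = 13 * \<gamma>" and "A$1$1 - 1 = 13 * m"
    by (elim dvdE)
  then have \<alpha>: "A$1$1 = 1 + 13 * m" by simp
  have det: "(1 + 13 * m) * \<delta> - \<beta> * (13 * \<gamma>) = 1"
    using \<open>A \<in> SL2Z\<close> by (simp add: SL2Z_iff \<alpha> \<gamma> \<beta>_def \<delta>_def)
  have ev: "even (m * (1 + \<beta>))"
  proof (rule ccontr)
    assume "odd (m * (1 + \<beta>))"
    then have "odd m" "even \<beta>" by auto
    then have "even ((1 + 13 * m) * \<delta> - \<beta> * (13 * \<gamma>))" by simp
    then show False unfolding det by simp
  qed
  obtain \<epsilon> where \<epsilon>: "\<epsilon> ^ 12 = 1" and s: "slash k (theta_prod 13 (2 * k) a) A \<tau>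
     = \<epsilon> powi (int k + (\<Sum>j=1..6. a j)) *
         siegel_prod k a (\<lambda>j. of_nat j * of_int (1 + 13 * m) / 13) (\<lambda>j. of_int (int j * \<beta>)) (13 * \<tau>)"
    using theta_prod_slash_infinity[OF det, of k a] \<tau> unfolding slash_def \<alpha> \<gamma> \<beta>_def[symmetric] \<delta>_def[symmetric] by blast
  obtain n where n: "int k + (\<Sum>j=1..6. a j) = 12 * n" using K by blast
  have \<epsilon>1: "\<epsilon> powi (int k + (\<Sum>j=1..6. a j)) = 1"
    unfolding n power_int_mult using \<epsilon> by simp
  have \<tau>13: "Im (13 * \<tau>) > 0" using \<tau> by simp
  \<comment> \<open>the constant picked up by the factor with index \<open>j\<close> is \<open>ee (X j / 26)\<close>\<close>
  define X where "X = (\<lambda>j. int j * m * 13 * (1 - int j * \<beta>) + int j * \<beta> * (13 + int j))"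
  have sj: "siegel (of_nat j * of_int (1 + 13 * m) / 13) (of_int (int j * \<beta>)) (13 * \<tau>)
      = ee (of_int (X j) / 26) * siegel (of_nat j / 13) 0 (13 * \<tau>)" for j
  proof -
    have r: "of_nat j * of_int (1 + 13 * m) / 13 = of_nat j / 13 + (of_int (int j * m) :: real)"
      by (simp add: field_simps)
    have "siegel (of_nat j * of_int (1 + 13 * m) / 13) (of_int (int j * \<beta>)) (13 * \<tau>)
      = ee (of_int (int j * m) * (1 - of_real (of_int (int j * \<beta>))) / 2)
        * (ee (of_int (int j * \<beta>) * (1 + of_real (of_nat j / 13)) / 2) * siegel (of_nat j / 13) 0 (13 * \<tau>))"
      unfolding r siegel_shift_1[OF \<tau>13]
      using siegel_shift_2[of "of_nat j / 13" 0 "int j * \<beta>" "13 * \<tau>"] by simp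
    also have "\<dots> = ee (of_int (int j * m) * (1 - of_real (of_int (int j * \<beta>))) / 2
       + of_int (int j * \<beta>) * (1 + of_real (of_nat j / 13)) / 2) * siegel (of_nat j / 13) 0 (13 * \<tau>)"
      by (simp only: ee_add mult.assoc)
    also have "of_int (int j * m) * (1 - of_real (of_int (int j * \<beta>))) / 2
       + of_int (int j * \<beta>) * (1 + of_real (of_nat j / 13)) / 2 = (of_int (X j) / 26 :: complex)"
      by (simp add: X_def field_simps)
    finally show ?thesis .
  qed
  have "siegel_prod k a (\<lambda>j. of_nat j * of_int (1 + 13 * m) / 13) (\<lambda>j. of_int (int j * \<beta>)) (13 * \<tau>)
     = ee (\<Sum>j=1..6. of_int (a j) * (of_int (X j) / 26)) * theta_prod 13 (2 * k) a \<tau>"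
    unfolding theta_prod_eq_siegel_prod siegel_prod_def sj prod_powi_mult ee_powi ee_sum
    by (simp only: mult_ac)
  moreover have "(\<Sum>j=1..6. of_int (a j) * (of_int (X j) / 26)) \<in> (\<int> :: complex set)"
  proof -
    obtain t where t: "(\<Sum>j=1..6. int j ^ 2 * a j) = 13 * t" using S by blast
    have "(\<Sum>j=1..6. int j * a j) - t = 2 * (6 * t - (a 2 + 3 * a 3 + 6 * a 4 + 10 * a 5 + 15 * a 6))"
      using t unfolding sum_1_to_6 by simp
    then have J: "even ((\<Sum>j=1..6. int j * a j) - t)" by simp
    have "(\<Sum>j=1..6. a j * X j) = 13 * (m + \<beta>) * (\<Sum>j=1..6. int j * a j)
        + (\<beta> - 13 * m * \<beta>) * (\<Sum>j=1..6. int j ^ 2 * a j)"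
      unfolding X_def sum_1_to_6 by (simp add: algebra_simps power2_eq_square)
    also have "\<dots> = 13 * ((m + \<beta>) * ((\<Sum>j=1..6. int j * a j) - t) + t * (m * (1 + \<beta>) + 2 * (\<beta> - 7 * m * \<beta>)))"
      unfolding t by (simp add: algebra_simps)
    finally have "26 dvd (\<Sum>j=1..6. a j * X j)"
    proof -
      assume *: "(\<Sum>j=1..6. a j * X j) = 13 * ((m + \<beta>) * ((\<Sum>j=1..6. int j * a j) - t) + t * (m * (1 + \<beta>) + 2 * (\<beta> - 7 * m * \<beta>)))"
      have "2 dvd (m + \<beta>) * ((\<Sum>j=1..6. int j * a j) - t) + t * (m * (1 + \<beta>) + 2 * (\<beta> - 7 * m * \<beta>))"
      proof (rule dvd_add)
        show "2 dvd (m + \<beta>) * ((\<Sum>j=1..6. int j * a j) - t)" using J by (rule dvd_mult)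
        have "2 dvd m * (1 + \<beta>) + 2 * (\<beta> - 7 * m * \<beta>)" using ev by (rule dvd_add) simp
        then show "2 dvd t * (m * (1 + \<beta>) + 2 * (\<beta> - 7 * m * \<beta>))" by (rule dvd_mult)
      qed
      then have "13 * 2 dvd (\<Sum>j=1..6. a j * X j)" unfolding * by (intro mult_dvd_mono) auto
      then show ?thesis by simp
    qed
    then obtain u where u: "(\<Sum>j=1..6. a j * X j) = 26 * u" by blast
    have "(\<Sum>j=1..6. of_int (a j) * (of_int (X j) / 26)) = (of_int (\<Sum>j=1..6. a j * X j) / 26 :: complex)"
      by (simp add: sum_divide_distrib)
    also have "\<dots> = of_int u" unfolding u by simp
    finally show ?thesis by simp
  qed
  ultimately show ?thesis unfolding s \<epsilon>1 by (simp add: ee_eq_1_iff[THEN iffD2])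
qed

text \<open>The exact multiplier of the generator of the stabiliser of the cusp \<open>0\<close>; it makes the divisibility by \<open>12\<close>
  necessary.\<close>
lemma theta_prod_parabolic_zero:
  assumes \<tau>: "Im \<tau> > 0"
  shows "slash k (theta_prod 13 (2 * k) a) (mat2 1 0 13 1) \<tau>
     = ee (- of_int (int k + (\<Sum>j=1..6. a j)) / 12) * theta_prod 13 (2 * k) a \<tau>"
proof -
  have det: "(1::int) * 1 - 0 * (13 * 1) = 1" by simp
  obtain \<epsilon> where \<epsilon>: "eta2 (13 * \<tau> / (13 * \<tau> + 1)) = \<epsilon> * (13 * \<tau> + 1) * eta2 (13 * \<tau>)"
   and s: "slash k (theta_prod 13 (2 * k) a) (mat2 1 0 13 1) \<tau>
     = \<epsilon> powi (int k + (\<Sum>j=1..6. a j)) * theta_prod 13 (2 * k) a \<tau>"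
    using theta_prod_slash_infinity[OF det, of k a] \<tau>
    unfolding slash_def theta_prod_eq_siegel_prod by auto
  define w where "w = 13 * \<tau>"
  have w: "Im w > 0" using \<tau> by (simp add: w_def)
  have w0: "w \<noteq> 0" using w by auto
  have w1: "w + 1 \<noteq> 0" using automorphy_factor_nonzero[of w 1 1 0 1] w by simp
  define u where "u = - 1 / w + of_int (- 1)"
  have "Im (- 1 / w) > 0" using Im_moebius_pos[of w 0 0 "-1" 1] w by simp
  then have u: "Im u > 0" by (simp add: u_def)
  have "eta2 (- 1 / u) = - \<i> * u * (ee (of_int (- 1) / 12) * (- \<i> * w * eta2 w))"
    unfolding eta2_inversion[OF u] unfolding u_def eta2_translation eta2_inversion[OF w] ..
  also have "\<dots> = (\<i> * \<i>) * (ee (of_int (- 1) / 12) * (u * w) * eta2 w)"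
    by (simp only: mult_ac mult_minus_left mult_minus_right minus_minus)
  also have "\<dots> = ee (- 1 / 12) * (- (u * w)) * eta2 w" by simp
  also have "- (u * w) = w + 1" using w0 by (simp add: u_def field_simps)
  also have "- 1 / u = w / (w + 1)"
  proof -
    have u: "u = - ((w + 1) / w)" using w0 by (simp add: u_def field_simps)
    show ?thesis unfolding u by (simp only: minus_divide_divide divide_divide_eq_right mult_1)
  qed
  finally have "\<epsilon> * (w + 1) * eta2 w = ee (- 1 / 12) * (w + 1) * eta2 w"
    using \<epsilon> by (simp add: w_def)
  then have "\<epsilon> = ee (- 1 / 12)" using w1 eta2_nonzero[OF w] by simp
  then have "\<epsilon> powi K = ee (of_int K * (- 1 / 12))" for K by (simp only: ee_powi)
  moreover have "of_int K * (- 1 / 12 :: complex) = - of_int K / 12" for K by simp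
  ultimately show ?thesis unfolding s by (simp only:)
qed

lemma theta_prod_modular_form_iff:
  "theta_prod 13 (2 * k) a \<in> modular_forms k (Gamma1 13) \<longleftrightarrow>
     12 dvd int k + (\<Sum>j=1..6. a j) \<and> 13 dvd (\<Sum>j=1..6. int j ^ 2 * a j) \<and>
     0 \<le> int k + (\<Sum>j=1..6. a j) \<and>
     (\<forall>i\<in>{1..6}. 6 * residue_form i a \<le> 169 * (int k + (\<Sum>j=1..6. a j)))"
    (is "?M \<longleftrightarrow> ?K \<and> ?S \<and> ?P")
proof -
  let ?f = "theta_prod 13 (2 * k) a"
  have M: "?M \<longleftrightarrow> ?f holomorphic_on upper_half_plane \<and>
     (\<forall>A\<in>Gamma1 13. \<forall>\<tau>\<in>upper_half_plane. slash k ?f A \<tau> = ?f \<tau>) \<and>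
     (\<forall>A\<in>SL2Z. bounded_at_infinity (slash k ?f A))"
    unfolding modular_forms_def bounded_at_infinity_def upper_half_plane_def by simp
  have hol: "?f holomorphic_on upper_half_plane"
  proof -
    have "(\<lambda>\<tau>. siegel_prod k a (\<lambda>j. of_nat j / 13) (\<lambda>j. 0) (13 * \<tau>)) holomorphic_on upper_half_plane"
      using of_nat_div_13_notin_Ints[of _ 1]
      by (intro siegel_prod_holomorphic holomorphic_intros)
         (auto simp: upper_half_plane_def open_halfspace_Im_gt)
    then show ?thesis by (simp add: theta_prod_eq_siegel_prod[abs_def])
  qed
  have I: "(\<forall>A\<in>Gamma1 13. \<forall>\<tau>\<in>upper_half_plane. slash k ?f A \<tau> = ?f \<tau>) \<longleftrightarrow> ?K \<and> ?S"
  proof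
    assume "?K \<and> ?S"
    then show "\<forall>A\<in>Gamma1 13. \<forall>\<tau>\<in>upper_half_plane. slash k ?f A \<tau> = ?f \<tau>"
      using theta_prod_invariant by (simp add: upper_half_plane_def)
  next
    assume inv: "\<forall>A\<in>Gamma1 13. \<forall>\<tau>\<in>upper_half_plane. slash k ?f A \<tau> = ?f \<tau>"
    have G: "mat2 1 1 0 1 \<in> Gamma1 13" "mat2 1 0 13 1 \<in> Gamma1 13"
      by (simp_all add: Gamma1_def SL2Z_iff cong_def)
    have i: "\<i> \<in> upper_half_plane" "Im \<i> > 0" by (simp_all add: upper_half_plane_def)
    have nz: "?f \<i> \<noteq> 0" by (rule theta_prod_13_nonzero) simp
    define d where "d = int k + (\<Sum>j=1..6. a j)"
    have "ee (- of_int d / 12) = 1"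
      using theta_prod_parabolic_zero[OF i(2), of k a] inv G(2) i(1) nz unfolding d_def by simp
    then have "- of_int d / 12 \<in> (\<int> :: complex set)" by (simp only: ee_eq_1_iff)
    then obtain t where "- of_int d / 12 = (of_int t :: complex)" by (rule Ints_cases)
    then have "Re (- of_int d / 12) = Re (of_int t)" by (rule arg_cong)
    then have "- real_of_int d / 12 = of_int t" by simp
    then have "real_of_int d = of_int (- 12 * t)" by simp
    then have "d = - 12 * t" by (simp only: of_int_eq_iff)
    then have "d = 12 * (- t)" by simp
    then have t: "int k + (\<Sum>j=1..6. a j) = 12 * (- t)" by (simp only: d_def)
    then have K: ?K by simp
    define v where "v = real 13 / 24 * of_int (S1 13 (2 * k) a) - 1 / (2 * real 13) * of_int (S2 13 a)"
    have "slash k ?f (mat2 1 1 0 1) \<i> = ee (of_real v) * ?f \<i>"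
      unfolding slash_def v_def using theta_prod_translation[of 13 "2 * k" a \<i>] by simp
    then have "ee (of_real v) = 1" using inv G(1) i(1) nz by simp
    then obtain n where "(of_real v :: complex) = of_int n" unfolding ee_eq_1_iff by (auto elim: Ints_cases)
    then have n: "v = of_int n" by (metis of_real_eq_iff of_real_of_int_eq)
    have S1: "S1 13 (2 * k) a = 24 * (- t)" using t by (simp add: S1_def)
    have "of_int (13 * 26 * (- t) - S2 13 a) = (of_int (26 * n) :: real)"
      using n unfolding v_def S1 by (simp add: field_simps)
    then have 1: "13 * 26 * (- t) - S2 13 a = 26 * n" by (simp only: of_int_eq_iff)
    have 6: "(13 div 2 :: nat) = 6" by simp
    have "S2 13 a = 13 * (\<Sum>j=1..6. int j * a j) - (\<Sum>j=1..6. int j ^ 2 * a j)"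
      unfolding S2_def 6 sum_1_to_6 by (simp add: algebra_simps)
    then have "(\<Sum>j=1..6. int j ^ 2 * a j) = 13 * ((\<Sum>j=1..6. int j * a j) + 26 * t + 2 * n)"
      using 1 by (simp add: algebra_simps)
    then have ?S by simp
    with K show "?K \<and> ?S" ..
  qed
  show ?thesis unfolding M I using hol theta_prod_cusps_iff[of k a] by blast
qed

section \<open>Counting compositions in a residue class modulo 19\<close>

text \<open>Vectors of naturals, one entry for each weight, with entry sum \<open>n\<close> and weighted sum congruent to \<open>c\<close>
  modulo \<open>19\<close>.\<close>
definition weighted_compositions :: "nat list \<Rightarrow> nat \<Rightarrow> nat \<Rightarrow> nat list set" where
  "weighted_compositions ws n c = {vs. length vs = length ws \<and> sum_list vs = n \<and>
     (\<Sum>(w, v)\<leftarrow>zip ws vs. w * v) mod 19 = c mod 19}"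

lemma finite_lists_sum: "finite {vs :: nat list. length vs = m \<and> sum_list vs = n}"
proof (rule finite_subset)
  show "{vs :: nat list. length vs = m \<and> sum_list vs = n} \<subseteq> {vs. set vs \<subseteq> {..n} \<and> length vs = m}"
    using member_le_sum_list by fastforce
qed (rule finite_lists_length_eq, simp)

lemma finite_weighted_compositions: "finite (weighted_compositions ws n c)"
  by (rule finite_subset[OF _ finite_lists_sum[of "length ws" n]]) (auto simp: weighted_compositions_def)

definition comp_count :: "nat list \<Rightarrow> nat \<Rightarrow> nat \<Rightarrow> int" where
  "comp_count ws n c = int (card (weighted_compositions ws n c))"

lemma comp_count_Cons_0: "comp_count (w # ws) 0 c = comp_count ws 0 c"
proof -
  have "weighted_compositions (w # ws) 0 c = (\<lambda>vs. 0 # vs) ` weighted_compositions ws 0 c"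
    by (auto simp: weighted_compositions_def length_Suc_conv image_iff)
  then show ?thesis by (simp add: comp_count_def card_image)
qed

text \<open>Either the first entry vanishes, or it can be decreased by one. In the second case the class drops by \<open>w\<close>;
  it is written \<open>c + 19 - w\<close> to stay among the naturals.\<close>
lemma comp_count_Cons_Suc:
  assumes "w \<le> 19"
  shows "comp_count (w # ws) (Suc n) c = comp_count (w # ws) n (c + 19 - w) + comp_count ws (Suc n) c"
proof -
  let ?inc = "\<lambda>vs. Suc (hd vs) # tl vs"
  have eq: "weighted_compositions (w # ws) (Suc n) c
      = ?inc ` weighted_compositions (w # ws) n (c + 19 - w) \<union> (\<lambda>vs. 0 # vs) ` weighted_compositions ws (Suc n) c"
    (is "?A = ?B \<union> ?C")
  proof (rule set_eqI)
    have m: "(w * Suc v + x) mod 19 = c mod 19 \<longleftrightarrow> (w * v + x) mod 19 = (c + 19 - w) mod 19" for v x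
    proof -
      have "(w * v + x) mod 19 = (c + 19 - w) mod 19 \<longleftrightarrow> (w * v + x + w) mod 19 = (c + 19 - w + w) mod 19"
        by (metis cong_add_rcancel_nat cong_def)
      then show ?thesis using assms by (simp add: algebra_simps)
    qed
    fix us
    show "us \<in> ?A \<longleftrightarrow> us \<in> ?B \<union> ?C"
    proof (cases us)
      case Nil
      then show ?thesis by (auto simp: weighted_compositions_def)
    next
      case (Cons u vs)
      show ?thesis
      proof (cases u)
        case 0
        then show ?thesis using Cons by (auto simp: weighted_compositions_def)
      next
        case (Suc u')
        have B: "us \<in> ?B \<longleftrightarrow> u' # vs \<in> weighted_compositions (w # ws) n (c + 19 - w)"
        proof
          assume "us \<in> ?B"
          then obtain xs where xs: "us = ?inc xs" "xs \<in> weighted_compositions (w # ws) n (c + 19 - w)" by blast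
          then have "xs = u' # vs" using Cons Suc
            by (cases xs) (auto simp: weighted_compositions_def)
          then show "u' # vs \<in> weighted_compositions (w # ws) n (c + 19 - w)" using xs by simp
        qed (use Cons Suc in force)
        have A: "us \<in> ?A \<longleftrightarrow> u' # vs \<in> weighted_compositions (w # ws) n (c + 19 - w)"
          using m[of u' "\<Sum>(w, v)\<leftarrow>zip ws vs. w * v"] Cons Suc
          by (simp add: weighted_compositions_def)
        have C: "us \<notin> ?C" using Cons Suc by auto
        show ?thesis unfolding A Un_iff B using C by simp
      qed
    qed
  qed
  have inj: "inj_on ?inc (weighted_compositions (w # ws) n (c + 19 - w))"
  proof (rule inj_onI)
    fix xs ys
    assume "xs \<in> weighted_compositions (w # ws) n (c + 19 - w)"
      "ys \<in> weighted_compositions (w # ws) n (c + 19 - w)" "?inc xs = ?inc ys"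
    then show "xs = ys"
      by (cases xs; cases ys) (simp_all add: weighted_compositions_def)
  qed
  have "?B \<inter> ?C = {}" by auto
  then have "card ?A = card ?B + card ?C"
    unfolding eq by (intro card_Un_disjoint finite_imageI finite_weighted_compositions)
  then show ?thesis by (simp add: comp_count_def card_image[OF inj] card_image)
qed

text \<open>For distinct weights modulo \<open>19\<close> the deviation of \<open>19\<close> times the count from the binomial coefficient is
  periodic in \<open>n\<close> modulo \<open>19\<close>: the generating function in a character \<open>\<chi> \<noteq> 1\<close> is \<open>1 / \<Prod>\<^sub>w (1 - \<chi>(w) x)\<close>, whose
  denominator divides \<open>1 - x\<^sup>1\<^sup>9\<close>. The deviations form a \<open>19 \<times> 19\<close> table with rows indexed by \<open>n\<close> and columns by \<open>c\<close>;
  it is computed weight by weight from the recurrence of the counts, where lowering the class is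
  a cyclic shift of the row.\<close>
definition shift_row :: "nat \<Rightarrow> int list \<Rightarrow> int list" where
  "shift_row w r = map (\<lambda>c. r ! ((c + 19 - w) mod 19)) [0..<19]"

fun next_rows :: "nat \<Rightarrow> int list \<Rightarrow> int list list \<Rightarrow> int list list" where
  "next_rows w r [] = []"
| "next_rows w r (t # ts) = (let r' = map2 (+) (shift_row w r) t in r' # next_rows w r' ts)"

definition next_table :: "nat \<Rightarrow> int list list \<Rightarrow> int list list" where
  "next_table w T = hd T # next_rows w (hd T) (tl T)"

text \<open>The deviation table of a nonempty list of weights; for a single weight the count is \<open>0\<close> or \<open>1\<close>, so the
  deviations are \<open>-1\<close> and \<open>18\<close>.\<close>
fun table :: "nat list \<Rightarrow> int list list" where
  "table [] = []"
| "table [w] = map (\<lambda>n. map (\<lambda>c. if c = (w * n) mod 19 then 18 else -1) [0..<19]) [0..<19]"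
| "table (w # ws) = next_table w (table ws)"


text \<open>The table \<open>T'\<close> starts like \<open>T\<close> and satisfies the recurrence of the counts cyclically; the wrap-around
  from row \<open>18\<close> to row \<open>0\<close> is what makes the deviations periodic.\<close>
definition table_ok :: "nat \<Rightarrow> int list list \<Rightarrow> int list list \<Rightarrow> bool" where
  "table_ok w T T' \<longleftrightarrow> (\<forall>c\<in>set [0..<19]. T' ! 0 ! c = T ! 0 ! c) \<and> (\<forall>n\<in>set [0..<19]. \<forall>c\<in>set[0..<19].
      T' ! (Suc n mod 19) ! c = T' ! n ! ((c + 19 - w) mod 19) + T ! (Suc n mod 19) ! c)"

text \<open>\<open>T\<close> is the table of deviations for the weights \<open>ws\<close>.\<close>
definition counts_by :: "nat list \<Rightarrow> int list list \<Rightarrow> bool" where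
  "counts_by ws T \<longleftrightarrow> (\<forall>n c. 19 * comp_count ws n c
     = int ((n + length ws - 1) choose (length ws - 1)) + T ! (n mod 19) ! (c mod 19))"

lemma counts_by_singleton: "counts_by [w] (table [w])"
  unfolding counts_by_def
proof (intro allI)
  fix n c
  have "weighted_compositions [w] n c = (if c mod 19 = (w * n) mod 19 then {[n]} else {})"
    by (auto simp: weighted_compositions_def length_Suc_conv)
  moreover have "table [w] ! (n mod 19) ! (c mod 19) = (if c mod 19 = (w * n) mod 19 then 18 else -1)"
    by (simp add: mod_mult_right_eq)
  ultimately show "19 * comp_count [w] n c
     = int ((n + length [w] - 1) choose (length [w] - 1)) + table [w] ! (n mod 19) ! (c mod 19)"
    by (simp add: comp_count_def)
qed

lemma counts_by_Cons:
  assumes "counts_by ws T" "table_ok w T T'" "w \<le> 19" "ws \<noteq> []"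
  shows "counts_by (w # ws) T'"
proof -
  obtain m where m: "length ws = Suc m" using assms(4) by (cases ws) auto
  have T: "19 * comp_count ws n c = int ((n + m) choose m) + T ! (n mod 19) ! (c mod 19)" for n c
    using assms(1) by (simp add: counts_by_def m)
  have "19 * comp_count (w # ws) n c = int ((n + Suc m) choose (Suc m)) + T' ! (n mod 19) ! (c mod 19)" for n c
  proof (induction n arbitrary: c)
    case 0
    have "T' ! 0 ! (c mod 19) = T ! 0 ! (c mod 19)"
      using assms(2) by (simp add: table_ok_def)
    then show ?case using T[of 0 c] by (simp add: comp_count_Cons_0)
  next
    case (Suc n)
    have "T' ! (Suc (n mod 19) mod 19) ! (c mod 19)
        = T' ! (n mod 19) ! ((c mod 19 + 19 - w) mod 19) + T ! (Suc (n mod 19) mod 19) ! (c mod 19)"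
      using assms(2) by (simp add: table_ok_def)
    moreover have "Suc (n mod 19) mod 19 = Suc n mod 19" by (simp add: mod_Suc_eq)
    moreover have "(c mod 19 + 19 - w) mod 19 = (c + 19 - w) mod 19"
    proof -
      have "(c mod 19 + (19 - w)) mod 19 = (c + (19 - w)) mod 19" by (simp add: mod_add_left_eq)
      then show ?thesis using assms(3) by simp
    qed
    ultimately have "T' ! (Suc n mod 19) ! (c mod 19)
        = T' ! (n mod 19) ! ((c + 19 - w) mod 19) + T ! (Suc n mod 19) ! (c mod 19)" by simp
    then show ?case
      using Suc.IH[of "c + 19 - w"] T[of "Suc n" c]
      by (simp add: comp_count_Cons_Suc[OF assms(3)])
  qed
  then show ?thesis by (simp add: counts_by_def m)
qed

text \<open>The orders at the six cusps over infinity are subject to one congruence modulo \<open>19\<close>, with these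
  coefficients. They form the subgroup of order \<open>6\<close> of the units modulo \<open>19\<close>.\<close>
abbreviation cusp_weights :: "nat list" where
  "cusp_weights \<equiv> [12, 11, 8, 18, 7, 1]"

lemma table_ok_checks:
  "table_ok 7 (table [1]) (table [7, 1])"
  "table_ok 18 (table [7, 1]) (table [18, 7, 1])"
  "table_ok 8 (table [18, 7, 1]) (table [8, 18, 7, 1])"
  "table_ok 11 (table [8, 18, 7, 1]) (table [11, 8, 18, 7, 1])"
  "table_ok 12 (table [11, 8, 18, 7, 1]) (table cusp_weights)"
  by code_simp+

text \<open>The column of the final table that belongs to the trivial class.\<close>
definition correction :: "int list" where
  "correction = [18, -6, 36, -18, -12, -24, -6, 6, 24, 12, 18, -36, 6, -18, 0, 0, 0, 0, 0]"

lemma table_correction: "map hd (table cusp_weights) = correction" "length (table cusp_weights) = 19"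
   "list_all (\<lambda>r. r \<noteq> []) (table cusp_weights)"
  by code_simp+

lemma comp_count_cusp_weights:
  "19 * comp_count cusp_weights n 0 = int ((n + 5) choose 5) + correction ! (n mod 19)"
proof -
  have "counts_by cusp_weights (table cusp_weights)"
    by (rule counts_by_Cons[OF counts_by_Cons[OF counts_by_Cons[OF counts_by_Cons[OF counts_by_Cons[OF
        counts_by_singleton table_ok_checks(1)] table_ok_checks(2)] table_ok_checks(3)]
        table_ok_checks(4)] table_ok_checks(5)]) simp_all
  then have "19 * comp_count cusp_weights n 0
      = int ((n + length cusp_weights - 1) choose (length cusp_weights - 1))
        + table cusp_weights ! (n mod 19) ! (0 mod 19)"
    unfolding counts_by_def by blast
  moreover have "n + length cusp_weights - 1 = n + 5" "length cusp_weights - 1 = 5" "0 mod 19 = (0::nat)"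
    by simp_all
  ultimately have "19 * comp_count cusp_weights n 0 = int ((n + 5) choose 5) + table cusp_weights ! (n mod 19) ! 0"
    by (simp only:)
  moreover have "n mod 19 < length (table cusp_weights)" unfolding table_correction by simp
  then have "table cusp_weights ! (n mod 19) ! 0 = map hd (table cusp_weights) ! (n mod 19)"
    using table_correction(3) by (simp add: hd_conv_nth list_all_length del: table.simps)
  ultimately show ?thesis unfolding table_correction by simp
qed

section \<open>The closed form of the divisor count\<close>

text \<open>The number of effective cuspidal divisors of trivial class that belong to weight \<open>k\<close>: \<open>s\<close> is the common
  order at the six cusps over \<open>0\<close>, and the six orders at the cusps over infinity add up to \<open>7k - 6s\<close>.\<close>
definition divisor_count :: "nat \<Rightarrow> int" where
  "divisor_count k = (\<Sum>s | 6 * s \<le> 7 * k. comp_count cusp_weights (7 * k - 6 * s) 0)"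

lemma finite_slack: "finite {s::nat. 6 * s \<le> 7 * k}"
  by (rule finite_subset[of _ "{..7 * k}"]) auto

text \<open>Raising \<open>k\<close> by \<open>6\<close> and \<open>s\<close> by \<open>7\<close> leaves \<open>7k - 6s\<close> unchanged, so seven new terms appear.\<close>
lemma divisor_count_add_6:
  "divisor_count (k + 6) = divisor_count k + (\<Sum>s<7. comp_count cusp_weights (7 * k + 42 - 6 * s) 0)"
proof -
  have split: "{s. 6 * s \<le> 7 * (k + 6)} = {..<7} \<union> (\<lambda>s. s + 7) ` {s. 6 * s \<le> 7 * k}"
  proof (rule set_eqI)
    fix s :: nat
    show "s \<in> {s. 6 * s \<le> 7 * (k + 6)} \<longleftrightarrow> s \<in> {..<7} \<union> (\<lambda>s. s + 7) ` {s. 6 * s \<le> 7 * k}"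
    proof (cases "s < 7")
      case False
      then obtain u where "s = u + 7" by (metis add.commute le_iff_add not_less)
      then show ?thesis by auto
    qed auto
  qed
  have "divisor_count (k + 6) = (\<Sum>s<7. comp_count cusp_weights (7 * (k + 6) - 6 * s) 0)
     + (\<Sum>s\<in>(\<lambda>s. s + 7) ` {s. 6 * s \<le> 7 * k}. comp_count cusp_weights (7 * (k + 6) - 6 * s) 0)"
    unfolding divisor_count_def split
    by (intro sum.union_disjoint finite_imageI finite_slack) auto
  also have "(\<Sum>s\<in>(\<lambda>s. s + 7) ` {s. 6 * s \<le> 7 * k}. comp_count cusp_weights (7 * (k + 6) - 6 * s) 0)
     = divisor_count k"
    unfolding divisor_count_def by (subst sum.reindex) (auto simp: inj_on_def)
  finally show ?thesis by (simp add: algebra_simps)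
qed

lemma choose_5: "real ((n + 5) choose 5)
   = (real n + 1) * (real n + 2) * (real n + 3) * (real n + 4) * (real n + 5) / 120"
proof -
  have "real (n + 5) gchoose 5 = (real n + 1) * (real n + 2) * (real n + 3) * (real n + 4) * (real n + 5) / 120"
    by (simp add: gbinomial_prod_rev numeral_eq_Suc algebra_simps)
  then show ?thesis by (simp add: binomial_gbinomial)
qed

text \<open>By periodicity modulo \<open>114\<close> the recurrence of the tabulated function is a finite check.\<close>
lemma C13_step_check:
  "list_all (\<lambda>r. C13 (r + 6) - C13 r = (\<Sum>s\<leftarrow>[0..<7]. correction ! ((7 * r + 42 - 6 * s) mod 19))) [0..<114]"
  by (simp add: C13_def C13_rows_def correction_def upt_conv_Cons)

lemma C13_step: "C13 (k + 6) - C13 k = (\<Sum>s<7. correction ! ((7 * k + 42 - 6 * s) mod 19))"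
proof -
  define r where "r = k mod 114"
  have "C13 (k + 6) = C13 (r + 6)" "C13 k = C13 r"
    by (simp_all add: C13_def r_def mod_add_left_eq)
  moreover have "C13 (r + 6) - C13 r = (\<Sum>s\<leftarrow>[0..<7]. correction ! ((7 * r + 42 - 6 * s) mod 19))"
    using C13_step_check by (simp add: list_all_iff r_def)
  moreover have "(\<Sum>s\<leftarrow>[0..<7]. correction ! ((7 * r + 42 - 6 * s) mod 19))
      = (\<Sum>s<7. correction ! ((7 * r + 42 - 6 * s) mod 19))"
    by (simp only: interv_sum_list_conv_sum_set_nat atLeast_upt[symmetric] set_upt atLeast0LessThan)
  moreover have "(7 * r + 42 - 6 * s) mod 19 = (7 * k + 42 - 6 * s) mod 19" if "s < 7" for s
  proof -
    have k: "k = 114 * (k div 114) + r" by (simp add: r_def)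
    have "7 * k + 42 - 6 * s = (7 * r + 42 - 6 * s) + 19 * (42 * (k div 114))"
      using that k by linarith
    then show ?thesis by (simp only: mod_mult_self2)
  qed
  ultimately show ?thesis by simp
qed

lemma T13_step:
  "19 * (T13 (k + 6) - T13 k) = (\<Sum>s<7. real ((7 * k + 42 - 6 * s + 5) choose 5))"
proof -
  define x where "x = real k"
  have "real (7 * k + 42 - 6 * s) = 7 * x + 42 - 6 * real s" if "s < 7" for s
    using that by (simp add: of_nat_diff x_def)
  then have "(\<Sum>s<7. real ((7 * k + 42 - 6 * s + 5) choose 5))
     = (\<Sum>s<7. (\<lambda>x. (x + 1) * (x + 2) * (x + 3) * (x + 4) * (x + 5) / 120) (7 * x + 42 - 6 * real s))"
    (is "?lhs = ?rhs") unfolding choose_5 by (intro sum.cong) auto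
  also have "?rhs = (\<Sum>s\<in>{0, 1, 2, 3, 4, 5, 6 :: nat}. (\<lambda>x. (x + 1) * (x + 2) * (x + 3) * (x + 4) * (x + 5) / 120) (7 * x + 42 - 6 * real s))"
    by (intro sum.cong) auto
  also have "(\<Sum>s\<in>{0, 1, 2, 3, 4, 5, 6 :: nat}. (\<lambda>x. (x + 1) * (x + 2) * (x + 3) * (x + 4) * (x + 5) / 120) (7 * x + 42 - 6 * real s))
     = 117649 / 120 * x ^ 5 + 151263 / 8 * x ^ 4 + 4189745 / 24 * x ^ 3 + 7158753 / 8 * x ^ 2 + 146383433 / 60 * x + 2767023"
    by (simp add: field_simps power_numeral_reduce)
  also have "\<dots> = 19 * (T13 (k + 6) - T13 k)"
  proof -
    have "(x + 6) ^ 2 = x ^ 2 + 12 * x + 36" "(x + 6) ^ 3 = x ^ 3 + 18 * x ^ 2 + 108 * x + 216"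
      "(x + 6) ^ 4 = x ^ 4 + 24 * x ^ 3 + 216 * x ^ 2 + 864 * x + 1296"
      "(x + 6) ^ 5 = x ^ 5 + 30 * x ^ 4 + 360 * x ^ 3 + 2160 * x ^ 2 + 6480 * x + 7776"
      "(x + 6) ^ 6 = x ^ 6 + 36 * x ^ 5 + 540 * x ^ 4 + 4320 * x ^ 3 + 19440 * x ^ 2 + 46656 * x + 46656"
      by (simp_all add: algebra_simps power_numeral_reduce)
    then show ?thesis
      unfolding T13_def x_def by (simp add: field_simps)
  qed
  finally show ?thesis by simp
qed

lemma divisor_count_closed_form: "real_of_int (divisor_count k) = T13 k + E13 k"
proof (induction k rule: less_induct)
  case (less k)
  show ?case
  proof (cases "k < 6")
    case True
    have "{s. 6 * s \<le> 7 * k} = {..<Suc (7 * k div 6)}" by auto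
    then have "19 * divisor_count k
      = (\<Sum>s<Suc (7 * k div 6). int ((7 * k - 6 * s + 5) choose 5) + correction ! ((7 * k - 6 * s) mod 19))"
      unfolding divisor_count_def by (simp only: sum_distrib_left comp_count_cusp_weights)
    then have "real_of_int (19 * divisor_count k)
      = real_of_int (\<Sum>s<Suc (7 * k div 6). int ((7 * k - 6 * s + 5) choose 5) + correction ! ((7 * k - 6 * s) mod 19))"
      by (rule arg_cong)
    then have *: "19 * real_of_int (divisor_count k)
      = (\<Sum>s<Suc (7 * k div 6). real ((7 * k - 6 * s + 5) choose 5) + of_int (correction ! ((7 * k - 6 * s) mod 19)))"
      by simp
    have "k = 0 \<or> k = 1 \<or> k = 2 \<or> k = 3 \<or> k = 4 \<or> k = 5" using True by auto
    then have "19 * real_of_int (divisor_count k) = 19 * (T13 k + E13 k)" unfolding * choose_5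
      by (elim disjE) (simp_all add: T13_def E13_def C13_def C13_rows_def d13_def correction_def lessThan_nat_numeral)
    then show ?thesis by simp
  next
    case False
    then obtain j where k: "k = j + 6" by (metis add.commute le_iff_add not_less)
    have "19 * real_of_int (divisor_count k) = 19 * real_of_int (divisor_count j)
       + real_of_int (\<Sum>s<7. 19 * comp_count cusp_weights (7 * j + 42 - 6 * s) 0)"
      unfolding k divisor_count_add_6 by (simp add: sum_distrib_left)
    also have "real_of_int (\<Sum>s<7. 19 * comp_count cusp_weights (7 * j + 42 - 6 * s) 0)
       = (\<Sum>s<7. real ((7 * j + 42 - 6 * s + 5) choose 5)) + of_int (\<Sum>s<7. correction ! ((7 * j + 42 - 6 * s) mod 19))"
      unfolding comp_count_cusp_weights by (simp add: sum.distrib)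
    also have "\<dots> = 19 * (T13 k - T13 j) + of_int (C13 k - C13 j)"
      unfolding T13_step[symmetric] C13_step[symmetric] k ..
    finally have 1: "19 * real_of_int (divisor_count k) = 19 * (T13 j + E13 j) + (19 * (T13 k - T13 j) + of_int (C13 k - C13 j))"
      using less.IH[of j] k by simp
    have "k mod 6 = j mod 6" by (simp add: k)
    then have "19 * (E13 k - E13 j) = of_int (C13 k - C13 j)"
      by (simp add: E13_def field_simps)
    with 1 show ?thesis by simp
  qed
qed

section \<open>Exponent vectors and cuspidal divisors\<close>

text \<open>The exponent vectors singled out by the arithmetic conditions for being a modular form of weight \<open>k\<close>.\<close>
definition admissible :: "nat \<Rightarrow> (nat \<Rightarrow> int) set" where
  "admissible k = {a \<in> {1..6} \<rightarrow>\<^sub>E UNIV. 12 dvd int k + (\<Sum>j=1..6. a j) \<and>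
     13 dvd (\<Sum>j=1..6. int j ^ 2 * a j) \<and> 0 \<le> int k + (\<Sum>j=1..6. a j) \<and>
     (\<forall>i\<in>{1..6}. 6 * residue_form i a \<le> 169 * (int k + (\<Sum>j=1..6. a j)))}"

lemma residue_form_explicit:
  "residue_form 1 a = 12 * a 1 + 22 * a 2 + 30 * a 3 + 36 * a 4 + 40 * a 5 + 42 * a 6"
  "residue_form 2 a = 22 * a 1 + 36 * a 2 + 42 * a 3 + 40 * a 4 + 30 * a 5 + 12 * a 6"
  "residue_form 3 a = 30 * a 1 + 42 * a 2 + 36 * a 3 + 12 * a 4 + 22 * a 5 + 40 * a 6"
  "residue_form 4 a = 36 * a 1 + 40 * a 2 + 12 * a 3 + 30 * a 4 + 42 * a 5 + 22 * a 6"
  "residue_form 5 a = 40 * a 1 + 30 * a 2 + 22 * a 3 + 42 * a 4 + 12 * a 5 + 36 * a 6"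
  "residue_form 6 a = 42 * a 1 + 12 * a 2 + 40 * a 3 + 22 * a 4 + 36 * a 5 + 30 * a 6"
  unfolding residue_form_def sum_1_to_6 by simp_all

text \<open>One divisibility by \<open>13\<close> thus makes the orders at all cusps over infinity integral.\<close>
lemma residue_form_cong_13: "13 dvd residue_form i a + i ^ 2 * (\<Sum>j=1..6. int j ^ 2 * a j)"
proof -
  have "13 dvd (\<Sum>j=1..6. ((int j * i mod 13) * (13 - int j * i mod 13) + i ^ 2 * int j ^ 2) * a j)"
  proof (intro dvd_sum dvd_mult2)
    fix j
    have "[(int j * i mod 13) * (13 - int j * i mod 13) = (int j * i) * (0 - int j * i)] (mod 13)"
      by (intro cong_mult cong_diff) (simp_all add: cong_def)
    moreover have "(int j * i) * (0 - int j * i) = - (i ^ 2 * int j ^ 2)"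
      by (simp add: power2_eq_square)
    ultimately have "[(int j * i mod 13) * (13 - int j * i mod 13) = - (i ^ 2 * int j ^ 2)] (mod 13)" by simp
    then show "13 dvd (int j * i mod 13) * (13 - int j * i mod 13) + i ^ 2 * int j ^ 2"
      by (simp add: cong_iff_dvd_diff)
  qed
  then show ?thesis
    by (simp only: residue_form_def distrib_right sum.distrib sum_distrib_left mult.assoc)
qed

lemma even_residue_form: "even (residue_form i a)"
proof -
  have "even (x * (13 - x))" for x :: int by (cases "even x") auto
  then show ?thesis unfolding residue_form_def by (rule dvd_sum[OF dvd_mult2])
qed

text \<open>The order at the cusp over infinity with index \<open>i\<close>. The division by \<open>26\<close> is exact for admissible vectors.\<close>
definition cusp_order :: "nat \<Rightarrow> (nat \<Rightarrow> int) \<Rightarrow> int \<Rightarrow> int" where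
  "cusp_order k a i = (338 * ((int k + (\<Sum>j=1..6. a j)) div 12) - residue_form i a) div 26"

lemma cusp_order_eq:
  assumes "int k + (\<Sum>j=1..6. a j) = 12 * s" "13 dvd (\<Sum>j=1..6. int j ^ 2 * a j)"
  shows "26 * cusp_order k a i = 338 * s - residue_form i a"
proof -
  have "13 dvd residue_form i a"
    using residue_form_cong_13[of i a] assms(2) by (simp add: dvd_add_left_iff)
  moreover have "coprime (13::int) 2" by simp
  ultimately have "13 * 2 dvd residue_form i a"
    using even_residue_form by (intro divides_mult)
  then have "26 dvd 338 * s - residue_form i a" by simp
  then show ?thesis unfolding cusp_order_def assms(1) by simp
qed

text \<open>The divisors counted by \<^term>\<open>divisor_count\<close>, as pairs of \<open>s\<close> and the list of the six orders over infinity.\<close>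
definition divisors :: "nat \<Rightarrow> (nat \<times> nat list) set" where
  "divisors k = (SIGMA s:{s. 6 * s \<le> 7 * k}. weighted_compositions cusp_weights (7 * k - 6 * s) 0)"

definition divisor_of :: "nat \<Rightarrow> (nat \<Rightarrow> int) \<Rightarrow> nat \<times> nat list" where
  "divisor_of k a = (nat ((int k + (\<Sum>j=1..6. a j)) div 12),
     map (\<lambda>i. nat (cusp_order k a i)) [1, 2, 3, 4, 5, 6])"

text \<open>The inverse of the linear map from exponents to orders, multiplied by \<open>19\<close>, modulo multiples of
  \<open>\<Sum>v\<^sub>i + 6s - 7k\<close>. Each row is proportional to \<^term>\<open>cusp_weights\<close> modulo \<open>19\<close>, hence the division in
  \<open>exponents_of\<close> is exact on divisors of trivial class.\<close>
definition exponent_coeffs :: "int list list" where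
  "exponent_coeffs =
    [[46, 39, 37, 31, 30, 26],
     [39, 31, 26, 30, 37, 46],
     [37, 26, 31, 46, 39, 30],
     [31, 30, 46, 37, 26, 39],
     [30, 37, 39, 26, 46, 31],
     [26, 46, 30, 39, 31, 37]]"

text \<open>The exponent vector of the theta product with the given orders.\<close>
definition exponents_of :: "nat \<Rightarrow> nat \<times> nat list \<Rightarrow> nat \<Rightarrow> int" where
  "exponents_of k = (\<lambda>(s, vs). \<lambda>j\<in>{1..6}.
     13 * (int s - int k) + (\<Sum>(c, v)\<leftarrow>zip (exponent_coeffs ! (j - 1)) vs. c * int v) div 19)"

lemma exponents_of_eq:
  fixes k s t :: nat
  assumes W: "12 * v1 + 11 * v2 + 8 * v3 + 18 * v4 + 7 * v5 + v6 = 19 * t"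
  defines "a \<equiv> exponents_of k (s, [v1, v2, v3, v4, v5, v6])"
  shows "a 1 = 13 * (int s - int k) + 7 * int t - 2 * int v1 - 2 * int v2 - int v3 - 5 * int v4 - int v5 + int v6"
    "a 2 = 13 * (int s - int k) + 8 * int t - 3 * int v1 - 3 * int v2 - 2 * int v3 - 6 * int v4 - int v5 + 2 * int v6"
    "a 3 = 13 * (int s - int k) + 11 * int t - 5 * int v1 - 5 * int v2 - 3 * int v3 - 8 * int v4 - 2 * int v5 + int v6"
    "a 4 = 13 * (int s - int k) + int t + int v1 + int v2 + 2 * int v3 + int v4 + int v5 + 2 * int v6"
    "a 5 = 13 * (int s - int k) + 12 * int t - 6 * int v1 - 5 * int v2 - 3 * int v3 - 10 * int v4 - 2 * int v5 + int v6"
    "a 6 = 13 * (int s - int k) + 18 * int t - 10 * int v1 - 8 * int v2 - 6 * int v3 - 15 * int v4 - 5 * int v5 + int v6"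
proof -
  have W': "12 * int v1 + 11 * int v2 + 8 * int v3 + 18 * int v4 + 7 * int v5 + int v6 = 19 * int t"
    using W by linarith
  have d: "x div 19 = y" if "x = 19 * y" for x y :: int using that by simp
  have e: "a j = 13 * (int s - int k) + (\<Sum>(c, v)\<leftarrow>zip (exponent_coeffs ! (j - 1)) [v1, v2, v3, v4, v5, v6]. c * int v) div 19"
    if "j \<in> {1..6}" for j
    using that by (simp add: a_def exponents_of_def)
  have 1: "(\<Sum>(c, v)\<leftarrow>zip (exponent_coeffs ! (1 - 1)) [v1, v2, v3, v4, v5, v6]. c * int v) div 19 = 7 * int t - 2 * int v1 - 2 * int v2 - int v3 - 5 * int v4 - int v5 + int v6"
    by (rule d) (use W' in \<open>simp add: exponent_coeffs_def\<close>)
  have 2: "(\<Sum>(c, v)\<leftarrow>zip (exponent_coeffs ! (2 - 1)) [v1, v2, v3, v4, v5, v6]. c * int v) div 19 = 8 * int t - 3 * int v1 - 3 * int v2 - 2 * int v3 - 6 * int v4 - int v5 + 2 * int v6"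
    by (rule d) (use W' in \<open>simp add: exponent_coeffs_def\<close>)
  have 3: "(\<Sum>(c, v)\<leftarrow>zip (exponent_coeffs ! (3 - 1)) [v1, v2, v3, v4, v5, v6]. c * int v) div 19 = 11 * int t - 5 * int v1 - 5 * int v2 - 3 * int v3 - 8 * int v4 - 2 * int v5 + int v6"
    by (rule d) (use W' in \<open>simp add: exponent_coeffs_def\<close>)
  have 4: "(\<Sum>(c, v)\<leftarrow>zip (exponent_coeffs ! (4 - 1)) [v1, v2, v3, v4, v5, v6]. c * int v) div 19 = int t + int v1 + int v2 + 2 * int v3 + int v4 + int v5 + 2 * int v6"
    by (rule d) (use W' in \<open>simp add: exponent_coeffs_def\<close>)
  have 5: "(\<Sum>(c, v)\<leftarrow>zip (exponent_coeffs ! (5 - 1)) [v1, v2, v3, v4, v5, v6]. c * int v) div 19 = 12 * int t - 6 * int v1 - 5 * int v2 - 3 * int v3 - 10 * int v4 - 2 * int v5 + int v6"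
    by (rule d) (use W' in \<open>simp add: exponent_coeffs_def\<close>)
  have 6: "(\<Sum>(c, v)\<leftarrow>zip (exponent_coeffs ! (6 - 1)) [v1, v2, v3, v4, v5, v6]. c * int v) div 19 = 18 * int t - 10 * int v1 - 8 * int v2 - 6 * int v3 - 15 * int v4 - 5 * int v5 + int v6"
    by (rule d) (use W' in \<open>simp add: exponent_coeffs_def\<close>)
  show "a 1 = 13 * (int s - int k) + 7 * int t - 2 * int v1 - 2 * int v2 - int v3 - 5 * int v4 - int v5 + int v6"
    using e[of 1] 1 by simp
  show "a 2 = 13 * (int s - int k) + 8 * int t - 3 * int v1 - 3 * int v2 - 2 * int v3 - 6 * int v4 - int v5 + 2 * int v6"
    using e[of 2] 2 by simp
  show "a 3 = 13 * (int s - int k) + 11 * int t - 5 * int v1 - 5 * int v2 - 3 * int v3 - 8 * int v4 - 2 * int v5 + int v6"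
    using e[of 3] 3 by simp
  show "a 4 = 13 * (int s - int k) + int t + int v1 + int v2 + 2 * int v3 + int v4 + int v5 + 2 * int v6"
    using e[of 4] 4 by simp
  show "a 5 = 13 * (int s - int k) + 12 * int t - 6 * int v1 - 5 * int v2 - 3 * int v3 - 10 * int v4 - 2 * int v5 + int v6"
    using e[of 5] 5 by simp
  show "a 6 = 13 * (int s - int k) + 18 * int t - 10 * int v1 - 8 * int v2 - 6 * int v3 - 15 * int v4 - 5 * int v5 + int v6"
    using e[of 6] 6 by simp
qed

lemma divisors_iff:
  "(s, [v1, v2, v3, v4, v5, v6]) \<in> divisors k \<longleftrightarrow>
     v1 + v2 + v3 + v4 + v5 + v6 + 6 * s = 7 * k \<and>
     19 dvd 12 * v1 + 11 * v2 + 8 * v3 + 18 * v4 + 7 * v5 + v6"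
proof -
  have "(s, [v1, v2, v3, v4, v5, v6]) \<in> divisors k \<longleftrightarrow>
    6 * s \<le> 7 * k \<and> v1 + v2 + v3 + v4 + v5 + v6 = 7 * k - 6 * s \<and>
     (12 * v1 + 11 * v2 + 8 * v3 + 18 * v4 + 7 * v5 + v6) mod 19 = 0"
    by (simp add: divisors_def weighted_compositions_def add.assoc)
  moreover have "6 * s \<le> 7 * k \<and> v1 + v2 + v3 + v4 + v5 + v6 = 7 * k - 6 * s
      \<longleftrightarrow> v1 + v2 + v3 + v4 + v5 + v6 + 6 * s = 7 * k" by auto
  ultimately show ?thesis unfolding dvd_eq_mod_eq_0 by (simp only: conj_assoc[symmetric])
qed

lemma divisor_of_in_divisors:
  assumes "a \<in> admissible k"
  shows "divisor_of k a \<in> divisors k" and "exponents_of k (divisor_of k a) = a"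
proof -
  from assms have dvd12: "12 dvd int k + (\<Sum>j=1..6. a j)"
    and S: "13 dvd (\<Sum>j=1..6. int j ^ 2 * a j)" and K0: "0 \<le> int k + (\<Sum>j=1..6. a j)"
    and b: "\<And>i. i \<in> {1..6} \<Longrightarrow> 6 * residue_form i a \<le> 169 * (int k + (\<Sum>j=1..6. a j))"
    and ext: "a \<in> {1..6} \<rightarrow>\<^sub>E UNIV"
    unfolding admissible_def by blast+
  from dvd12 obtain s where s: "int k + (\<Sum>j=1..6. a j) = 12 * s" by blast
  have s0: "0 \<le> s" using K0 unfolding s by simp
  define v where "v = (\<lambda>i. nat (cusp_order k a i))"
  have v: "26 * int (v i) = 338 * s - residue_form i a" if "i \<in> {1..6}" for i
    using cusp_order_eq[OF s S, of i] b[OF that] unfolding s v_def by simp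
  have "26 * int (v 1) = 338 * s - residue_form 1 a" "26 * int (v 2) = 338 * s - residue_form 2 a"
    "26 * int (v 3) = 338 * s - residue_form 3 a" "26 * int (v 4) = 338 * s - residue_form 4 a"
    "26 * int (v 5) = 338 * s - residue_form 5 a" "26 * int (v 6) = 338 * s - residue_form 6 a"
    by (rule v, simp)+
  note ve = this[unfolded residue_form_explicit]
  have s': "int k + (a 1 + a 2 + a 3 + a 4 + a 5 + a 6) = 12 * s"
    using s unfolding sum_1_to_6 .
  have d: "divisor_of k a = (nat s, [v 1, v 2, v 3, v 4, v 5, v 6])"
    unfolding divisor_of_def s v_def by simp
  have sum: "int (v 1) + int (v 2) + int (v 3) + int (v 4) + int (v 5) + int (v 6) + 6 * s = 7 * int k"
    using ve s' by linarith
  \<comment> \<open>the weights form a linear relation modulo \<open>19\<close> between the rows of the order matrix\<close>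
  have "2 * (13 * (12 * int (v 1) + 11 * int (v 2) + 8 * int (v 3) + 18 * int (v 4) + 7 * int (v 5) + int (v 6)))
     = 2 * (19 * (507 * s - (42 * a 1 + 51 * a 2 + 40 * a 3 + 48 * a 4 + 49 * a 5 + 43 * a 6)))"
    using ve by algebra
  then have "13 * (12 * int (v 1) + 11 * int (v 2) + 8 * int (v 3) + 18 * int (v 4) + 7 * int (v 5) + int (v 6))
     = 19 * (507 * s - (42 * a 1 + 51 * a 2 + 40 * a 3 + 48 * a 4 + 49 * a 5 + 43 * a 6))"
    by (simp only: mult_cancel_left) simp
  then have "19 dvd 13 * (12 * int (v 1) + 11 * int (v 2) + 8 * int (v 3) + 18 * int (v 4) + 7 * int (v 5) + int (v 6))"
    by simp
  moreover have "prime (19::int)" "\<not> (19::int) dvd 13" by simp_all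
  ultimately have "19 dvd 12 * int (v 1) + 11 * int (v 2) + 8 * int (v 3) + 18 * int (v 4) + 7 * int (v 5) + int (v 6)"
    using prime_dvd_mult_iff by blast
  then have "int 19 dvd int (12 * v 1 + 11 * v 2 + 8 * v 3 + 18 * v 4 + 7 * v 5 + v 6)" by simp
  then have dvd: "19 dvd 12 * v 1 + 11 * v 2 + 8 * v 3 + 18 * v 4 + 7 * v 5 + v 6"
    by (simp only: of_nat_dvd_iff)
  have "v 1 + v 2 + v 3 + v 4 + v 5 + v 6 + 6 * nat s = 7 * k" using sum s0 by linarith
  then show "divisor_of k a \<in> divisors k" unfolding d divisors_iff using dvd by blast
  from dvd obtain t where t: "12 * v 1 + 11 * v 2 + 8 * v 3 + 18 * v 4 + 7 * v 5 + v 6 = 19 * t" by blast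
  then have t': "12 * int (v 1) + 11 * int (v 2) + 8 * int (v 3) + 18 * int (v 4) + 7 * int (v 5) + int (v 6) = 19 * int t"
    by linarith
  define b where "b = exponents_of k (nat s, [v 1, v 2, v 3, v 4, v 5, v 6])"
  have s_nat: "int (nat s) = s" using s0 by simp
  note be = exponents_of_eq[OF t, of k "nat s", folded b_def, unfolded s_nat]
  \<comment> \<open>\<open>494 = 19 * 26\<close> clears the denominators of \<open>t\<close> and of the orders\<close>
  have "494 * b 1 = 494 * a 1" "494 * b 2 = 494 * a 2" "494 * b 3 = 494 * a 3"
    "494 * b 4 = 494 * a 4" "494 * b 5 = 494 * a 5" "494 * b 6 = 494 * a 6"
    unfolding be using ve s' t' by algebra+
  then have ba: "b 1 = a 1" "b 2 = a 2" "b 3 = a 3" "b 4 = a 4" "b 5 = a 5" "b 6 = a 6" by simp_all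
  show "exponents_of k (divisor_of k a) = a"
  proof (rule extensionalityI[of _ "{1..6}"])
    show "exponents_of k (divisor_of k a) \<in> extensional {1..6}"
      by (simp add: exponents_of_def d)
    show "a \<in> extensional {1..6}" using ext by (simp add: PiE_def)
    fix j :: nat assume "j \<in> {1..6}"
    then have "j = 1 \<or> j = 2 \<or> j = 3 \<or> j = 4 \<or> j = 5 \<or> j = 6" by auto
    then show "exponents_of k (divisor_of k a) j = a j"
      unfolding d b_def[symmetric] using ba by (elim disjE) (simp_all only:)
  qed
qed

lemma exponents_of_admissible:
  assumes "x \<in> divisors k"
  shows "exponents_of k x \<in> admissible k" and "divisor_of k (exponents_of k x) = x"
proof -
  obtain s vs where x: "x = (s, vs)" by force
  have "length vs = 6" using assms by (auto simp: x divisors_def weighted_compositions_def)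
  then obtain v1 v2 v3 v4 v5 v6 where vs: "vs = [v1, v2, v3, v4, v5, v6]"
    by (auto simp: length_Suc_conv numeral_eq_Suc)
  have sum: "v1 + v2 + v3 + v4 + v5 + v6 + 6 * s = 7 * k"
    and "19 dvd 12 * v1 + 11 * v2 + 8 * v3 + 18 * v4 + 7 * v5 + v6"
    using assms unfolding x vs divisors_iff by blast+
  then obtain t where t: "12 * v1 + 11 * v2 + 8 * v3 + 18 * v4 + 7 * v5 + v6 = 19 * t" by blast
  have t': "12 * int v1 + 11 * int v2 + 8 * int v3 + 18 * int v4 + 7 * int v5 + int v6 = 19 * int t"
    using t by linarith
  have sum': "int v1 + int v2 + int v3 + int v4 + int v5 + int v6 + 6 * int s = 7 * int k"
    using sum by linarith
  define a where "a = exponents_of k x"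
  note ae = exponents_of_eq[OF t, of k s, folded vs x a_def]
  have K: "int k + (\<Sum>j=1..6. a j) = 12 * int s"
    unfolding sum_1_to_6 ae using t' sum' by algebra
  have rf: "residue_form 1 a = 338 * int s - 26 * int v1" "residue_form 2 a = 338 * int s - 26 * int v2"
    "residue_form 3 a = 338 * int s - 26 * int v3" "residue_form 4 a = 338 * int s - 26 * int v4"
    "residue_form 5 a = 338 * int s - 26 * int v5" "residue_form 6 a = 338 * int s - 26 * int v6"
    unfolding residue_form_explicit ae using t' sum' by algebra+
  have "13 dvd residue_form 1 a" unfolding rf by simp
  then have S: "13 dvd (\<Sum>j=1..6. int j ^ 2 * a j)"
    using residue_form_cong_13[of 1 a] by (simp add: dvd_add_right_iff)
  have "6 * residue_form i a \<le> 169 * (int k + (\<Sum>j=1..6. a j))" if "i \<in> {1..6}" for i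
  proof -
    have "i = 1 \<or> i = 2 \<or> i = 3 \<or> i = 4 \<or> i = 5 \<or> i = 6" using that by auto
    then show ?thesis unfolding K using rf by (elim disjE) simp_all
  qed
  moreover have "a \<in> {1..6} \<rightarrow>\<^sub>E UNIV" by (simp add: a_def x exponents_of_def)
  moreover have "12 dvd int k + (\<Sum>j=1..6. a j)" "0 \<le> int k + (\<Sum>j=1..6. a j)"
    unfolding K by simp_all
  ultimately show "exponents_of k x \<in> admissible k"
    unfolding a_def[symmetric] admissible_def using S by blast
  have "cusp_order k a 1 = int v1" "cusp_order k a 2 = int v2" "cusp_order k a 3 = int v3"
    "cusp_order k a 4 = int v4" "cusp_order k a 5 = int v5" "cusp_order k a 6 = int v6"
    unfolding cusp_order_def K rf by simp_all
  then have "divisor_of k a = (s, vs)" unfolding divisor_of_def K vs by simp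
  then show "divisor_of k (exponents_of k x) = x" by (simp only: a_def x)
qed

lemma card_admissible: "finite (admissible k)" "int (card (admissible k)) = divisor_count k"
proof -
  have "bij_betw (divisor_of k) (admissible k) (divisors k)"
    by (rule bij_betw_byWitness[where f' = "exponents_of k"])
       (auto simp: divisor_of_in_divisors exponents_of_admissible)
  moreover have fin: "finite (divisors k)"
    unfolding divisors_def by (intro finite_SigmaI finite_slack finite_weighted_compositions)
  ultimately show "finite (admissible k)" "int (card (admissible k)) = divisor_count k"
    by (simp_all add: bij_betw_finite bij_betw_same_card divisors_def card_SigmaI finite_slack
        finite_weighted_compositions divisor_count_def comp_count_def)
qed

lemma L_13_eq_admissible: "L 13 k = admissible k"
proof -
  have "(13 div 2 :: nat) = 6" by simp
  then show ?thesis
    unfolding L_def admissible_def theta_prod_modular_form_iff by (simp only:)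
qed

theorem theorem5p3:
  fixes k :: nat
  shows "finite (L 13 k) \<and> real (card (L 13 k)) = T13 k + E13 k"
proof -
  have "real (card (L 13 k)) = real_of_int (divisor_count k)"
    unfolding L_13_eq_admissible card_admissible(2)[symmetric] by simp
  then show ?thesis
    using card_admissible(1) divisor_count_closed_form by (simp add: L_13_eq_admissible)
qed

end
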